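(* Let $a,m,\kappa,H>0$ and let $(\psi,\mathbf A)\in H^1(\widetilde\Omega;\mathbb C)\times H^1_{\rm div}(\widetilde\Omega;\mathbb R^2)$ be a weak solution of the Ginzburg–Landau equations. Then $$a\int_{\widetilde\Omega\setminus\Omega}|\psi|^4\,dx\le\int_\Omega|\psi|^4\,dx .$$
   Context: Setting. $\Omega,\widetilde\Omega\subset\mathbb R^2$ are fixed smooth, bounded, simply connected open sets with $\overline\Omega\subset\widetilde\Omega$. $\mathbf F$ is the unique vector field with $\operatorname{curl}\mathbf F=1$, $\operatorname{div}\mathbf F=0$ in $\widetilde\Omega$ and $\nu\cdot\mathbf F=0$ on $\partial\widetilde\Omega$ ($\nu$ the unit outward normal). $H^1_{\rm div}(\widetilde\Omega;\mathbb R^2)=\{\mathbf A\in H^1(\widetilde\Omega;\mathbb R^2):\operatorname{div}\mathbf A=0\text{ in }\widetilde\Omega,\ \nu\cdot\mathbf A=0\text{ on }\partial\widetilde\Omega\}$. Write $\nabla_{\mathbf A}=\nabla-i\mathbf A$. Let $w_m=1,\ V_a=-1$ in $\Omega$ and $w_m=\tfrac1m,\ V_a=a$ outside $\Omega$. A pair $(\psi,\mathbf A)\in H^1(\widetilde\Omega;\mathbb C)\times H^1(\widetilde\Omega;\mathbb R^2)$ is a weak solution of the Ginzburg–Landau equations (with parameters $\kappa,H$) if for all $\phi\in H^1(\widetilde\Omega;\mathbb C)$ and $\mathbf a\in H^1(\widetilde\Omega;\mathbb R^2)$ $$\int_{\widetilde\Omega}\Big(w_m\nabla_{\kappa H\mathbf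 A}\psi\cdot\overline{\nabla_{\kappa H\mathbf A}\phi}+\kappa^2(V_a\psi+\mathbf 1_\Omega|\psi|^2\psi)\overline\phi\Big)dx=0,$$ $$\int_{\widetilde\Omega}\Big(\operatorname{curl}(\mathbf A-\mathbf F)\operatorname{curl}\mathbf a-(\kappa H)^{-1}w_m\,{\rm Im}\big(\overline\psi\,\nabla_{\kappa H\mathbf A}\psi\big)\cdot\mathbf a\Big)dx=0 .$$ *)

theory Defs
  imports "HOL-Analysis.Analysis"
begin

section \<open>Smooth functions\<close>

definition partial_deriv :: "'n::finite \<Rightarrow> (real^'n \<Rightarrow> 'b::real_normed_vector) \<Rightarrow> real^'n \<Rightarrow> 'b"
  where "partial_deriv i f x = frechet_derivative f (at x) (axis i 1)"

fun iterated_partial_deriv ::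
    "'n::finite list \<Rightarrow> (real^'n \<Rightarrow> 'b::real_normed_vector) \<Rightarrow> real^'n \<Rightarrow> 'b" where
  "iterated_partial_deriv [] f = f"
| "iterated_partial_deriv (i # is) f = partial_deriv i (iterated_partial_deriv is f)"

text \<open>On an open set this is \<open>C\<^sup>\<infinity>\<close>: all iterated partial derivatives exist and are Frechet
  differentiable, hence continuous.\<close>

definition smooth_on :: "(real^'n::finite) set \<Rightarrow> (real^'n \<Rightarrow> 'b::real_normed_vector) \<Rightarrow> bool"
  where "smooth_on S f \<longleftrightarrow> (\<forall>is. \<forall>x\<in>S. iterated_partial_deriv is f differentiable (at x))"

definition gradient :: "(real^'n::finite \<Rightarrow> real) \<Rightarrow> real^'n \<Rightarrow> real^'n"
  where "gradient f x = (\<chi> i. partial_deriv i f x)"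


section \<open>Open sets with smooth boundary\<close>

text \<open>\<open>U\<close> lies locally on one side of its boundary, which is a regular level set of \<open>\<rho>\<close>.\<close>

definition local_defining_function ::
    "(real^'n::finite) set \<Rightarrow> real^'n \<Rightarrow> (real^'n) set \<Rightarrow> (real^'n \<Rightarrow> real) \<Rightarrow> bool"
  where "local_defining_function U x V \<rho> \<longleftrightarrow>
    open V \<and> x \<in> V \<and> smooth_on V \<rho> \<and> (\<forall>y\<in>V. gradient \<rho> y \<noteq> 0) \<and> U \<inter> V = {y \<in> V. \<rho> y < 0}"

definition smooth_boundary :: "(real^'n::finite) set \<Rightarrow> bool"
  where "smooth_boundary U \<longleftrightarrow> (\<forall>x\<in>frontier U. \<exists>V \<rho>. local_defining_function U x V \<rho>)"

definition outward_unit_normal :: "(real^'n::finite) set \<Rightarrow> real^'n \<Rightarrow> real^'n \<Rightarrow> bool"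
  where "outward_unit_normal U x \<nu> \<longleftrightarrow> x \<in> frontier U \<and>
    (\<exists>V \<rho>. local_defining_function U x V \<rho> \<and> \<nu> = gradient \<rho> x /\<^sub>R norm (gradient \<rho> x))"


section \<open>Weak derivatives and the Sobolev space \<open>H\<^sup>1\<close>\<close>

definition test_function :: "(real^'n::finite) set \<Rightarrow> (real^'n \<Rightarrow> real) \<Rightarrow> bool"
  where "test_function U \<phi> \<longleftrightarrow>
    smooth_on UNIV \<phi> \<and> (\<exists>K. compact K \<and> K \<subseteq> U \<and> (\<forall>x. x \<notin> K \<longrightarrow> \<phi> x = 0))"

definition locally_integrable_on ::
    "(real^'n::finite) set \<Rightarrow> (real^'n \<Rightarrow> 'b::{banach,second_countable_topology}) \<Rightarrow> bool"
  where "locally_integrable_on U f \<longleftrightarrow> (\<forall>K. compact K \<and> K \<subseteq> U \<longrightarrow> integrable (lebesgue_on K) f)"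

definition has_weak_partial :: "(real^'n::finite) set \<Rightarrow> 'n \<Rightarrow>
    (real^'n \<Rightarrow> 'b::{banach,second_countable_topology}) \<Rightarrow> (real^'n \<Rightarrow> 'b) \<Rightarrow> bool"
  where "has_weak_partial U i f g \<longleftrightarrow>
    locally_integrable_on U f \<and> locally_integrable_on U g \<and>
    (\<forall>\<phi>. test_function U \<phi> \<longrightarrow>
      (\<integral>x. partial_deriv i \<phi> x *\<^sub>R f x \<partial>lebesgue_on U) = - (\<integral>x. \<phi> x *\<^sub>R g x \<partial>lebesgue_on U))"

text \<open>A weak derivative is determined only up to a null set of \<open>U\<close>; the choice is immaterial, as
  it is used only under integrals and almost everywhere.\<close>

definition weak_partial :: "(real^'n::finite) set \<Rightarrow> 'n \<Rightarrow>
    (real^'n \<Rightarrow> 'b::{banach,second_countable_topology}) \<Rightarrow> real^'n \<Rightarrow> 'b"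
  where "weak_partial U i f = (SOME g. has_weak_partial U i f g)"

definition square_integrable :: "'a measure \<Rightarrow> ('a \<Rightarrow> 'b::{banach,second_countable_topology}) set"
  where "square_integrable M = {f \<in> borel_measurable M. integrable M (\<lambda>x. (norm (f x))\<^sup>2)}"

definition H1 :: "(real^'n::finite) set \<Rightarrow> (real^'n \<Rightarrow> 'b::{banach,second_countable_topology}) set"
  where "H1 U = {f \<in> square_integrable (lebesgue_on U).
    \<forall>i. \<exists>g \<in> square_integrable (lebesgue_on U). has_weak_partial U i f g}"

definition H1_norm ::
    "(real^'n::finite) set \<Rightarrow> (real^'n \<Rightarrow> 'b::{banach,second_countable_topology}) \<Rightarrow> real"
  where "H1_norm U f =
    sqrt (\<integral>x. (norm (f x))\<^sup>2 + (\<Sum>i\<in>UNIV. (norm (weak_partial U i f x))\<^sup>2) \<partial>lebesgue_on U)"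


section \<open>One-dimensional Hausdorff measure\<close>

text \<open>With this normalization it is arc length on smooth plane curves. Boundedness is required
  because \<open>diameter\<close> is unspecified on unbounded sets.\<close>

definition hausdorff1_content :: "real \<Rightarrow> 'a::metric_space set \<Rightarrow> ennreal"
  where "hausdorff1_content \<delta> S =
    (INF E\<in>{E :: nat \<Rightarrow> 'a set. S \<subseteq> (\<Union>i. E i) \<and> (\<forall>i. bounded (E i) \<and> diameter (E i) \<le> \<delta>)}.
      \<Sum>i. ennreal (diameter (E i)))"

definition hausdorff1_outer :: "'a::metric_space set \<Rightarrow> ennreal"
  where "hausdorff1_outer S = (SUP \<delta>\<in>{0<..}. hausdorff1_content \<delta> S)"

definition hausdorff1 :: "'a::metric_space measure"
  where "hausdorff1 =
    measure_of UNIV (lambda_system UNIV (Pow UNIV) hausdorff1_outer) hausdorff1_outer"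

lemma hausdorff1_content_UN:
  "hausdorff1_content \<delta> (\<Union>n. A n) \<le> (\<Sum>n. hausdorff1_content \<delta> (A n :: 'a::metric_space set))"
proof (rule ennreal_le_epsilon)
  fix e :: real
  assume fin: "(\<Sum>n. hausdorff1_content \<delta> (A n)) < top" and e: "0 < e"
  let ?C = "\<lambda>S. {E :: nat \<Rightarrow> 'a set. S \<subseteq> (\<Union>i. E i) \<and> (\<forall>i. bounded (E i) \<and> diameter (E i) \<le> \<delta>)}"
  have fn: "hausdorff1_content \<delta> (A n) < top" for n
    using fin by (metis ennreal_suminf_lessD)
  have "\<exists>E\<in>?C (A n). (\<Sum>i. ennreal (diameter (E i)))
      < hausdorff1_content \<delta> (A n) + ennreal (e * (1/2) ^ Suc n)" for n
  proof -
    have "hausdorff1_content \<delta> (A n) < hausdorff1_content \<delta> (A n) + ennreal (e * (1/2) ^ Suc n)"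
      using fn[of n] e by (simp add: less_top ennreal_zero_less_mult_iff)
    then show ?thesis
      unfolding hausdorff1_content_def[of \<delta> "A n"] by (simp only: INF_less_iff)
  qed
  then have "\<forall>n. \<exists>E. E \<in> ?C (A n) \<and> (\<Sum>i. ennreal (diameter (E i)))
      < hausdorff1_content \<delta> (A n) + ennreal (e * (1/2) ^ Suc n)"
    by blast
  from choice[OF this] obtain E where E: "\<And>n. E n \<in> ?C (A n)"
    and less: "\<And>n. (\<Sum>i. ennreal (diameter (E n i)))
      < hausdorff1_content \<delta> (A n) + ennreal (e * (1/2) ^ Suc n)"
    by blast
  define D where "D k = (case prod_decode k of (n, i) \<Rightarrow> E n i)" for k
  have "D \<in> ?C (\<Union>n. A n)"
  proof -
    have "x \<in> (\<Union>k. D k)" if x: "x \<in> A n" for x n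
    proof -
      obtain i where "x \<in> E n i" using E[of n] x by blast
      then have "x \<in> D (prod_encode (n, i))" by (simp add: D_def)
      then show ?thesis by blast
    qed
    moreover have "bounded (D k) \<and> diameter (D k) \<le> \<delta>" for k
      using E[of "fst (prod_decode k)"] by (simp add: D_def case_prod_beta)
    ultimately show ?thesis by blast
  qed
  then have "hausdorff1_content \<delta> (\<Union>n. A n) \<le> (\<Sum>k. ennreal (diameter (D k)))"
    unfolding hausdorff1_content_def by (rule INF_lower)
  also have "\<dots> = (\<Sum>n i. ennreal (diameter (E n i)))"
    using suminf_ennreal_2dimen[of "\<lambda>n. \<Sum>i. ennreal (diameter (E n i))"
        "\<lambda>p. ennreal (diameter (case p of (n, i) \<Rightarrow> E n i))"]
    unfolding D_def by simp
  also have "\<dots> \<le> (\<Sum>n. hausdorff1_content \<delta> (A n) + ennreal (e * (1/2) ^ Suc n))"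
    using less by (intro suminf_le less_imp_le) simp_all
  also have "\<dots> = (\<Sum>n. hausdorff1_content \<delta> (A n)) + (\<Sum>n. ennreal (e * (1/2) ^ Suc n))"
    by (intro suminf_add[symmetric]) simp_all
  also have "(\<Sum>n. ennreal (e * (1/2) ^ Suc n)) = ennreal e"
    using sums_mult[OF power_half_series, of e] e
    by (intro suminf_ennreal_eq) simp_all
  finally show "hausdorff1_content \<delta> (\<Union>n. A n) \<le> (\<Sum>n. hausdorff1_content \<delta> (A n)) + ennreal e" .
qed

lemma outer_measure_space_hausdorff1:
  "outer_measure_space (Pow UNIV) (hausdorff1_outer :: 'a::metric_space set \<Rightarrow> ennreal)"
  unfolding outer_measure_space_def
proof
  have "hausdorff1_content \<delta> ({} :: 'a set) = 0" if "\<delta> > 0" for \<delta>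
  proof -
    have "hausdorff1_content \<delta> ({} :: 'a set) \<le> (\<Sum>i::nat. ennreal (diameter ({} :: 'a set)))"
      unfolding hausdorff1_content_def using that by (intro INF_lower) auto
    then show ?thesis by simp
  qed
  then show "positive (Pow UNIV) (hausdorff1_outer :: 'a set \<Rightarrow> ennreal)"
    by (simp add: positive_def hausdorff1_outer_def cong: SUP_cong_simp)
  have mono: "hausdorff1_content \<delta> S \<le> hausdorff1_content \<delta> T" if "S \<subseteq> T" for S T :: "'a set" and \<delta>
    unfolding hausdorff1_content_def using that by (intro INF_superset_mono) auto
  have "hausdorff1_outer S \<le> hausdorff1_outer T" if "S \<subseteq> T" for S T :: "'a set"
    unfolding hausdorff1_outer_def by (intro SUP_mono') (rule mono[OF that])
  moreover have "hausdorff1_outer (\<Union>n. A n) \<le> (\<Sum>n. hausdorff1_outer (A n))"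
    for A :: "nat \<Rightarrow> 'a set"
    unfolding hausdorff1_outer_def[of "\<Union>n. A n"]
  proof (rule SUP_least)
    fix \<delta> :: real assume "\<delta> \<in> {0<..}"
    then have "hausdorff1_content \<delta> (A n) \<le> hausdorff1_outer (A n)" for n
      unfolding hausdorff1_outer_def by (rule SUP_upper)
    then show "hausdorff1_content \<delta> (\<Union>n. A n) \<le> (\<Sum>n. hausdorff1_outer (A n))"
      by (intro order_trans[OF hausdorff1_content_UN] suminf_le) auto
  qed
  ultimately show "increasing (Pow UNIV) (hausdorff1_outer :: 'a set \<Rightarrow> ennreal)
      \<and> countably_subadditive (Pow UNIV) (hausdorff1_outer :: 'a set \<Rightarrow> ennreal)"
    by (auto simp: increasing_def countably_subadditive_def)
qed

lemma emeasure_hausdorff1: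
  assumes "S \<in> sets (hausdorff1 :: 'a::metric_space measure)"
  shows "emeasure hausdorff1 S = hausdorff1_outer S"
proof -
  have "measure_space UNIV (lambda_system UNIV (Pow UNIV) hausdorff1_outer)
      (hausdorff1_outer :: 'a set \<Rightarrow> ennreal)"
    using sigma_algebra.caratheodory_lemma[OF sigma_algebra_Pow outer_measure_space_hausdorff1]
    by simp
  then show ?thesis
    using assms unfolding hausdorff1_def measure_space_def
    by (metis emeasure_measure_of_sigma sigma_algebra.sets_measure_of_eq)
qed


section \<open>Boundary values\<close>

definition boundary_measure :: "(real^2) set \<Rightarrow> (real^2) measure"
  where "boundary_measure U = restrict_space hausdorff1 (frontier U)"

text \<open>The Sobolev trace: the continuous extension to \<open>H\<^sup>1\<close>, with values in \<open>L\<^sup>2\<close> of the boundary, of the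
  restriction map on functions smooth up to the boundary.\<close>

definition has_trace :: "(real^2) set \<Rightarrow> (real^2 \<Rightarrow> 'b::{banach,second_countable_topology}) \<Rightarrow>
    (real^2 \<Rightarrow> 'b) \<Rightarrow> bool"
  where "has_trace U f g \<longleftrightarrow>
    f \<in> H1 U \<and> g \<in> square_integrable (boundary_measure U) \<and>
    (\<exists>u. (\<forall>n::nat. smooth_on UNIV (u n)) \<and>
      (\<lambda>n. H1_norm U (\<lambda>x. u n x - f x)) \<longlonglongrightarrow> 0 \<and>
      (\<lambda>n. \<integral>\<^sup>+x. ennreal ((norm (u n x - g x))\<^sup>2) \<partial>boundary_measure U) \<longlonglongrightarrow> 0)"

definition zero_normal_trace :: "(real^2) set \<Rightarrow> (real^2 \<Rightarrow> real^2) \<Rightarrow> bool"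
  where "zero_normal_trace U A \<longleftrightarrow>
    (\<exists>g. has_trace U A g \<and>
      (AE x in boundary_measure U. \<forall>\<nu>. outward_unit_normal U x \<nu> \<longrightarrow> \<nu> \<bullet> g x = 0))"


section \<open>The Ginzburg--Landau equations\<close>

definition weak_curl :: "(real^2) set \<Rightarrow> (real^2 \<Rightarrow> real^2) \<Rightarrow> real^2 \<Rightarrow> real"
  where "weak_curl U A x = weak_partial U 1 A x $ 2 - weak_partial U 2 A x $ 1"

definition weak_div :: "(real^2) set \<Rightarrow> (real^2 \<Rightarrow> real^2) \<Rightarrow> real^2 \<Rightarrow> real"
  where "weak_div U A x = weak_partial U 1 A x $ 1 + weak_partial U 2 A x $ 2"

definition H1_div :: "(real^2) set \<Rightarrow> (real^2 \<Rightarrow> real^2) set"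
  where "H1_div U = {A \<in> H1 U. (AE x in lebesgue_on U. weak_div U A x = 0) \<and> zero_normal_trace U A}"

text \<open>This determines \<open>F\<close> up to a null set.\<close>

definition unit_field_potential :: "(real^2) set \<Rightarrow> (real^2 \<Rightarrow> real^2) \<Rightarrow> bool"
  where "unit_field_potential U F \<longleftrightarrow> F \<in> H1_div U \<and> (AE x in lebesgue_on U. weak_curl U F x = 1)"

definition magnetic_gradient ::
    "(real^2) set \<Rightarrow> (real^2 \<Rightarrow> real^2) \<Rightarrow> (real^2 \<Rightarrow> complex) \<Rightarrow> real^2 \<Rightarrow> complex^2"
  where "magnetic_gradient U A \<psi> x =
    (\<chi> j. weak_partial U j \<psi> x - \<i> * complex_of_real (A x $ j) * \<psi> x)"

definition w_weight :: "(real^2) set \<Rightarrow> real \<Rightarrow> real^2 \<Rightarrow> real"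
  where "w_weight \<Omega> m x = (if x \<in> \<Omega> then 1 else 1 / m)"

definition V_potential :: "(real^2) set \<Rightarrow> real \<Rightarrow> real^2 \<Rightarrow> real"
  where "V_potential \<Omega> a x = (if x \<in> \<Omega> then - 1 else a)"

text \<open>\<open>has_bochner_integral\<close> says that the integral exists and has the given value. For \<open>H\<^sup>1\<close> functions on
  a smooth bounded plane domain existence is automatic, by the Sobolev embedding into all \<open>L\<^sup>p\<close> with
  \<open>p\<close> finite; it has to be explicit because \<open>lebesgue_integral\<close> is \<open>0\<close> on non-integrable functions.\<close>

definition GL_weak_solution ::
    "(real^2) set \<Rightarrow> (real^2) set \<Rightarrow> (real^2 \<Rightarrow> real^2) \<Rightarrow> real \<Rightarrow> real \<Rightarrow> real \<Rightarrow> real \<Rightarrow>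
     (real^2 \<Rightarrow> complex) \<Rightarrow> (real^2 \<Rightarrow> real^2) \<Rightarrow> bool"
  where "GL_weak_solution \<Omega> \<Omega>' F a m \<kappa> H \<psi> A \<longleftrightarrow>
    \<psi> \<in> H1 \<Omega>' \<and> A \<in> H1 \<Omega>' \<and>
    (\<forall>\<phi>\<in>H1 \<Omega>'. has_bochner_integral (lebesgue_on \<Omega>')
      (\<lambda>x. complex_of_real (w_weight \<Omega> m x) *
             (\<Sum>j\<in>UNIV. magnetic_gradient \<Omega>' (\<lambda>y. (\<kappa> * H) *\<^sub>R A y) \<psi> x $ j *
                        cnj (magnetic_gradient \<Omega>' (\<lambda>y. (\<kappa> * H) *\<^sub>R A y) \<phi> x $ j)) +
           complex_of_real (\<kappa>\<^sup>2) *
             (complex_of_real (V_potential \<Omega> a x) * \<psi> x +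
              complex_of_real (indicator \<Omega> x * (cmod (\<psi> x))\<^sup>2) * \<psi> x) * cnj (\<phi> x)) 0) \<and>
    (\<forall>b\<in>H1 \<Omega>'. has_bochner_integral (lebesgue_on \<Omega>')
      (\<lambda>x. weak_curl \<Omega>' (\<lambda>y. A y - F y) x * weak_curl \<Omega>' b x -
           inverse (\<kappa> * H) * w_weight \<Omega> m x *
             (\<Sum>j\<in>UNIV. Im (cnj (\<psi> x) * magnetic_gradient \<Omega>' (\<lambda>y. (\<kappa> * H) *\<^sub>R A y) \<psi> x $ j) * b x $ j)) 0)"

end

theory Submission
  imports Defs "HOL-Computational_Algebra.Polynomial"
begin

text \<open>Why the estimate holds. If \<open>\<bar>\<psi>\<bar>\<^sup>2\<psi>\<close> were admissible as a test function in the first equation, the real part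
  of the kinetic term would be nonnegative, because \<open>z \<mapsto> \<bar>z\<bar>\<^sup>2z\<close> is the gradient of a convex radial function and
  the magnetic part \<open>i A \<psi>\<close> is orthogonal to \<open>\<psi>\<close>. What remains is
  \[a \int_{\Omega'\setminus\Omega} |\psi|^4 + \int_\Omega |\psi|^6 \le \int_\Omega |\psi|^4 .\]
  The cube grows too fast to preserve \<open>H\<^sup>1\<close>, so it is replaced by the damped cube
  \<open>G\<^sub>\<epsilon>(z) = \<bar>z\<bar>\<^sup>2z / (1 + \<epsilon>\<bar>z\<bar>\<^sup>2)\<close>, whose derivative is bounded and Lipschitz. This gives the same inequality with every
  power divided by \<open>1 + \<epsilon>\<bar>\<psi>\<bar>\<^sup>2\<close> (\<open>GL_damped_inequality\<close>). Since \<open>2t\<^sup>2 \<le> t\<^sup>3 + t\<close>, the term with the sixth power absorbs half of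
  the right-hand side and leaves the bound \<open>\<integral>\<bar>\<psi>\<bar>\<^sup>2\<close>, uniformly in \<open>\<epsilon>\<close>; monotone convergence as \<open>\<epsilon> \<rightarrow> 0\<close> then yields
  both the integrability of \<open>\<bar>\<psi>\<bar>\<^sup>4\<close> and the inequality (\<open>quartic_inequality_limit\<close>). The terms of the equation are not
  treated one by one: its whole integrand is integrable, and dominates the part without derivatives.\<close>

text \<open>The analytic core is the chain rule \<open>\<nabla>(G \<circ> f) = G'(f) \<nabla>f\<close> for weak derivatives (\<open>H1_chain_rule\<close>).
  It is proved with difference quotients. Testing shows that for almost every \<open>x\<close>
  \<open>f(x + he) - f(x)\<close> is the integral of the weak derivative along the segment (\<open>AE_increment\<close>); hence increments
  of length \<open>h\<close> are of size \<open>h\<close> in \<open>L\<^sup>2\<close> (\<open>L2_increment\<close>). Since \<open>G'\<close> is Lipschitz, the Taylor remainder of \<open>G\<close> is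
  quadratic in the increment, so every error in the discrete integration by parts is \<open>O(h\<^sup>2)\<close>, and dividing by \<open>h\<close> leaves the
  chain rule. Passing from integrated to pointwise statements, and the uniqueness of weak derivatives that turns the arbitrary
  choice \<open>weak_partial\<close> into the computed one, rest on the fundamental lemma of the calculus of variations, for which
  sufficiently many test functions are constructed first.\<close>

section \<open>Test functions\<close>

text \<open>The functions \<open>p(1/t) exp(-1/t)\<close>, extended by \<open>0\<close>. Admitting a polynomial factor makes the family closed under
  differentiation, so that smoothness needs no formula for higher derivatives.\<close>
definition flat_exp :: "real poly \<Rightarrow> real \<Rightarrow> real"
  where "flat_exp p t = (if t > 0 then poly p (1 / t) * exp (- (1 / t)) else 0)"

text \<open>The decay that makes every \<open>flat_exp\<close> vanish to infinite order at \<open>0\<close>.\<close>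
lemma poly_times_exp_minus_tendsto_0:
  "((\<lambda>x. poly p x * exp (- x)) \<longlongrightarrow> 0) at_top" for p :: "real poly"
proof -
  have "((\<lambda>x. \<Sum>i\<le>degree p. coeff p i * (x ^ i / exp x)) \<longlongrightarrow> (\<Sum>i\<le>degree p. coeff p i * 0)) at_top"
    by (intro tendsto_sum tendsto_mult tendsto_const tendsto_power_div_exp_0)
  then show ?thesis
    by (simp add: poly_altdef exp_minus divide_inverse sum_distrib_right mult.assoc)
qed

lemma flat_exp_has_real_derivative:
  "(flat_exp p has_real_derivative flat_exp ([:0, 0, 1:] * (p - pderiv p)) t) (at t)"
proof -
  consider "t > 0" | "t < 0" | "t = 0" by linarith
  then show ?thesis
  proof cases
    case 1
    have "((\<lambda>t. poly p (1 / t) * exp (- (1 / t))) has_real_derivative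
        flat_exp ([:0, 0, 1:] * (p - pderiv p)) t) (at t)"
      using 1
      by (auto intro!: derivative_eq_intros DERIV_chain2[OF poly_DERIV] simp: flat_exp_def)
        (simp add: field_simps power2_eq_square)
    moreover have "eventually (\<lambda>s. s > 0) (nhds t)"
      using 1 eventually_nhds_in_open[of "{0<..}" t] by simp
    then have "eventually (\<lambda>s. flat_exp p s = poly p (1 / s) * exp (- (1 / s))) (nhds t)"
      by eventually_elim (simp add: flat_exp_def)
    ultimately show ?thesis
      by (subst DERIV_cong_ev[OF refl _ refl]) auto
  next
    case 2
    have "eventually (\<lambda>s. s < 0) (nhds t)"
      using 2 eventually_nhds_in_open[of "{..<0}" t] by simp
    then have "eventually (\<lambda>s. flat_exp p s = 0) (nhds t)"
      by eventually_elim (simp add: flat_exp_def)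
    then show ?thesis
      using 2 by (subst DERIV_cong_ev[OF refl _ refl]) (auto simp: flat_exp_def)
  next
    case 3
    have "((\<lambda>s. flat_exp p s / s) \<longlongrightarrow> 0) (at_right 0)"
    proof -
      have "((\<lambda>s. poly ([:0,1:] * p) (inverse s) * exp (- inverse s)) \<longlongrightarrow> 0) (at_right 0)"
        by (rule filterlim_compose[OF poly_times_exp_minus_tendsto_0 filterlim_inverse_at_top_right])
      moreover have "eventually (\<lambda>s::real. s > 0) (at_right 0)"
        by (simp add: eventually_at_right_less)
      then have "eventually (\<lambda>s. poly ([:0,1:] * p) (inverse s) * exp (- inverse s) = flat_exp p s / s) (at_right 0)"
        by eventually_elim (simp add: flat_exp_def field_simps)
      ultimately show ?thesis
        by (rule Lim_transform_eventually)
    qed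
    moreover have "((\<lambda>s. flat_exp p s / s) \<longlongrightarrow> 0) (at_left 0)"
      by (rule tendsto_eventually) (auto simp: flat_exp_def eventually_at_filter)
    ultimately have "((\<lambda>s. flat_exp p s / s) \<longlongrightarrow> 0) (at 0)"
      by (simp add: filterlim_split_at)
    then show ?thesis
      using 3 by (simp add: has_field_derivative_iff flat_exp_def)
  qed
qed

text \<open>Closed under sums because of the product rule; a function in this set is smooth because its derivative
  is in the set again.\<close>
inductive_set flat_functions :: "(real \<Rightarrow> real) set" where
  affine: "(\<lambda>t. flat_exp p (c * t + d)) \<in> flat_functions"
| add: "f \<in> flat_functions \<Longrightarrow> g \<in> flat_functions \<Longrightarrow> (\<lambda>t. f t + g t) \<in> flat_functions"
| mult: "f \<in> flat_functions \<Longrightarrow> g \<in> flat_functions \<Longrightarrow> (\<lambda>t. f t * g t) \<in> flat_functions"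

lemma flat_functions_closed_under_derivative:
  assumes "f \<in> flat_functions"
  shows "\<exists>f'\<in>flat_functions. \<forall>t. (f has_real_derivative f' t) (at t)"
  using assms
proof induction
  case (affine p c d)
  let ?q = "smult c ([:0, 0, 1:] * (p - pderiv p))"
  have "((\<lambda>t. flat_exp p (c * t + d)) has_real_derivative flat_exp ?q (c * t + d)) (at t)" for t
    by (rule DERIV_cong[OF DERIV_chain2[OF flat_exp_has_real_derivative]])
      (auto intro!: derivative_eq_intros simp: flat_exp_def)
  then show ?case by (intro bexI[of _ "\<lambda>t. flat_exp ?q (c * t + d)"] flat_functions.affine) auto
next
  case (add f g)
  then obtain f' g' where "f' \<in> flat_functions" "g' \<in> flat_functions"
    and "\<And>t. (f has_real_derivative f' t) (at t)" "\<And>t. (g has_real_derivative g' t) (at t)"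
    by blast
  then show ?case
    by (intro bexI[of _ "\<lambda>t. f' t + g' t"] flat_functions.add) (auto intro: DERIV_add)
next
  case (mult f g)
  then obtain f' g' where "f' \<in> flat_functions" "g' \<in> flat_functions"
    and "\<And>t. (f has_real_derivative f' t) (at t)" "\<And>t. (g has_real_derivative g' t) (at t)"
    by blast
  with mult show ?case
    by (intro bexI[of _ "\<lambda>t. f' t * g t + g' t * f t"] flat_functions.add flat_functions.mult) (auto intro: DERIV_mult)
qed

lemma flat_functions_derivatives:
  assumes "\<And>i. c i \<in> flat_functions"
  shows "\<exists>c'. \<forall>i. c' i \<in> flat_functions \<and> (\<forall>t. (c i has_real_derivative c' i t) (at t))"
  using assms flat_functions_closed_under_derivative by (intro choice) blast

text \<open>A partial derivative of a product of one-variable functions replaces a single factor by its derivative. So products of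
  flat functions are mapped to products of flat functions, and all iterated partial derivatives exist.\<close>
lemma partial_deriv_prod_coordinates:
  fixes b b' :: "'n::finite \<Rightarrow> real \<Rightarrow> real"
  assumes "\<And>i t. (b i has_real_derivative b' i t) (at t)"
  shows "(\<lambda>x::real^'n. \<Prod>i\<in>UNIV. b i (x $ i)) differentiable (at x)"
    and "partial_deriv j (\<lambda>x::real^'n. \<Prod>i\<in>UNIV. b i (x $ i)) x =
      (\<Prod>i\<in>UNIV. (if i = j then b' i else b i) (x $ i))"
proof -
  have 1: "((\<lambda>x::real^'n. b i (x $ i)) has_derivative (\<lambda>h. b' i (x $ i) * h $ i)) (at x)" for i
    using has_derivative_compose[where f = "\<lambda>x. x $ i" and g = "b i" and s = UNIV,
        OF bounded_linear_imp_has_derivative[OF bounded_linear_vec_nth]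
          assms[THEN has_field_derivative_imp_has_derivative]]
    by simp
  have D: "((\<lambda>x::real^'n. \<Prod>i\<in>UNIV. b i (x $ i)) has_derivative
      (\<lambda>h. \<Sum>i\<in>UNIV. (b' i (x $ i) * h $ i) * (\<Prod>l\<in>UNIV - {i}. b l (x $ l)))) (at x)"
    by (rule has_derivative_prod) (rule 1)
  then show "(\<lambda>x::real^'n. \<Prod>i\<in>UNIV. b i (x $ i)) differentiable (at x)"
    by (auto simp: differentiable_def)
  have "partial_deriv j (\<lambda>x::real^'n. \<Prod>i\<in>UNIV. b i (x $ i)) x =
      (\<Sum>i\<in>UNIV. (b' i (x $ i) * (axis j 1 :: real^'n) $ i) * (\<Prod>l\<in>UNIV - {i}. b l (x $ l)))"
    unfolding partial_deriv_def frechet_derivative_at[OF D, symmetric] ..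
  also have "\<dots> = (\<Sum>i\<in>UNIV. if i = j then b' i (x $ i) * (\<Prod>l\<in>UNIV - {i}. b l (x $ l)) else 0)"
    by (intro sum.cong) (auto simp: axis_def)
  also have "\<dots> = b' j (x $ j) * (\<Prod>l\<in>UNIV - {j}. b l (x $ l))"
    by simp
  also have "\<dots> = (\<Prod>i\<in>UNIV. (if i = j then b' i else b i) (x $ i))"
    by (subst prod.remove[of _ j]) (auto intro!: prod.cong)
  finally show "partial_deriv j (\<lambda>x::real^'n. \<Prod>i\<in>UNIV. b i (x $ i)) x =
      (\<Prod>i\<in>UNIV. (if i = j then b' i else b i) (x $ i))" .
qed

lemma smooth_on_prod_flat_functions:
  fixes b :: "'n::finite \<Rightarrow> real \<Rightarrow> real"
  assumes "\<And>i. b i \<in> flat_functions"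
  shows "smooth_on UNIV (\<lambda>x::real^'n. \<Prod>i\<in>UNIV. b i (x $ i))"
proof -
  have "\<exists>c. (\<forall>i. c i \<in> flat_functions) \<and>
      iterated_partial_deriv is (\<lambda>x::real^'n. \<Prod>i\<in>UNIV. b i (x $ i)) = (\<lambda>x. \<Prod>i\<in>UNIV. c i (x $ i))" for "is"
  proof (induction "is")
    case Nil
    then show ?case using assms by auto
  next
    case (Cons j js)
    then obtain c where c: "\<And>i. c i \<in> flat_functions" and
      eq: "iterated_partial_deriv js (\<lambda>x::real^'n. \<Prod>i\<in>UNIV. b i (x $ i)) = (\<lambda>x. \<Prod>i\<in>UNIV. c i (x $ i))"
      by blast
    obtain c' where c': "\<And>i. c' i \<in> flat_functions" "\<And>i t. (c i has_real_derivative c' i t) (at t)"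
      using flat_functions_derivatives[of c] c by auto
    show ?case
      using c c'
      by (intro exI[of _ "\<lambda>i. if i = j then c' i else c i"])
        (auto simp: eq partial_deriv_prod_coordinates(2)[OF c'(2)])
  qed
  moreover have "(\<lambda>x::real^'n. \<Prod>i\<in>UNIV. c i (x $ i)) differentiable (at x)"
    if c: "\<And>i. c i \<in> flat_functions" for c x
  proof -
    obtain c' where "\<And>i t. (c i has_real_derivative c' i t) (at t)"
      using flat_functions_derivatives[of c] c by auto
    then show ?thesis by (rule partial_deriv_prod_coordinates(1))
  qed
  ultimately show ?thesis
    unfolding smooth_on_def by metis
qed

text \<open>Positive exactly on the open box. As \<open>k\<close> grows, every factor tends to \<open>1\<close> inside, so the bumps increase to the indicator
  of the box.\<close>
definition box_bump :: "real^'n::finite \<Rightarrow> real^'n \<Rightarrow> nat \<Rightarrow> real^'n \<Rightarrow> real" where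
  "box_bump a b k x = (\<Prod>i\<in>UNIV. flat_exp 1 (real (Suc k) * (x $ i - a $ i)) *
      flat_exp 1 (real (Suc k) * (b $ i - x $ i)))"

lemma flat_exp_one_bounds: "0 \<le> flat_exp 1 t" "flat_exp 1 t \<le> 1"
  by (auto simp: flat_exp_def)

lemma box_bump_bounds: "0 \<le> box_bump a b k x" "box_bump a b k x \<le> 1"
  unfolding box_bump_def using flat_exp_one_bounds
  by (auto intro!: prod_nonneg prod_le_1 mult_le_one mult_nonneg_nonneg)

lemma box_bump_eq_0: "x \<notin> box a b \<Longrightarrow> box_bump a b k x = 0"
  unfolding box_bump_def
  by (auto simp: mem_box_cart flat_exp_def zero_less_mult_iff)

lemma test_function_box_bump:
  assumes "cbox a b \<subseteq> U"
  shows "test_function U (box_bump a b k)"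
proof -
  have "(\<lambda>t. flat_exp 1 (real (Suc k) * (t - a $ i)) * flat_exp 1 (real (Suc k) * (b $ i - t))) \<in> flat_functions" for i
    using flat_functions.mult[OF flat_functions.affine[of 1 "real (Suc k)" "- real (Suc k) * a $ i"]
        flat_functions.affine[of 1 "- real (Suc k)" "real (Suc k) * b $ i"]]
    by (simp add: algebra_simps)
  from smooth_on_prod_flat_functions[OF this] have "smooth_on UNIV (box_bump a b k)"
    unfolding box_bump_def .
  moreover have "\<forall>x. x \<notin> cbox a b \<longrightarrow> box_bump a b k x = 0"
    using box_bump_eq_0 box_subset_cbox by blast
  ultimately show ?thesis
    unfolding test_function_def using assms compact_cbox by blast
qed

lemma box_bump_tendsto_indicator: "(\<lambda>k. box_bump a b k x) \<longlonglongrightarrow> indicator (box a b) x"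
proof (cases "x \<in> box a b")
  case True
  have 1: "(\<lambda>k. flat_exp 1 (real (Suc k) * t)) \<longlonglongrightarrow> 1" if "t > 0" for t
  proof -
    have "(\<lambda>k. exp (- (1 / t * inverse (real (Suc k))))) \<longlonglongrightarrow> exp (- (1 / t * 0))"
      by (intro tendsto_intros LIMSEQ_inverse_real_of_nat)
    then show ?thesis using that by (simp add: flat_exp_def add_pos_nonneg field_simps)
  qed
  have "(\<lambda>k. box_bump a b k x) \<longlonglongrightarrow> (\<Prod>i\<in>(UNIV::'a set). 1 * 1)"
    unfolding box_bump_def using True
    by (intro tendsto_prod tendsto_mult 1) (auto simp: mem_box_cart)
  then show ?thesis using True by simp
next
  case False
  then show ?thesis by (simp add: box_bump_eq_0)
qed

section \<open>The fundamental lemma of the calculus of variations\<close>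

lemma AE_zero_if_integrals_zero:
  fixes u :: "'a \<Rightarrow> 'b::euclidean_space"
  assumes u: "integrable M u"
    and 0: "\<And>A. A \<in> sets M \<Longrightarrow> (\<integral>x. indicator A x *\<^sub>R u x \<partial>M) = 0"
  shows "AE x in M. u x = 0"
proof -
  have pos: "AE x in M. u x \<bullet> b \<le> 0" for b
  proof -
    let ?A = "{x \<in> space M. u x \<bullet> b > 0}"
    have [measurable]: "u \<in> borel_measurable M" using u by simp
    have A: "?A \<in> sets M" by measurable
    have int: "integrable M (\<lambda>x. indicator ?A x *\<^sub>R u x)"
      using A u by (rule integrable_mult_indicator)
    have "(\<integral>x. (indicator ?A x *\<^sub>R u x) \<bullet> b \<partial>M) = (\<integral>x. indicator ?A x *\<^sub>R u x \<partial>M) \<bullet> b"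
      by (rule integral_inner_left) (use int in simp)
    also have "\<dots> = 0" using 0[OF A] by simp
    finally have "AE x in M. (indicator ?A x *\<^sub>R u x) \<bullet> b = 0"
      by (subst (asm) integral_nonneg_eq_0_iff_AE)
        (use integrable_inner_left[OF int, of b] in \<open>auto simp del: inner_scaleR_left split: split_indicator\<close>)
    then show ?thesis
      using AE_space by eventually_elim (auto simp: indicator_def split: if_splits)
  qed
  have "AE x in M. \<forall>b\<in>Basis. u x \<bullet> b \<le> 0 \<and> u x \<bullet> - b \<le> 0"
    by (intro AE_finite_allI finite_Basis AE_conjI pos)
  then show ?thesis
    by eventually_elim (auto intro!: euclidean_eqI[of _ 0] antisym)
qed

text \<open>Boxes generate the Borel sets and are closed under intersection, so Dynkin's theorem extends the vanishing from boxes to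
  all Borel sets. The integral over the whole space starts the closure under complements.\<close>
lemma AE_zero_if_box_integrals_zero:
  fixes u :: "real^'n::finite \<Rightarrow> 'b::euclidean_space"
  assumes u: "integrable lborel u"
    and UNIV: "(\<integral>x. u x \<partial>lborel) = 0"
    and 0: "\<And>a b. (\<integral>x. indicator (box a b) x *\<^sub>R u x \<partial>lborel) = 0"
  shows "AE x in lborel. u x = 0"
proof (rule AE_zero_if_integrals_zero[OF u])
  fix A :: "(real^'n) set" assume "A \<in> sets lborel"
  then have A: "A \<in> sigma_sets UNIV (range (\<lambda>(a, b). box a b))"
    by (simp add: borel_eq_box)
  have "Int_stable (range (\<lambda>(a, b). box a b :: (real^'n) set))"
  proof (rule Int_stableI)
    fix X Y assume "X \<in> range (\<lambda>(a, b). box a b :: (real^'n) set)" "Y \<in> range (\<lambda>(a, b). box a b :: (real^'n) set)"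
    then obtain a b c d where "X = box a b" "Y = box c d" by auto
    then obtain p q where "X \<inter> Y = box p q" using box_Int_box by blast
    then show "X \<inter> Y \<in> range (\<lambda>(a, b). box a b)" by (intro image_eqI[of _ _ "(p, q)"]) auto
  qed
  moreover have "range (\<lambda>(a, b). box a b) \<subseteq> Pow (UNIV :: (real^'n) set)" by simp
  ultimately show "(\<integral>x. indicator A x *\<^sub>R u x \<partial>lborel) = 0"
    using A
  proof (induction rule: sigma_sets_induct_disjoint)
    case (basic X) then show ?case using 0 by auto
  next
    case empty then show ?case by simp
  next
    case (compl X)
    then have X: "X \<in> sets lborel" by (simp add: borel_eq_box)
    have "(\<integral>x. indicator (UNIV - X) x *\<^sub>R u x \<partial>lborel)
        = (\<integral>x. u x - indicator X x *\<^sub>R u x \<partial>lborel)"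
      by (intro Bochner_Integration.integral_cong) (auto simp: indicator_def)
    also have "\<dots> = (\<integral>x. u x \<partial>lborel) - (\<integral>x. indicator X x *\<^sub>R u x \<partial>lborel)"
      by (intro Bochner_Integration.integral_diff u integrable_mult_indicator X)
    finally show ?case using compl UNIV by simp
  next
    case (union X)
    then have X: "X i \<in> sets lborel" for i by (auto simp: borel_eq_box)
    have "(\<Union>i. X i) \<in> sets lborel" using X by blast
    then have "(LINT x:(\<Union>i. X i)|lborel. u x) = (\<Sum>i. LINT x:(X i)|lborel. u x)"
      using X union(1) u
      by (intro lebesgue_integral_countable_add)
        (auto simp: disjoint_family_on_def set_integrable_def intro!: integrable_mult_indicator)
    then show ?case using union(3) by (simp add: set_lebesgue_integral_def)
  qed
qed

text \<open>Dominated convergence along the bumps of the box.\<close>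
lemma box_integral_zero_if_test_integrals_zero:
  fixes u :: "real^'n::finite \<Rightarrow> 'b::euclidean_space"
  assumes u: "set_integrable lborel (cbox a b) u"
    and V: "cbox a b \<subseteq> V"
    and 0: "\<And>\<phi>. test_function V \<phi> \<Longrightarrow> (\<integral>x. \<phi> x *\<^sub>R u x \<partial>lborel) = 0"
  shows "(\<integral>x. indicator (box a b) x *\<^sub>R u x \<partial>lborel) = 0"
proof -
  let ?w = "\<lambda>x. indicator (cbox a b) x *\<^sub>R u x"
  have w: "integrable lborel ?w" using u by (simp add: set_integrable_def)
  have eq: "box_bump a b k x *\<^sub>R ?w x = box_bump a b k x *\<^sub>R u x" for k x
    using box_bump_eq_0[of x a b k] box_subset_cbox[of a b] by (auto simp: indicator_def)
  have eq2: "indicator (box a b) x *\<^sub>R ?w x = indicator (box a b) x *\<^sub>R u x" for x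
    using box_subset_cbox[of a b] by (auto simp: indicator_def)
  have m: "box_bump a b k \<in> borel_measurable lborel" for k
  proof -
    have "smooth_on UNIV (box_bump a b k)"
      using test_function_box_bump[of a b UNIV] by (simp add: test_function_def)
    then have "box_bump a b k differentiable (at x)" for x
      unfolding smooth_on_def by (metis UNIV_I iterated_partial_deriv.simps(1))
    then have "continuous_on UNIV (box_bump a b k)"
      by (intro differentiable_imp_continuous_on) (simp add: differentiable_on_def)
    then show ?thesis using borel_measurable_continuous_onI by simp
  qed
  have "(\<lambda>k. \<integral>x. box_bump a b k x *\<^sub>R ?w x \<partial>lborel) \<longlonglongrightarrow> (\<integral>x. indicator (box a b) x *\<^sub>R ?w x \<partial>lborel)"
  proof (rule integral_dominated_convergence)
    show "integrable lborel (\<lambda>x. norm (?w x))" using w by (rule integrable_norm)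
    show "AE x in lborel. (\<lambda>k. box_bump a b k x *\<^sub>R ?w x) \<longlonglongrightarrow> indicator (box a b) x *\<^sub>R ?w x"
      by (intro AE_I2 tendsto_scaleR box_bump_tendsto_indicator tendsto_const)
    show "AE x in lborel. norm (box_bump a b k x *\<^sub>R ?w x) \<le> norm (?w x)" for k
    proof (rule AE_I2)
      fix x
      have "norm (box_bump a b k x *\<^sub>R ?w x) = box_bump a b k x * norm (?w x)"
        using box_bump_bounds(1)[of a b k x] by (simp only: norm_scaleR real_norm_def abs_of_nonneg)
      also have "\<dots> \<le> 1 * norm (?w x)"
        by (rule mult_right_mono[OF box_bump_bounds(2) norm_ge_zero])
      finally show "norm (box_bump a b k x *\<^sub>R ?w x) \<le> norm (?w x)" by simp
    qed
    show "(\<lambda>x. indicator (box a b) x *\<^sub>R ?w x) \<in> borel_measurable lborel"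
      by (intro borel_measurable_scaleR borel_measurable_integrable[OF w]) simp
    show "(\<lambda>x. box_bump a b k x *\<^sub>R ?w x) \<in> borel_measurable lborel" for k
      by (intro borel_measurable_scaleR borel_measurable_integrable[OF w] m)
  qed
  moreover have "(\<integral>x. box_bump a b k x *\<^sub>R ?w x \<partial>lborel) = 0" for k
    unfolding eq by (rule 0[OF test_function_box_bump[OF V]])
  ultimately show ?thesis
    unfolding eq2 by (simp add: LIMSEQ_const_iff)
qed

text \<open>An open set is a countable union of closed boxes, so it suffices to work in one box; there \<open>u\<close> is integrable and the
  intersection with a second box is a box again.\<close>
lemma fundamental_lemma:
  fixes u :: "real^'n::finite \<Rightarrow> 'b::euclidean_space"
  assumes V: "open V"
    and u: "\<And>K. compact K \<Longrightarrow> K \<subseteq> V \<Longrightarrow> set_integrable lborel K u"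
    and 0: "\<And>\<phi>. test_function V \<phi> \<Longrightarrow> (\<integral>x. \<phi> x *\<^sub>R u x \<partial>lborel) = 0"
  shows "AE x in lborel. x \<in> V \<longrightarrow> u x = 0"
proof -
  obtain D where D: "countable D" "\<Union>D = V" "\<And>X. X \<in> D \<Longrightarrow> X \<subseteq> V"
    and box: "\<And>X. X \<in> D \<Longrightarrow> \<exists>a b. X = cbox a b"
    using open_countable_Union_open_cbox[OF V] by (metis Pow_iff subset_iff)
  have "AE x in lborel. x \<in> X \<longrightarrow> u x = 0" if X: "X \<in> D" for X
  proof -
    obtain a b where ab: "X = cbox a b" using box[OF X] by blast
    with D X have V: "cbox a b \<subseteq> V" by blast
    let ?w = "\<lambda>x. indicator (box a b) x *\<^sub>R u x"
    have ui: "set_integrable lborel (cbox p q) u" if "cbox p q \<subseteq> cbox a b" for p q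
      using u[of "cbox p q"] that V by auto
    have "set_integrable lborel (box a b) u"
      using ui[OF order_refl] by (rule set_integrable_subset) (auto simp: box_subset_cbox)
    then have w: "integrable lborel ?w" by (simp add: set_integrable_def)
    have sub: "(\<integral>x. indicator (box p q) x *\<^sub>R u x \<partial>lborel) = 0" if "box p q \<subseteq> box a b" for p q
    proof (cases "box p q = {}")
      case False
      moreover have "box a b \<noteq> {}" using False that by auto
      ultimately have "cbox p q \<subseteq> cbox a b"
        using closure_mono[OF that] by (simp add: closure_box)
      then show ?thesis
        using V by (intro box_integral_zero_if_test_integrals_zero[OF ui _ 0]) auto
    qed simp
    have "AE x in lborel. ?w x = 0"
    proof (rule AE_zero_if_box_integrals_zero[OF w])
      show "integral\<^sup>L lborel ?w = 0" by (rule sub) simp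
      fix p q :: "real^'n"
      obtain p' q' where pq: "box p q \<inter> box a b = box p' q'" by (rule that[OF box_Int_box])
      have "(\<integral>x. indicator (box p q) x *\<^sub>R ?w x \<partial>lborel) = (\<integral>x. indicator (box p' q') x *\<^sub>R u x \<partial>lborel)"
        unfolding pq[symmetric]
        by (intro Bochner_Integration.integral_cong) (auto simp: indicator_def)
      also have "\<dots> = 0" using pq by (intro sub) auto
      finally show "(\<integral>x. indicator (box p q) x *\<^sub>R ?w x \<partial>lborel) = 0" .
    qed
    moreover have "cbox a b - box a b \<in> null_sets lborel"
      by (simp add: null_sets_def emeasure_Diff emeasure_lborel_cbox_eq emeasure_lborel_box_eq box_subset_cbox)
    then have "AE x in lborel. x \<notin> cbox a b - box a b" by (rule AE_not_in)
    ultimately show ?thesis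
      unfolding ab by eventually_elim (auto simp: indicator_def split: if_splits)
  qed
  then have "AE x in lborel. \<forall>X\<in>D. x \<in> X \<longrightarrow> u x = 0"
    by (simp only: AE_ball_countable[OF D(1)]) blast
  then show ?thesis
    by eventually_elim (use D(2) in blast)
qed

section \<open>Derivatives and translates of smooth functions\<close>

lemma smooth_on_differentiable:
  assumes "smooth_on UNIV \<phi>"
  shows "\<phi> differentiable (at x)"
  using assms unfolding smooth_on_def by (metis UNIV_I iterated_partial_deriv.simps(1))

lemma smooth_on_imp_continuous_on: "smooth_on UNIV \<phi> \<Longrightarrow> continuous_on UNIV \<phi>"
  by (intro differentiable_imp_continuous_on) (simp add: differentiable_on_def smooth_on_differentiable)

lemma smooth_on_borel_measurable: "smooth_on UNIV \<phi> \<Longrightarrow> \<phi> \<in> borel_measurable borel"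
  by (intro borel_measurable_continuous_onI smooth_on_imp_continuous_on)

lemma smooth_on_partial_deriv:
  assumes "smooth_on S \<phi>"
  shows "smooth_on S (partial_deriv i \<phi>)"
proof -
  have "iterated_partial_deriv is (partial_deriv i \<phi>) = iterated_partial_deriv (is @ [i]) \<phi>" for "is"
    by (induction "is") auto
  with assms show ?thesis unfolding smooth_on_def by metis
qed

lemma smooth_on_has_vector_derivative_line:
  assumes "smooth_on UNIV \<phi>"
  shows "((\<lambda>t. \<phi> (x + t *\<^sub>R axis i 1)) has_vector_derivative partial_deriv i \<phi> (x + t *\<^sub>R axis i 1)) (at t within S)"
proof -
  have D: "(\<phi> has_derivative frechet_derivative \<phi> (at (x + t *\<^sub>R axis i 1))) (at (x + t *\<^sub>R axis i 1))"
    using smooth_on_differentiable[OF assms] by (simp add: frechet_derivative_works)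
  have "((\<lambda>t. x + t *\<^sub>R axis i 1) has_derivative (\<lambda>s. s *\<^sub>R axis i 1)) (at t within S)"
    by (auto intro!: derivative_eq_intros)
  from has_derivative_compose[OF this D] have "((\<lambda>t. \<phi> (x + t *\<^sub>R axis i 1)) has_derivative
      (\<lambda>s. frechet_derivative \<phi> (at (x + t *\<^sub>R axis i 1)) (s *\<^sub>R axis i 1))) (at t within S)" .
  moreover have "linear (frechet_derivative \<phi> (at (x + t *\<^sub>R axis i 1)))"
    by (intro linear_frechet_derivative smooth_on_differentiable[OF assms])
  ultimately show ?thesis
    unfolding has_vector_derivative_def partial_deriv_def by (simp add: linear_cmul)
qed

lemma has_derivative_translate:
  fixes \<phi> :: "real^'n::finite \<Rightarrow> 'b::real_normed_vector"
  assumes "smooth_on UNIV \<phi>"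
  shows "((\<lambda>x. \<phi> (x - c)) has_derivative frechet_derivative \<phi> (at (x - c))) (at x)"
proof -
  have D: "(\<phi> has_derivative frechet_derivative \<phi> (at (x - c))) (at (x - c))"
    using smooth_on_differentiable[OF assms] by (simp add: frechet_derivative_works)
  have "((\<lambda>x. x - c) has_derivative (\<lambda>h. h)) (at x)"
    by (auto intro!: derivative_eq_intros)
  from has_derivative_compose[OF this D] show ?thesis .
qed

lemma partial_deriv_translate:
  assumes "smooth_on UNIV \<phi>"
  shows "partial_deriv i (\<lambda>x. \<phi> (x - c)) = (\<lambda>x. partial_deriv i \<phi> (x - c))"
  by (rule ext)
    (simp add: partial_deriv_def frechet_derivative_at[OF has_derivative_translate[OF assms], symmetric])

lemma smooth_on_translate:
  assumes "smooth_on UNIV \<phi>"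
  shows "smooth_on UNIV (\<lambda>x. \<phi> (x - c))"
proof -
  have smooth: "smooth_on UNIV (iterated_partial_deriv is \<phi>)" for "is"
    by (induction "is") (auto intro: assms smooth_on_partial_deriv)
  have "iterated_partial_deriv is (\<lambda>x. \<phi> (x - c)) = (\<lambda>x. iterated_partial_deriv is \<phi> (x - c))" for "is"
    by (induction "is") (simp_all add: partial_deriv_translate smooth)
  then show ?thesis
    unfolding smooth_on_def using has_derivative_translate[OF smooth] by (metis differentiable_def)
qed

lemma test_function_smooth: "test_function U \<phi> \<Longrightarrow> smooth_on UNIV \<phi>"
  by (simp add: test_function_def)

lemma partial_deriv_eq_0_outside:
  assumes "closed K" "\<And>x. x \<notin> K \<Longrightarrow> \<phi> x = 0" "x \<notin> K"
  shows "partial_deriv i \<phi> x = 0"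
proof -
  have "(\<phi> has_derivative (\<lambda>_. 0)) (at x)"
    by (rule has_derivative_transform_within_open[of "\<lambda>_. 0" _ _ _ "- K"]) (use assms in auto)
  then show ?thesis unfolding partial_deriv_def by (simp flip: frechet_derivative_at)
qed

lemma test_function_partial_deriv:
  assumes "test_function U \<phi>"
  shows "test_function U (partial_deriv i \<phi>)"
proof -
  obtain K where K: "compact K" "K \<subseteq> U" "\<And>x. x \<notin> K \<Longrightarrow> \<phi> x = 0"
    using assms unfolding test_function_def by blast
  then have "\<forall>x. x \<notin> K \<longrightarrow> partial_deriv i \<phi> x = 0"
    using partial_deriv_eq_0_outside compact_imp_closed by blast
  with K show ?thesis
    using smooth_on_partial_deriv[OF test_function_smooth[OF assms]] unfolding test_function_def by blast
qed

lemma test_function_bounded: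
  assumes "test_function U \<phi>"
  shows "\<exists>C\<ge>0. \<forall>x. \<bar>\<phi> x\<bar> \<le> C"
proof -
  obtain K where K: "compact K" "\<And>x. x \<notin> K \<Longrightarrow> \<phi> x = 0"
    using assms unfolding test_function_def by blast
  have "bounded (\<phi> ` K)"
    using smooth_on_imp_continuous_on[OF test_function_smooth[OF assms]] K(1)
    by (intro compact_imp_bounded compact_continuous_image) (auto elim: continuous_on_subset)
  then obtain C where "C > 0" "\<And>x. x \<in> K \<Longrightarrow> \<bar>\<phi> x\<bar> \<le> C"
    by (auto simp: bounded_pos)
  with K(2) show ?thesis by (intro exI[of _ C]) (metis abs_zero less_imp_le)
qed

text \<open>Shifting by \<open>c\<close> leaves a test function of \<open>V\<close> a test function of \<open>U\<close> as soon as \<open>V + c \<subseteq> U\<close>. This is where the distance of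
  the support to the boundary limits the length of the increments.\<close>
lemma test_function_translate:
  assumes "test_function V \<phi>" and "\<And>x. x \<in> V \<Longrightarrow> x + c \<in> U"
  shows "test_function U (\<lambda>x. \<phi> (x - c))"
proof -
  obtain K where K: "compact K" "K \<subseteq> V" "\<And>x. x \<notin> K \<Longrightarrow> \<phi> x = 0"
    using assms unfolding test_function_def by blast
  let ?K = "(\<lambda>x. x + c) ` K"
  have "compact ?K" using K(1) by (intro compact_continuous_image continuous_intros)
  moreover have "?K \<subseteq> U" using K(2) assms(2) by blast
  moreover have "\<phi> (x - c) = 0" if "x \<notin> ?K" for x
    using that K(3)[of "x - c"] by (metis diff_add_cancel imageI)
  ultimately show ?thesis
    unfolding test_function_def
    using smooth_on_translate[OF test_function_smooth[OF assms(1)]] by blast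
qed

section \<open>Translations and Lebesgue measure\<close>

lemma integral_lborel_translate:
  fixes u :: "'a::euclidean_space \<Rightarrow> 'b::{banach, second_countable_topology}"
  assumes "u \<in> borel_measurable borel"
  shows "(\<integral>x. u (x + c) \<partial>lborel) = (\<integral>x. u x \<partial>lborel)"
proof -
  have "(\<integral>x. u x \<partial>lborel) = (\<integral>x. u x \<partial>distr lborel borel ((+) c))"
    by (simp only: lborel_distr_plus)
  also have "\<dots> = (\<integral>x. u (c + x) \<partial>lborel)"
    using assms by (intro integral_distr) auto
  finally show ?thesis by (simp add: add.commute)
qed

lemma nn_integral_lborel_translate:
  fixes u :: "'a::euclidean_space \<Rightarrow> ennreal"
  assumes "u \<in> borel_measurable borel"
  shows "(\<integral>\<^sup>+x. u (x + c) \<partial>lborel) = (\<integral>\<^sup>+x. u x \<partial>lborel)"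
proof -
  have "(\<integral>\<^sup>+x. u x \<partial>lborel) = (\<integral>\<^sup>+x. u x \<partial>distr lborel borel ((+) c))"
    by (simp only: lborel_distr_plus)
  also have "\<dots> = (\<integral>\<^sup>+x. u (c + x) \<partial>lborel)"
    using assms by (intro nn_integral_distr) auto
  finally show ?thesis by (simp add: add.commute)
qed

lemma integrable_lborel_translate:
  fixes u :: "'a::euclidean_space \<Rightarrow> 'b::{banach, second_countable_topology}"
  assumes "integrable lborel u"
  shows "integrable lborel (\<lambda>x. u (x + c))"
proof -
  have "integrable (distr lborel borel ((+) c)) u"
    using assms by (simp only: lborel_distr_plus)
  then have "integrable lborel (\<lambda>x. u (c + x))"
    by (subst (asm) integrable_distr_eq) (use borel_measurable_integrable[OF assms] in auto)
  then show ?thesis by (simp add: add.commute)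
qed

text \<open>The integrability on the product space that Fubini's theorem needs in the following section; with \<open>v = 0\<close> it also covers functions that
  are not shifted.\<close>
lemma integrable_moving_translates:
  fixes u :: "'a::euclidean_space \<Rightarrow> 'b::{banach, second_countable_topology}"
  assumes "integrable lborel u"
  shows "integrable (lborel \<Otimes>\<^sub>M lborel) (\<lambda>(t, x). indicator {0..h::real} t *\<^sub>R u (x + t *\<^sub>R v))"
proof (rule lborel_pair.Fubini_integrable)
  have [measurable]: "u \<in> borel_measurable borel" using borel_measurable_integrable[OF assms] by simp
  show "(\<lambda>(t, x). indicator {0..h} t *\<^sub>R u (x + t *\<^sub>R v)) \<in> borel_measurable (lborel \<Otimes>\<^sub>M lborel)"
    by measurable
  have "(\<integral>x. norm (case (t, x) of (t, x) \<Rightarrow> indicator {0..h} t *\<^sub>R u (x + t *\<^sub>R v)) \<partial>lborel)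
      = indicator {0..h} t *\<^sub>R (\<integral>x. norm (u x) \<partial>lborel)" for t
    using integral_lborel_translate[of "\<lambda>x. norm (u x)" "t *\<^sub>R v"] by simp
  then show "integrable lborel (\<lambda>t. \<integral>x. norm (case (t, x) of (t, x) \<Rightarrow> indicator {0..h} t *\<^sub>R u (x + t *\<^sub>R v)) \<partial>lborel)"
    using borel_integrable_atLeastAtMost'[of 0 h "\<lambda>_. \<integral>x. norm (u x) \<partial>lborel"]
    by (simp only: set_integrable_def continuous_on_const)
  show "AE t in lborel. integrable lborel (\<lambda>x. case (t, x) of (t, x) \<Rightarrow> indicator {0..h} t *\<^sub>R u (x + t *\<^sub>R v))"
    using integrable_lborel_translate[OF assms] by simp
qed

section \<open>Increments of functions with a weak derivative\<close>

lemma integrable_bounded_scaleR: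
  fixes u :: "'a::euclidean_space \<Rightarrow> 'c::{banach, second_countable_topology}"
  assumes "integrable lborel u" and [measurable]: "\<phi> \<in> borel_measurable borel" and "\<And>x. \<bar>\<phi> x\<bar> \<le> C"
  shows "integrable lborel (\<lambda>x. \<phi> x *\<^sub>R u x)"
proof (rule Bochner_Integration.integrable_bound)
  have [measurable]: "u \<in> borel_measurable borel"
    using borel_measurable_integrable[OF assms(1)] by simp
  show "integrable lborel (\<lambda>x. C * norm (u x))" using assms(1) by simp
  show "(\<lambda>x. \<phi> x *\<^sub>R u x) \<in> borel_measurable lborel" by measurable
  show "AE x in lborel. norm (\<phi> x *\<^sub>R u x) \<le> norm (C * norm (u x))"
  proof (rule AE_I2)
    fix x
    have "norm (\<phi> x *\<^sub>R u x) \<le> C * norm (u x)"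
      using assms(3) by (simp add: mult_right_mono)
    then show "norm (\<phi> x *\<^sub>R u x) \<le> norm (C * norm (u x))" by simp
  qed
qed

text \<open>The functions live on the whole space, are Borel measurable, and only the test functions are confined to \<open>U\<close>. In this way
  translations and Fubini's theorem for Borel measure apply directly. An \<open>H\<^sup>1\<close> function on a bounded open set is brought into this form below,
  by choosing a Borel version that vanishes outside the set.\<close>
locale weak_derivative =
  fixes U :: "(real^'n::finite) set" and i :: 'n
    and f g :: "real^'n \<Rightarrow> 'b::euclidean_space"
  assumes f: "integrable lborel f" and f2: "integrable lborel (\<lambda>x. (norm (f x))\<^sup>2)"
    and g: "integrable lborel g" and g2: "integrable lborel (\<lambda>x. (norm (g x))\<^sup>2)"
    and weak: "\<And>\<phi>. test_function U \<phi> \<Longrightarrow>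
      (\<integral>x. partial_deriv i \<phi> x *\<^sub>R f x \<partial>lborel) = - (\<integral>x. \<phi> x *\<^sub>R g x \<partial>lborel)"
begin

abbreviation e :: "real^'n" where "e \<equiv> axis i 1"

lemma f_measurable [measurable]: "f \<in> borel_measurable borel"
  using borel_measurable_integrable[OF f] by simp

lemma g_measurable [measurable]: "g \<in> borel_measurable borel"
  using borel_measurable_integrable[OF g] by simp

lemma test_increment:
  fixes \<phi> :: "real^'n \<Rightarrow> real"
  assumes \<phi>: "smooth_on UNIV \<phi>" and h: "0 \<le> h"
  shows "(\<integral>t. indicator {0..h} t *\<^sub>R partial_deriv i \<phi> (x - t *\<^sub>R e) \<partial>lborel) = \<phi> x - \<phi> (x - h *\<^sub>R e)"
proof -
  have "((\<lambda>t. - \<phi> (x - t *\<^sub>R e)) has_vector_derivative partial_deriv i \<phi> (x - t *\<^sub>R e)) (at t within S)" for t S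
  proof -
    have "((\<lambda>s. \<phi> (x + s *\<^sub>R e)) has_real_derivative partial_deriv i \<phi> (x + (- t) *\<^sub>R e)) (at (- t))"
      using smooth_on_has_vector_derivative_line[OF \<phi>, of x i "- t" UNIV]
      by (simp add: has_real_derivative_iff_has_vector_derivative)
    from DERIV_chain2[where f = "\<lambda>s. \<phi> (x + s *\<^sub>R e)" and g = uminus and x = t and s = S and Db = "- 1", OF this]
    have "((\<lambda>t. \<phi> (x + (- t) *\<^sub>R e)) has_real_derivative - partial_deriv i \<phi> (x - t *\<^sub>R e)) (at t within S)"
      using DERIV_minus[OF DERIV_ident, of t S] by simp
    from DERIV_minus[OF this]
    have "((\<lambda>t. - \<phi> (x - t *\<^sub>R e)) has_real_derivative partial_deriv i \<phi> (x - t *\<^sub>R e)) (at t within S)"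
      by simp
    then show ?thesis by (simp add: has_real_derivative_iff_has_vector_derivative)
  qed
  moreover have "continuous_on {0..h} (\<lambda>t. partial_deriv i \<phi> (x - t *\<^sub>R e))"
    by (rule continuous_on_compose2[OF smooth_on_imp_continuous_on[OF smooth_on_partial_deriv[OF \<phi>]]])
      (auto intro!: continuous_intros)
  ultimately show ?thesis
    using integral_FTC_atLeastAtMost[OF h, of "\<lambda>t. - \<phi> (x - t *\<^sub>R e)" "\<lambda>t. partial_deriv i \<phi> (x - t *\<^sub>R e)"]
    by simp
qed

text \<open>The increment of the test function is the integral of its derivative; Fubini's theorem moves that integral outside, the weak derivative takes
  over for each \<open>t\<close>, and a translation brings the shift back to \<open>g\<close>.\<close>
lemma weak_increment:
  assumes h: "0 \<le> h" and V: "\<And>x t. x \<in> V \<Longrightarrow> 0 \<le> t \<Longrightarrow> t \<le> h \<Longrightarrow> x + t *\<^sub>R e \<in> U"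
    and \<phi>: "test_function V \<phi>"
  shows "(\<integral>x. \<phi> x *\<^sub>R (f (x + h *\<^sub>R e) - f x) \<partial>lborel) =
    (\<integral>x. \<phi> x *\<^sub>R (\<integral>t. indicator {0..h} t *\<^sub>R g (x + t *\<^sub>R e) \<partial>lborel) \<partial>lborel)"
proof -
  note smooth = test_function_smooth[OF \<phi>]
  note smooth' = test_function_smooth[OF test_function_partial_deriv[OF \<phi>, of i]]
  have [measurable]: "\<phi> \<in> borel_measurable borel" "partial_deriv i \<phi> \<in> borel_measurable borel"
    using smooth smooth' by (auto intro: smooth_on_borel_measurable)
  obtain C where C: "\<And>x. \<bar>\<phi> x\<bar> \<le> C" using test_function_bounded[OF \<phi>] by blast
  obtain C' where C': "\<And>x. \<bar>partial_deriv i \<phi> x\<bar> \<le> C'"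
    using test_function_bounded[OF test_function_partial_deriv[OF \<phi>]] by blast
  have "(\<integral>x. \<phi> x *\<^sub>R (f (x + h *\<^sub>R e) - f x) \<partial>lborel)
      = (\<integral>x. \<phi> x *\<^sub>R f (x + h *\<^sub>R e) \<partial>lborel) - (\<integral>x. \<phi> x *\<^sub>R f x \<partial>lborel)"
    unfolding scaleR_diff_right
    by (intro Bochner_Integration.integral_diff integrable_bounded_scaleR[OF _ _ C] f integrable_lborel_translate) auto
  also have "(\<integral>x. \<phi> x *\<^sub>R f (x + h *\<^sub>R e) \<partial>lborel) = (\<integral>x. \<phi> (x - h *\<^sub>R e) *\<^sub>R f x \<partial>lborel)"
    using integral_lborel_translate[of "\<lambda>x. \<phi> (x - h *\<^sub>R e) *\<^sub>R f x" "h *\<^sub>R e"] by simp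
  also have "\<dots> - (\<integral>x. \<phi> x *\<^sub>R f x \<partial>lborel) = (\<integral>x. \<phi> (x - h *\<^sub>R e) *\<^sub>R f x - \<phi> x *\<^sub>R f x \<partial>lborel)"
    by (intro Bochner_Integration.integral_diff[symmetric] integrable_bounded_scaleR[OF _ _ C] f) auto
  also have "\<dots> = (\<integral>x. \<integral>t. - (indicator {0..h} t *\<^sub>R partial_deriv i \<phi> (x - t *\<^sub>R e) *\<^sub>R f x) \<partial>lborel \<partial>lborel)"
  proof (intro Bochner_Integration.integral_cong refl)
    fix x
    have "(\<integral>t. - (indicator {0..h} t *\<^sub>R partial_deriv i \<phi> (x - t *\<^sub>R e) *\<^sub>R f x) \<partial>lborel)
       = (\<integral>t. (indicator {0..h} t *\<^sub>R partial_deriv i \<phi> (x - t *\<^sub>R e)) *\<^sub>R - f x \<partial>lborel)"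
      by (intro Bochner_Integration.integral_cong) auto
    also have "\<dots> = (\<integral>t. indicator {0..h} t *\<^sub>R partial_deriv i \<phi> (x - t *\<^sub>R e) \<partial>lborel) *\<^sub>R - f x"
    proof (rule integral_scaleR_left)
      have "continuous_on {0..h} (\<lambda>t. partial_deriv i \<phi> (x - t *\<^sub>R e))"
        by (rule continuous_on_compose2[OF smooth_on_imp_continuous_on[OF smooth']])
          (auto intro!: continuous_intros)
      from borel_integrable_atLeastAtMost'[OF this]
      show "integrable lborel (\<lambda>t. indicator {0..h} t *\<^sub>R partial_deriv i \<phi> (x - t *\<^sub>R e))"
        by (simp add: set_integrable_def)
    qed
    finally show "\<phi> (x - h *\<^sub>R e) *\<^sub>R f x - \<phi> x *\<^sub>R f x =
        (\<integral>t. - (indicator {0..h} t *\<^sub>R partial_deriv i \<phi> (x - t *\<^sub>R e) *\<^sub>R f x) \<partial>lborel)"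
      by (simp only: test_increment[OF smooth h] scaleR_minus_right scaleR_diff_left minus_diff_eq)
  qed
  also have "\<dots> = (\<integral>t. \<integral>x. - (indicator {0..h} t *\<^sub>R partial_deriv i \<phi> (x - t *\<^sub>R e) *\<^sub>R f x) \<partial>lborel \<partial>lborel)"
  proof (rule lborel_pair.Fubini_integral)
    show "integrable (lborel \<Otimes>\<^sub>M lborel) (\<lambda>(t, x). - (indicator {0..h} t *\<^sub>R partial_deriv i \<phi> (x - t *\<^sub>R e) *\<^sub>R f x))"
    proof (rule Bochner_Integration.integrable_bound)
      show "integrable (lborel \<Otimes>\<^sub>M lborel) (\<lambda>p. C' *\<^sub>R (case p of (t, x) \<Rightarrow> indicator {0..h} t *\<^sub>R f (x + t *\<^sub>R 0)))"
        by (intro integrable_scaleR_right integrable_moving_translates f)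
      show "AE p in lborel \<Otimes>\<^sub>M lborel. norm (case p of (t, x) \<Rightarrow> - (indicator {0..h} t *\<^sub>R partial_deriv i \<phi> (x - t *\<^sub>R e) *\<^sub>R f x))
          \<le> norm (C' *\<^sub>R (case p of (t, x) \<Rightarrow> indicator {0..h} t *\<^sub>R f (x + t *\<^sub>R 0)))"
        using C' by (auto intro!: AE_I2 mult_right_mono order_trans[OF C' abs_ge_self] split: split_indicator)
    qed measurable
  qed
  also have "\<dots> = (\<integral>t. indicator {0..h} t *\<^sub>R (\<integral>x. \<phi> x *\<^sub>R g (x + t *\<^sub>R e) \<partial>lborel) \<partial>lborel)"
  proof (intro Bochner_Integration.integral_cong refl)
    fix t :: real
    have "- (\<integral>x. partial_deriv i \<phi> (x - t *\<^sub>R e) *\<^sub>R f x \<partial>lborel) = (\<integral>x. \<phi> x *\<^sub>R g (x + t *\<^sub>R e) \<partial>lborel)"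
      if t: "0 \<le> t" "t \<le> h"
    proof -
      have test: "test_function U (\<lambda>x. \<phi> (x - t *\<^sub>R e))"
        by (rule test_function_translate[OF \<phi>]) (use V t in auto)
      have "partial_deriv i (\<lambda>x. \<phi> (x - t *\<^sub>R e)) = (\<lambda>x. partial_deriv i \<phi> (x - t *\<^sub>R e))"
        by (rule partial_deriv_translate[OF smooth])
      with weak[OF test] have "- (\<integral>x. partial_deriv i \<phi> (x - t *\<^sub>R e) *\<^sub>R f x \<partial>lborel)
          = (\<integral>x. \<phi> (x - t *\<^sub>R e) *\<^sub>R g x \<partial>lborel)" by simp
      also have "\<dots> = (\<integral>x. \<phi> x *\<^sub>R g (x + t *\<^sub>R e) \<partial>lborel)"
        using integral_lborel_translate[of "\<lambda>x. \<phi> (x - t *\<^sub>R e) *\<^sub>R g x" "t *\<^sub>R e"] by simp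
      finally show ?thesis .
    qed
    then show "(\<integral>x. - (indicator {0..h} t *\<^sub>R partial_deriv i \<phi> (x - t *\<^sub>R e) *\<^sub>R f x) \<partial>lborel)
        = indicator {0..h} t *\<^sub>R (\<integral>x. \<phi> x *\<^sub>R g (x + t *\<^sub>R e) \<partial>lborel)"
      by (auto split: split_indicator)
  qed
  also have "\<dots> = (\<integral>t. \<integral>x. \<phi> x *\<^sub>R indicator {0..h} t *\<^sub>R g (x + t *\<^sub>R e) \<partial>lborel \<partial>lborel)"
    by (auto intro!: Bochner_Integration.integral_cong split: split_indicator)
  also have "\<dots> = (\<integral>x. \<integral>t. \<phi> x *\<^sub>R indicator {0..h} t *\<^sub>R g (x + t *\<^sub>R e) \<partial>lborel \<partial>lborel)"
  proof (rule lborel_pair.Fubini_integral[symmetric])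
    show "integrable (lborel \<Otimes>\<^sub>M lborel) (\<lambda>(t, x). \<phi> x *\<^sub>R indicator {0..h} t *\<^sub>R g (x + t *\<^sub>R e))"
    proof (rule Bochner_Integration.integrable_bound)
      show "integrable (lborel \<Otimes>\<^sub>M lborel) (\<lambda>p. C *\<^sub>R (case p of (t, x) \<Rightarrow> indicator {0..h} t *\<^sub>R g (x + t *\<^sub>R e)))"
        by (intro integrable_scaleR_right integrable_moving_translates g)
      show "AE p in lborel \<Otimes>\<^sub>M lborel. norm (case p of (t, x) \<Rightarrow> \<phi> x *\<^sub>R indicator {0..h} t *\<^sub>R g (x + t *\<^sub>R e))
          \<le> norm (C *\<^sub>R (case p of (t, x) \<Rightarrow> indicator {0..h} t *\<^sub>R g (x + t *\<^sub>R e)))"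
        using C by (auto intro!: AE_I2 mult_right_mono order_trans[OF C abs_ge_self] split: split_indicator)
    qed measurable
  qed
  also have "\<dots> = (\<integral>x. \<phi> x *\<^sub>R (\<integral>t. indicator {0..h} t *\<^sub>R g (x + t *\<^sub>R e) \<partial>lborel) \<partial>lborel)"
    by (simp only: integral_scaleR_right)
  finally show ?thesis .
qed

lemma AE_increment:
  assumes h: "0 \<le> h" and V: "open V" "\<And>x t. x \<in> V \<Longrightarrow> 0 \<le> t \<Longrightarrow> t \<le> h \<Longrightarrow> x + t *\<^sub>R e \<in> U"
  shows "AE x in lborel. x \<in> V \<longrightarrow>
    f (x + h *\<^sub>R e) - f x = (\<integral>t. indicator {0..h} t *\<^sub>R g (x + t *\<^sub>R e) \<partial>lborel)"
proof -
  let ?I = "\<lambda>x. \<integral>t. indicator {0..h} t *\<^sub>R g (x + t *\<^sub>R e) \<partial>lborel"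
  have I: "integrable lborel ?I"
    using lborel_pair.integrable_snd[of "\<lambda>t x. indicator {0..h} t *\<^sub>R g (x + t *\<^sub>R e)"]
      integrable_moving_translates[OF g, of h e] by simp
  have d: "integrable lborel (\<lambda>x. f (x + h *\<^sub>R e) - f x)"
    by (intro Bochner_Integration.integrable_diff integrable_lborel_translate f)
  have "AE x in lborel. x \<in> V \<longrightarrow> f (x + h *\<^sub>R e) - f x - ?I x = 0"
  proof (rule fundamental_lemma[OF V(1)])
    fix K :: "(real^'n) set" assume "compact K"
    then have "K \<in> sets lborel" by (simp add: borel_compact)
    then show "set_integrable lborel K (\<lambda>x. f (x + h *\<^sub>R e) - f x - ?I x)"
      unfolding set_integrable_def by (intro integrable_mult_indicator Bochner_Integration.integrable_diff d I)
  next
    fix \<phi> assume \<phi>: "test_function V \<phi>"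
    obtain C where C: "\<And>x. \<bar>\<phi> x\<bar> \<le> C" using test_function_bounded[OF \<phi>] by blast
    have [measurable]: "\<phi> \<in> borel_measurable borel"
      using smooth_on_borel_measurable[OF test_function_smooth[OF \<phi>]] .
    have "(\<integral>x. \<phi> x *\<^sub>R (f (x + h *\<^sub>R e) - f x - ?I x) \<partial>lborel) =
        (\<integral>x. \<phi> x *\<^sub>R (f (x + h *\<^sub>R e) - f x) \<partial>lborel) - (\<integral>x. \<phi> x *\<^sub>R ?I x \<partial>lborel)"
      unfolding scaleR_diff_right[of _ "f _ - f _"]
      by (intro Bochner_Integration.integral_diff integrable_bounded_scaleR[OF _ _ C] d I) auto
    then show "(\<integral>x. \<phi> x *\<^sub>R (f (x + h *\<^sub>R e) - f x - ?I x) \<partial>lborel) = 0"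
      using weak_increment[OF h V(2) \<phi>] by simp
  qed
  then show ?thesis by eventually_elim auto
qed

end

text \<open>First- and second-order Taylor bounds for backward differences with a common constant: both derivatives of a test function
  along the axis are bounded.\<close>
lemma test_function_difference_bounds:
  assumes "test_function U \<eta>"
  obtains M where "M \<ge> 0"
    and "\<And>x t. 0 \<le> t \<Longrightarrow> \<bar>\<eta> (x - t *\<^sub>R axis i 1) - \<eta> x\<bar> \<le> M * t"
    and "\<And>x t. 0 \<le> t \<Longrightarrow> \<bar>\<eta> (x - t *\<^sub>R axis i 1) - \<eta> x + t * partial_deriv i \<eta> x\<bar> \<le> M * t\<^sup>2"
proof -
  have lipschitz: "\<bar>\<phi> (x + s *\<^sub>R axis i 1) - \<phi> x\<bar> \<le> B * \<bar>s\<bar>"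
    if "smooth_on UNIV \<phi>" "\<And>x. \<bar>partial_deriv i \<phi> x\<bar> \<le> B" for \<phi> :: "real^'a \<Rightarrow> real" and B x s
    using field_differentiable_bound[where S = UNIV and f = "\<lambda>t. \<phi> (x + t *\<^sub>R axis i 1)"
        and f' = "\<lambda>t. partial_deriv i \<phi> (x + t *\<^sub>R axis i 1)" and B = B and x = s and y = 0]
      smooth_on_has_vector_derivative_line[OF that(1)] that(2)
    by (simp add: has_real_derivative_iff_has_vector_derivative)
  note test1 = test_function_partial_deriv[OF assms, of i]
  note test2 = test_function_partial_deriv[OF test1, of i]
  obtain M1 where M1: "M1 \<ge> 0" "\<And>x. \<bar>partial_deriv i \<eta> x\<bar> \<le> M1"
    using test_function_bounded[OF test1] by blast
  obtain M2 where M2: "M2 \<ge> 0" "\<And>x. \<bar>partial_deriv i (partial_deriv i \<eta>) x\<bar> \<le> M2"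
    using test_function_bounded[OF test2] by blast
  show thesis
  proof (rule that[of "M1 + M2"])
    show "M1 + M2 \<ge> 0" using M1 M2 by simp
    fix x and t :: real assume t: "0 \<le> t"
    have "\<bar>\<eta> (x - t *\<^sub>R axis i 1) - \<eta> x\<bar> \<le> M1 * t"
      using lipschitz[OF test_function_smooth[OF assms] M1(2), of x "- t"] t by simp
    also have "\<dots> \<le> (M1 + M2) * t" using M2 t by (simp add: mult_right_mono)
    finally show "\<bar>\<eta> (x - t *\<^sub>R axis i 1) - \<eta> x\<bar> \<le> (M1 + M2) * t" .
    have "norm (\<eta> (x + (- t) *\<^sub>R axis i 1) - \<eta> (x + 0 *\<^sub>R axis i 1)
        - (- t - 0) *\<^sub>R partial_deriv i \<eta> (x + 0 *\<^sub>R axis i 1)) \<le> norm (- t - 0) * (M2 * t)"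
    proof (rule vector_differentiable_bound_linearization[where S = "{- t..0}"
          and f = "\<lambda>s. \<eta> (x + s *\<^sub>R axis i 1)" and f' = "\<lambda>s. partial_deriv i \<eta> (x + s *\<^sub>R axis i 1)"])
      show "closed_segment 0 (- t) \<subseteq> {- t..0}" using t by (auto simp: closed_segment_eq_real_ivl)
      show "((\<lambda>t. \<eta> (x + t *\<^sub>R axis i 1)) has_vector_derivative partial_deriv i \<eta> (x + s *\<^sub>R axis i 1))
          (at s within {- t..0})" for s
        by (rule smooth_on_has_vector_derivative_line[OF test_function_smooth[OF assms]])
      show "norm (partial_deriv i \<eta> (x + s *\<^sub>R axis i 1) - partial_deriv i \<eta> (x + 0 *\<^sub>R axis i 1)) \<le> M2 * t"
        if "s \<in> {- t..0}" for s
      proof -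
        have "norm (partial_deriv i \<eta> (x + s *\<^sub>R axis i 1) - partial_deriv i \<eta> (x + 0 *\<^sub>R axis i 1)) \<le> M2 * \<bar>s\<bar>"
          using lipschitz[OF test_function_smooth[OF test1] M2(2), of x s] by simp
        also have "\<dots> \<le> M2 * t" using that M2(1) by (intro mult_left_mono) auto
        finally show ?thesis .
      qed
      show "0 \<in> {- t..0}" using t by simp
    qed
    then have "\<bar>\<eta> (x - t *\<^sub>R axis i 1) - \<eta> x + t * partial_deriv i \<eta> x\<bar> \<le> M2 * t\<^sup>2"
      using t by (simp add: power2_eq_square mult_ac)
    also have "\<dots> \<le> (M1 + M2) * t\<^sup>2" using M1 by (simp add: mult_right_mono)
    finally show "\<bar>\<eta> (x - t *\<^sub>R axis i 1) - \<eta> x + t * partial_deriv i \<eta> x\<bar> \<le> (M1 + M2) * t\<^sup>2" .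
  qed
qed

context weak_derivative begin

text \<open>The Dirichlet energy of \<open>f\<close> in the direction \<open>i\<close>.\<close>
definition energy :: real where "energy = (\<integral>x. (norm (g x))\<^sup>2 \<partial>lborel)"

lemma energy_nonneg: "energy \<ge> 0"
  unfolding energy_def by (rule Bochner_Integration.integral_nonneg) simp

lemma integrable_square_increment:
  "integrable lborel (\<lambda>x. (norm (f (x + c) - f x))\<^sup>2)"
proof (rule Bochner_Integration.integrable_bound)
  show "integrable lborel (\<lambda>x. 2 * (norm (f (x + c)))\<^sup>2 + 2 * (norm (f x))\<^sup>2)"
    using f2 integrable_lborel_translate[OF f2, of c] by simp
  have "(norm (a - b))\<^sup>2 \<le> 2 * (norm a)\<^sup>2 + 2 * (norm b)\<^sup>2" for a b :: 'b
  proof -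
    have "(norm (a - b))\<^sup>2 \<le> (norm a + norm b)\<^sup>2" by (intro power_mono norm_triangle_ineq4) simp
    also have "\<dots> \<le> 2 * (norm a)\<^sup>2 + 2 * (norm b)\<^sup>2"
      using zero_le_power2[of "norm a - norm b"] by (simp add: power2_eq_square algebra_simps)
    finally show ?thesis .
  qed
  then show "AE x in lborel. norm ((norm (f (x + c) - f x))\<^sup>2) \<le> norm (2 * (norm (f (x + c)))\<^sup>2 + 2 * (norm (f x))\<^sup>2)"
    by (auto intro!: AE_I2)
qed measurable

text \<open>The Cauchy--Schwarz inequality in \<open>t\<close> gives one factor \<open>h\<close>; integrating the translates of \<open>\<bar>g\<bar>\<^sup>2\<close> over \<open>0 \<le> t \<le> h\<close> gives the
  other one.\<close>
lemma L2_increment: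
  assumes h: "0 \<le> h" and V: "open V" "\<And>x t. x \<in> V \<Longrightarrow> 0 \<le> t \<Longrightarrow> t \<le> h \<Longrightarrow> x + t *\<^sub>R e \<in> U"
  shows "(\<integral>x. indicator V x * (norm (f (x + h *\<^sub>R e) - f x))\<^sup>2 \<partial>lborel) \<le> h\<^sup>2 * energy"
proof -
  let ?g = "\<lambda>x t. ennreal (norm (g (x + t *\<^sub>R e)))"
  have [measurable]: "V \<in> sets borel" using V(1) by simp
  have ae: "AE x in lborel. x \<in> V \<longrightarrow>
      f (x + h *\<^sub>R e) - f x = (\<integral>t. indicator {0..h} t *\<^sub>R g (x + t *\<^sub>R e) \<partial>lborel)"
    by (rule AE_increment[OF assms])
  have int: "integrable lborel (\<lambda>x. indicator V x * (norm (f (x + h *\<^sub>R e) - f x))\<^sup>2)"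
    using integrable_mult_indicator[OF _ integrable_square_increment, of V] V(1) by simp
  have "ennreal (\<integral>x. indicator V x * (norm (f (x + h *\<^sub>R e) - f x))\<^sup>2 \<partial>lborel)
      = (\<integral>\<^sup>+x. ennreal (indicator V x * (norm (f (x + h *\<^sub>R e) - f x))\<^sup>2) \<partial>lborel)"
    by (rule nn_integral_eq_integral[OF int, symmetric]) simp
  also have "\<dots> \<le> (\<integral>\<^sup>+x. ennreal h * (\<integral>\<^sup>+t. indicator {0..h} t * (?g x t)\<^sup>2 \<partial>lborel) \<partial>lborel)"
  proof (rule nn_integral_mono_AE)
    show "AE x in lborel. ennreal (indicator V x * (norm (f (x + h *\<^sub>R e) - f x))\<^sup>2)
        \<le> ennreal h * (\<integral>\<^sup>+t. indicator {0..h} t * (?g x t)\<^sup>2 \<partial>lborel)"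
      using ae
    proof eventually_elim
      case (elim x)
      show ?case
      proof (cases "x \<in> V")
        case True
        let ?I = "\<integral>t. indicator {0..h} t *\<^sub>R g (x + t *\<^sub>R e) \<partial>lborel"
        have "ennreal (norm ?I) \<le> (\<integral>\<^sup>+t. ennreal (norm (indicator {0..h} t *\<^sub>R g (x + t *\<^sub>R e))) \<partial>lborel)"
          by (cases "integrable lborel (\<lambda>t. indicator {0..h} t *\<^sub>R g (x + t *\<^sub>R e))")
            (use integral_norm_bound_ennreal in blast, simp add: not_integrable_integral_eq)
        also have "\<dots> = (\<integral>\<^sup>+t. indicator {0..h} t * (indicator {0..h} t * ?g x t) \<partial>lborel)"
          by (intro nn_integral_cong) (auto split: split_indicator)
        finally have "(ennreal (norm ?I))\<^sup>2 \<le> (\<integral>\<^sup>+t. indicator {0..h} t * (indicator {0..h} t * ?g x t) \<partial>lborel)\<^sup>2"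
          by (rule power_mono) simp
        also have "\<dots> \<le> (\<integral>\<^sup>+t. (indicator {0..h} t)\<^sup>2 \<partial>lborel) * (\<integral>\<^sup>+t. (indicator {0..h} t * ?g x t)\<^sup>2 \<partial>lborel)"
          by (rule Cauchy_Schwarz_nn_integral) measurable
        also have "(\<integral>\<^sup>+t. (indicator {0..h} t :: ennreal)\<^sup>2 \<partial>lborel) = (\<integral>\<^sup>+t. indicator {0..h} t \<partial>lborel)"
          by (intro nn_integral_cong) (auto split: split_indicator)
        also have "\<dots> = ennreal h" using h by simp
        also have "(\<integral>\<^sup>+t. (indicator {0..h} t * ?g x t)\<^sup>2 \<partial>lborel) = (\<integral>\<^sup>+t. indicator {0..h} t * (?g x t)\<^sup>2 \<partial>lborel)"
          by (intro nn_integral_cong) (auto split: split_indicator)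
        finally show ?thesis using elim True by (simp add: ennreal_power)
      qed simp
    qed
  qed
  also have "\<dots> = ennreal h * (\<integral>\<^sup>+x. (\<integral>\<^sup>+t. indicator {0..h} t * (?g x t)\<^sup>2 \<partial>lborel) \<partial>lborel)"
    by (rule nn_integral_cmult) measurable
  also have "(\<integral>\<^sup>+x. (\<integral>\<^sup>+t. indicator {0..h} t * (?g x t)\<^sup>2 \<partial>lborel) \<partial>lborel)
      = (\<integral>\<^sup>+t. (\<integral>\<^sup>+x. indicator {0..h} t * (?g x t)\<^sup>2 \<partial>lborel) \<partial>lborel)"
    by (rule lborel_pair.Fubini') measurable
  also have "\<dots> = (\<integral>\<^sup>+t. ennreal energy * indicator {0..h} t \<partial>lborel)"
  proof (intro nn_integral_cong)
    fix t :: real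
    have "(\<integral>\<^sup>+x. (?g x t)\<^sup>2 \<partial>lborel) = (\<integral>\<^sup>+x. (ennreal (norm (g x)))\<^sup>2 \<partial>lborel)"
      by (rule nn_integral_lborel_translate) measurable
    also have "\<dots> = ennreal energy"
      unfolding energy_def using nn_integral_eq_integral[OF g2] by (simp add: ennreal_power)
    finally show "(\<integral>\<^sup>+x. indicator {0..h} t * (?g x t)\<^sup>2 \<partial>lborel) = ennreal energy * indicator {0..h} t"
      by (simp split: split_indicator)
  qed
  also have "\<dots> = ennreal energy * ennreal h"
    using h by (simp add: nn_integral_cmult_indicator)
  also have "ennreal h * \<dots> = ennreal (h\<^sup>2 * energy)"
    using h energy_nonneg by (simp add: power2_eq_square mult_ac flip: ennreal_mult)
  finally show ?thesis
    using energy_nonneg by (simp add: ennreal_le_iff)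
qed

end

section \<open>The chain rule for weak derivatives\<close>

lemma integral_norm_le:
  fixes u :: "'x \<Rightarrow> 'y::{banach, second_countable_topology}"
  assumes "integrable M w" "\<And>x. norm (u x) \<le> w x"
  shows "norm (\<integral>x. u x \<partial>M) \<le> (\<integral>x. w x \<partial>M)"
proof -
  have "norm (\<integral>x. u x \<partial>M) \<le> (\<integral>x. norm (u x) \<partial>M)" by (rule integral_norm_bound)
  also have "\<dots> \<le> (\<integral>x. w x \<partial>M)"
    using assms order_trans[OF norm_ge_zero assms(2)] by (intro integral_mono') auto
  finally show ?thesis .
qed

text \<open>The condition \<open>G 0 = 0\<close> keeps \<open>G \<circ> f\<close> integrable on the whole space. The Lipschitz bound on \<open>G'\<close> is what
  makes all errors quadratic in the length of the increment.\<close>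
locale weak_derivative_composition = weak_derivative U i f g
  for U :: "(real^'n::finite) set" and i and f g :: "real^'n \<Rightarrow> 'b::euclidean_space" +
  fixes G :: "'b \<Rightarrow> 'c::euclidean_space" and G' :: "'b \<Rightarrow> 'b \<Rightarrow>\<^sub>L 'c" and C L :: real
  assumes U: "open U"
    and G_zero: "G 0 = 0"
    and G_derivative: "\<And>u. (G has_derivative blinfun_apply (G' u)) (at u)"
    and G'_bounded: "\<And>u. norm (G' u) \<le> C"
    and G'_lipschitz: "\<And>u v. norm (G' u - G' v) \<le> L * norm (u - v)"
begin

lemma C_nonneg: "C \<ge> 0"
  using G'_bounded[of 0] norm_ge_zero order_trans by blast

lemma L_nonneg: "L \<ge> 0"
proof -
  obtain b :: 'b where "b \<in> Basis" by (meson ex_in_conv nonempty_Basis)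
  then show ?thesis using order_trans[OF norm_ge_zero G'_lipschitz[of b 0]] by simp
qed

lemma G'_apply_bound: "norm (G' u w) \<le> C * norm w"
  by (rule order_trans[OF norm_blinfun mult_right_mono[OF G'_bounded norm_ge_zero]])

lemma G'_apply_diff_bound: "norm (G' u w - G' v w) \<le> L * norm (u - v) * norm w"
  unfolding blinfun.diff_left[symmetric]
  by (rule order_trans[OF norm_blinfun mult_right_mono[OF G'_lipschitz norm_ge_zero]])

lemma G_bound: "norm (G u) \<le> C * norm u"
proof -
  have "norm (G u - G 0) \<le> C * norm (u - 0)"
    by (rule differentiable_bound[where S = UNIV and f' = "\<lambda>u. blinfun_apply (G' u)"])
      (auto intro: G_derivative simp: norm_blinfun.rep_eq[symmetric] G'_bounded)
  then show ?thesis by (simp add: G_zero)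
qed

lemma G_taylor: "norm (G v - G u - G' u (v - u)) \<le> L * (norm (v - u))\<^sup>2"
proof -
  have "norm (G v - G u - G' u (v - u)) \<le> norm (v - u) * (L * norm (v - u))"
  proof (rule differentiable_bound_linearization[where S = "closed_segment u v" and f' = "\<lambda>u. blinfun_apply (G' u)"])
    show "(G has_derivative blinfun_apply (G' x)) (at x within closed_segment u v)" for x
      by (rule has_derivative_at_withinI[OF G_derivative])
    show "onorm (blinfun_apply (G' x) - blinfun_apply (G' u)) \<le> L * norm (v - u)"
      if x: "x \<in> closed_segment u v" for x
    proof -
      have "onorm (blinfun_apply (G' x) - blinfun_apply (G' u)) = norm (G' x - G' u)"
        by (simp add: norm_blinfun.rep_eq minus_blinfun.rep_eq fun_diff_def)
      also have "\<dots> \<le> L * norm (x - u)" by (rule G'_lipschitz)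
      also have "\<dots> \<le> L * norm (v - u)"
        using segment_bound1[OF x] by (intro mult_left_mono L_nonneg)
      finally show ?thesis .
    qed
    show "u + t *\<^sub>R (v - u) \<in> closed_segment u v" if "t \<in> {0..1}" for t
      using that by (auto simp: closed_segment_def algebra_simps intro!: exI[of _ t])
  qed simp
  then show ?thesis by (simp add: power2_eq_square mult_ac)
qed

lemma G_measurable [measurable]: "G \<in> borel_measurable borel"
  by (intro borel_measurable_continuous_onI continuous_at_imp_continuous_on ballI
      has_derivative_continuous[OF G_derivative])

lemma G'_measurable [measurable (raw)]:
  assumes [measurable]: "u \<in> borel_measurable M" "w \<in> borel_measurable M"
  shows "(\<lambda>x. blinfun_apply (G' (u x)) (w x)) \<in> borel_measurable M"
proof (rule borel_measurable_continuous_Pair[where H = "\<lambda>u w. blinfun_apply (G' u) w"])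
  have "continuous_on UNIV G'"
  proof (rule continuous_onI)
    fix u and \<epsilon> :: real assume "\<epsilon> > 0"
    have L1: "L + 1 > 0" using L_nonneg by simp
    show "\<exists>d>0. \<forall>v\<in>UNIV. dist v u < d \<longrightarrow> dist (G' v) (G' u) \<le> \<epsilon>"
    proof (intro exI[of _ "\<epsilon> / (L + 1)"] conjI ballI impI)
      show "\<epsilon> / (L + 1) > 0" using \<open>\<epsilon> > 0\<close> L1 by simp
      fix v assume v: "dist v u < \<epsilon> / (L + 1)"
      have "dist (G' v) (G' u) \<le> L * norm (v - u)" unfolding dist_norm by (rule G'_lipschitz)
      also have "\<dots> \<le> (L + 1) * norm (v - u)" by (simp add: mult_right_mono)
      also have "\<dots> \<le> \<epsilon>" using v L1 by (simp add: dist_norm field_simps)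
      finally show "dist (G' v) (G' u) \<le> \<epsilon>" .
    qed
  qed
  then show "continuous_on UNIV (\<lambda>x. blinfun_apply (G' (fst x)) (snd x))"
    by (intro continuous_intros continuous_on_compose2[of UNIV G' UNIV fst]) auto
qed fact+

lemma integrable_G_f: "integrable lborel (\<lambda>x. G (f x))"
proof (rule Bochner_Integration.integrable_bound)
  show "integrable lborel (\<lambda>x. C * norm (f x))" using f by simp
  have "norm (G (f x)) \<le> norm (C * norm (f x))" for x
    using G_bound[of "f x"] by (simp add: abs_mult C_nonneg)
  then show "AE x in lborel. norm (G (f x)) \<le> norm (C * norm (f x))" by simp
qed measurable

lemma integrable_G'_apply:
  assumes "integrable lborel w" and [measurable]: "v \<in> borel_measurable borel"
  shows "integrable lborel (\<lambda>x. G' (v x) (w x))"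
proof (rule Bochner_Integration.integrable_bound)
  have [measurable]: "w \<in> borel_measurable borel"
    using borel_measurable_integrable[OF assms(1)] by simp
  show "integrable lborel (\<lambda>x. C * norm (w x))" using assms by simp
  show "(\<lambda>x. G' (v x) (w x)) \<in> borel_measurable lborel" by measurable
  have "norm (G' (v x) (w x)) \<le> norm (C * norm (w x))" for x
    using G'_apply_bound[of "v x" "w x"] by (simp add: abs_mult C_nonneg)
  then show "AE x in lborel. norm (G' (v x) (w x)) \<le> norm (C * norm (w x))" by simp
qed

context
  fixes \<eta> :: "real^'n \<Rightarrow> real"
  assumes \<eta>: "test_function U \<eta>"
begin

text \<open>Both terms are compared with \<open>Q h\<close>, the integral of \<open>\<eta>\<close> against the increments of \<open>G \<circ> f\<close>. Moving the increment to
  \<open>\<eta>\<close> gives \<open>- h \<integral>\<partial>\<^sub>i\<eta> G(f)\<close> up to \<open>O(h\<^sup>2)\<close>. Linearizing \<open>G\<close> gives \<open>\<integral>\<eta> G'(f) (f(x + he) - f(x))\<close>, which is the average of \<open>b t\<close> over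
  \<open>0 \<le> t \<le> h\<close> times \<open>h\<close>; and \<open>b t\<close> is Lipschitz at \<open>0\<close>, where it equals \<open>\<integral>\<eta> G'(f) g\<close>.\<close>
lemma chain_rule_error:
  obtains B r where "r > 0"
    and "\<And>h. 0 < h \<Longrightarrow> h < r \<Longrightarrow>
      norm (h *\<^sub>R (\<integral>x. partial_deriv i \<eta> x *\<^sub>R G (f x) \<partial>lborel) +
        h *\<^sub>R (\<integral>x. \<eta> x *\<^sub>R G' (f x) (g x) \<partial>lborel)) \<le> B * h\<^sup>2"
proof -
  obtain K where K: "compact K" "K \<subseteq> U" "\<And>x. x \<notin> K \<Longrightarrow> \<eta> x = 0"
    using \<eta> unfolding test_function_def by blast
  obtain r where r: "r > 0" "(\<Union>x\<in>K. ball x r) \<subseteq> U"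
    using compact_subset_open_imp_ball_epsilon_subset[OF K(1) U K(2)] by blast
  obtain M where M: "M \<ge> 0"
    and M1: "\<And>x t. 0 \<le> t \<Longrightarrow> \<bar>\<eta> (x - t *\<^sub>R e) - \<eta> x\<bar> \<le> M * t"
    and M2: "\<And>x t. 0 \<le> t \<Longrightarrow> \<bar>\<eta> (x - t *\<^sub>R e) - \<eta> x + t * partial_deriv i \<eta> x\<bar> \<le> M * t\<^sup>2"
    using test_function_difference_bounds[OF \<eta>] by blast
  obtain M0 where M0: "M0 \<ge> 0" "\<And>x. \<bar>\<eta> x\<bar> \<le> M0" using test_function_bounded[OF \<eta>] by blast
  obtain M3 where M3: "M3 \<ge> 0" "\<And>x. \<bar>partial_deriv i \<eta> x\<bar> \<le> M3"
    using test_function_bounded[OF test_function_partial_deriv[OF \<eta>]] by blast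
  have \<eta>_meas [measurable]: "\<eta> \<in> borel_measurable borel" "partial_deriv i \<eta> \<in> borel_measurable borel"
    using test_function_smooth[OF \<eta>] test_function_smooth[OF test_function_partial_deriv[OF \<eta>]]
    by (auto intro: smooth_on_borel_measurable)
  \<comment> \<open>Points of \<open>V\<close> may be moved by less than \<open>r / 2\<close> without leaving \<open>U\<close>.\<close>
  define V where "V = (\<Union>x\<in>K. ball x (r / 2))"
  have V: "open V" unfolding V_def by auto
  have KV: "x \<in> V" if "x \<in> K" for x using that r by (auto simp: V_def intro!: bexI[of _ x])
  have \<eta>_le: "\<bar>\<eta> x\<bar> \<le> M0 * indicator V x" for x
    using K(3) M0 KV by (cases "x \<in> K") (auto simp: indicator_def)
  have V_shift: "x + t *\<^sub>R e \<in> U" if "x \<in> V" "0 \<le> t" "t < r / 2" for x t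
  proof -
    from that(1) obtain y where y: "y \<in> K" "dist y x < r / 2" by (auto simp: V_def)
    have "dist y (x + t *\<^sub>R e) \<le> dist y x + t"
      using dist_triangle[of y "x + t *\<^sub>R e" x] that by (simp add: dist_norm)
    then have "x + t *\<^sub>R e \<in> ball y r" using y that by simp
    then show ?thesis using r y by blast
  qed
  have [measurable]: "V \<in> sets borel" using V by simp
  have sq_int: "integrable lborel (\<lambda>x. indicator V x * (norm (f (x + c) - f x))\<^sup>2)" for c
    using integrable_mult_indicator[OF _ integrable_square_increment, of V] V by simp
  have sq: "(\<integral>x. indicator V x * (norm (f (x + t *\<^sub>R e) - f x))\<^sup>2 \<partial>lborel) \<le> t\<^sup>2 * energy"
    if "0 \<le> t" "t < r / 2" for t
    using that by (intro L2_increment V V_shift) auto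

  define N where "N = (\<integral>x. norm (G (f x)) \<partial>lborel)"
  define N1 where "N1 = (\<integral>x. norm (g x) \<partial>lborel)"
  define X where "X = (\<integral>x. partial_deriv i \<eta> x *\<^sub>R G (f x) \<partial>lborel)"
  define b where "b t = (\<integral>x. \<eta> x *\<^sub>R G' (f x) (g (x + t *\<^sub>R e)) \<partial>lborel)" for t
  define D where "D h x = f (x + h *\<^sub>R e) - f x" for h x
  define Q where "Q h = (\<integral>x. \<eta> x *\<^sub>R (G (f (x + h *\<^sub>R e)) - G (f x)) \<partial>lborel)" for h
  have int_D: "integrable lborel (D h)" for h
    unfolding D_def by (intro Bochner_Integration.integrable_diff integrable_lborel_translate f)

  \<comment> \<open>The increment is moved to \<open>\<eta>\<close>, whose Taylor remainder is quadratic.\<close>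
  have part1: "norm (Q h + h *\<^sub>R X) \<le> M * N * h\<^sup>2" if h: "0 < h" for h
  proof -
    have 1: "integrable lborel (\<lambda>x. \<eta> (x + c) *\<^sub>R G (f (x + d)))" for c d
      by (rule integrable_bounded_scaleR[OF integrable_lborel_translate[OF integrable_G_f] _ M0(2)]) measurable
    have 2: "integrable lborel (\<lambda>x. partial_deriv i \<eta> x *\<^sub>R G (f x))"
      by (rule integrable_bounded_scaleR[OF integrable_G_f _ M3(2)]) measurable
    have "Q h = (\<integral>x. \<eta> x *\<^sub>R G (f (x + h *\<^sub>R e)) \<partial>lborel) - (\<integral>x. \<eta> x *\<^sub>R G (f x) \<partial>lborel)"
      unfolding Q_def scaleR_diff_right
      using 1[of 0 "h *\<^sub>R e"] 1[of 0 0] by (intro Bochner_Integration.integral_diff) auto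
    also have "(\<integral>x. \<eta> x *\<^sub>R G (f (x + h *\<^sub>R e)) \<partial>lborel) = (\<integral>x. \<eta> (x - h *\<^sub>R e) *\<^sub>R G (f x) \<partial>lborel)"
      using integral_lborel_translate[of "\<lambda>x. \<eta> (x - h *\<^sub>R e) *\<^sub>R G (f x)" "h *\<^sub>R e"] by simp
    finally have "Q h + h *\<^sub>R X = (\<integral>x. \<eta> (x - h *\<^sub>R e) *\<^sub>R G (f x) \<partial>lborel) - (\<integral>x. \<eta> x *\<^sub>R G (f x) \<partial>lborel)
        + (\<integral>x. h *\<^sub>R partial_deriv i \<eta> x *\<^sub>R G (f x) \<partial>lborel)"
      unfolding X_def by (simp only: integral_scaleR_right)
    also have "\<dots> = (\<integral>x. (\<eta> (x - h *\<^sub>R e) *\<^sub>R G (f x) - \<eta> x *\<^sub>R G (f x)) + h *\<^sub>R partial_deriv i \<eta> x *\<^sub>R G (f x) \<partial>lborel)"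
    proof -
      have 3: "integrable lborel (\<lambda>x. \<eta> (x - h *\<^sub>R e) *\<^sub>R G (f x))" "integrable lborel (\<lambda>x. \<eta> x *\<^sub>R G (f x))"
        using 1[of "- h *\<^sub>R e" 0] 1[of 0 0] by auto
      show ?thesis
        by (simp only: Bochner_Integration.integral_add[OF Bochner_Integration.integrable_diff[OF 3]
              integrable_scaleR_right[OF 2]] Bochner_Integration.integral_diff[OF 3])
    qed
    also have "norm \<dots> \<le> (\<integral>x. (M * h\<^sup>2) * norm (G (f x)) \<partial>lborel)"
    proof (rule integral_norm_le)
      show "integrable lborel (\<lambda>x. (M * h\<^sup>2) * norm (G (f x)))" using integrable_G_f by simp
      fix x
      have "(\<eta> (x - h *\<^sub>R e) *\<^sub>R G (f x) - \<eta> x *\<^sub>R G (f x)) + h *\<^sub>R partial_deriv i \<eta> x *\<^sub>R G (f x)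
         = (\<eta> (x - h *\<^sub>R e) - \<eta> x + h * partial_deriv i \<eta> x) *\<^sub>R G (f x)"
        by (simp add: algebra_simps)
      then show "norm ((\<eta> (x - h *\<^sub>R e) *\<^sub>R G (f x) - \<eta> x *\<^sub>R G (f x)) + h *\<^sub>R partial_deriv i \<eta> x *\<^sub>R G (f x))
          \<le> (M * h\<^sup>2) * norm (G (f x))"
        using M2[of h x] h by (simp add: mult_right_mono)
    qed
    finally show ?thesis unfolding N_def by (simp add: mult_ac)
  qed

  \<comment> \<open>Linearization of \<open>G\<close>: the remainder is controlled by the squared \<open>L\<^sup>2\<close> norm of the increment.\<close>
  have part2: "norm (Q h - (\<integral>x. \<eta> x *\<^sub>R G' (f x) (D h x) \<partial>lborel)) \<le> M0 * L * energy * h\<^sup>2"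
    if h: "0 < h" "h < r / 2" for h
  proof -
    have 1: "integrable lborel (\<lambda>x. \<eta> x *\<^sub>R (G (f (x + h *\<^sub>R e)) - G (f x)))"
      by (rule integrable_bounded_scaleR[OF Bochner_Integration.integrable_diff[OF
            integrable_lborel_translate[OF integrable_G_f] integrable_G_f] _ M0(2)]) measurable
    have 2: "integrable lborel (\<lambda>x. \<eta> x *\<^sub>R G' (f x) (D h x))"
      by (rule integrable_bounded_scaleR[OF integrable_G'_apply[OF int_D] _ M0(2)]) measurable
    have "norm (Q h - (\<integral>x. \<eta> x *\<^sub>R G' (f x) (D h x) \<partial>lborel))
        = norm (\<integral>x. \<eta> x *\<^sub>R (G (f (x + h *\<^sub>R e)) - G (f x)) - \<eta> x *\<^sub>R G' (f x) (D h x) \<partial>lborel)"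
      unfolding Q_def using 1 2 by simp
    also have "\<dots> \<le> (\<integral>x. (M0 * L) * (indicator V x * (norm (D h x))\<^sup>2) \<partial>lborel)"
    proof (rule integral_norm_le)
      show "integrable lborel (\<lambda>x. (M0 * L) * (indicator V x * (norm (D h x))\<^sup>2))"
        unfolding D_def by (intro integrable_mult_right sq_int)
      fix x
      have "norm (\<eta> x *\<^sub>R (G (f (x + h *\<^sub>R e)) - G (f x)) - \<eta> x *\<^sub>R G' (f x) (D h x))
          = \<bar>\<eta> x\<bar> * norm (G (f (x + h *\<^sub>R e)) - G (f x) - G' (f x) (D h x))"
        by (simp flip: scaleR_diff_right)
      also have "\<dots> \<le> (M0 * indicator V x) * (L * (norm (D h x))\<^sup>2)"
        unfolding D_def using M0(1) by (intro mult_mono \<eta>_le G_taylor) auto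
      finally show "norm (\<eta> x *\<^sub>R (G (f (x + h *\<^sub>R e)) - G (f x)) - \<eta> x *\<^sub>R G' (f x) (D h x))
          \<le> (M0 * L) * (indicator V x * (norm (D h x))\<^sup>2)" by (simp add: mult_ac)
    qed
    also have "\<dots> = (M0 * L) * (\<integral>x. indicator V x * (norm (D h x))\<^sup>2 \<partial>lborel)" by simp
    also have "\<dots> \<le> (M0 * L) * (h\<^sup>2 * energy)"
      unfolding D_def using h M0 L_nonneg by (intro mult_left_mono sq) auto
    finally show ?thesis by (simp add: mult_ac)
  qed

  \<comment> \<open>The increment is written as an integral of \<open>g\<close>, and the integrals are exchanged.\<close>
  have part3: "(\<integral>x. \<eta> x *\<^sub>R G' (f x) (D h x) \<partial>lborel) = (\<integral>t. indicator {0..h} t *\<^sub>R b t \<partial>lborel)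
      \<and> integrable lborel (\<lambda>t. indicator {0..h} t *\<^sub>R b t)"
    if h: "0 < h" "h < r / 2" for h
  proof -
    let ?F = "\<lambda>t x. indicator {0..h} t *\<^sub>R \<eta> x *\<^sub>R G' (f x) (g (x + t *\<^sub>R e))"
    have F: "integrable (lborel \<Otimes>\<^sub>M lborel) (\<lambda>(t, x). ?F t x)"
    proof (rule Bochner_Integration.integrable_bound)
      show "integrable (lborel \<Otimes>\<^sub>M lborel) (\<lambda>p. (M0 * C) *\<^sub>R (case p of (t, x) \<Rightarrow> indicator {0..h} t *\<^sub>R g (x + t *\<^sub>R e)))"
        by (intro integrable_scaleR_right integrable_moving_translates g)
      have "\<bar>\<eta> x\<bar> * norm (G' (f x) w) \<le> (M0 * C) * norm w" for x w
        using mult_mono[OF M0(2) G'_apply_bound[of "f x" w] M0(1) norm_ge_zero] by (simp add: mult_ac)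
      then show "AE p in lborel \<Otimes>\<^sub>M lborel. norm (case p of (t, x) \<Rightarrow> ?F t x)
          \<le> norm ((M0 * C) *\<^sub>R (case p of (t, x) \<Rightarrow> indicator {0..h} t *\<^sub>R g (x + t *\<^sub>R e)))"
        using M0(1) C_nonneg by (auto intro!: AE_I2 simp: abs_mult split: split_indicator)
    qed measurable
    have gint: "AE x in lborel. integrable lborel (\<lambda>t. indicator {0..h} t *\<^sub>R g (x + t *\<^sub>R e))"
      using lborel_pair.AE_integrable_snd[of "\<lambda>t x. indicator {0..h} t *\<^sub>R g (x + t *\<^sub>R e)"]
        integrable_moving_translates[OF g, of h e] by simp
    have "AE x in lborel. x \<in> V \<longrightarrow> D h x = (\<integral>t. indicator {0..h} t *\<^sub>R g (x + t *\<^sub>R e) \<partial>lborel)"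
      unfolding D_def using h by (intro AE_increment V V_shift) auto
    then have "AE x in lborel. \<eta> x *\<^sub>R G' (f x) (D h x) = (\<integral>t. ?F t x \<partial>lborel)"
      using gint
    proof eventually_elim
      case (elim x)
      show ?case
      proof (cases "x \<in> V")
        case True
        let ?A = "\<lambda>w. \<eta> x *\<^sub>R G' (f x) w"
        have "bounded_linear ?A"
          by (intro bounded_linear_scaleR_right bounded_linear_compose[of "\<lambda>y. \<eta> x *\<^sub>R y"] blinfun.bounded_linear_right)
        from integral_bounded_linear[OF this elim(2)]
        have "(\<integral>t. ?A (indicator {0..h} t *\<^sub>R g (x + t *\<^sub>R e)) \<partial>lborel) = ?A (D h x)"
          using elim(1) True by simp
        then show ?thesis by (simp add: blinfun.scaleR_right mult_ac)
      next
        case False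
        then have "\<eta> x = 0" using K(3) KV by blast
        then show ?thesis by simp
      qed
    qed
    moreover have "(\<lambda>x. \<eta> x *\<^sub>R G' (f x) (D h x)) \<in> borel_measurable lborel"
      unfolding D_def by measurable
    ultimately have "(\<integral>x. \<eta> x *\<^sub>R G' (f x) (D h x) \<partial>lborel) = (\<integral>x. \<integral>t. ?F t x \<partial>lborel \<partial>lborel)"
      using borel_measurable_integrable[OF lborel_pair.integrable_snd[OF F]] by (intro integral_cong_AE)
    also have "\<dots> = (\<integral>t. \<integral>x. ?F t x \<partial>lborel \<partial>lborel)"
      by (rule lborel_pair.Fubini_integral[OF F])
    finally show ?thesis
      using lborel_pair.integrable_fst[OF F] unfolding b_def by (simp only: integral_scaleR_right)
  qed

  \<comment> \<open>Shifting \<open>\<eta> G'(f)\<close> instead of \<open>g\<close> avoids any regularity of \<open>g\<close>.\<close>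
  have part4: "norm (b t - b 0) \<le> (M * C * N1 + M0 * L * energy) * t" if t: "0 < t" "t < r / 2" for t
  proof -
    have gt: "integrable lborel (\<lambda>x. (norm (g (x + t *\<^sub>R e)))\<^sup>2)" by (rule integrable_lborel_translate[OF g2])
    let ?y = "\<lambda>x. x + t *\<^sub>R e"
    have 1: "integrable lborel (\<lambda>x. \<eta> (x + c) *\<^sub>R G' (f (x + c)) (g (x + d)))" for c d
      by (rule integrable_bounded_scaleR[OF integrable_G'_apply[OF integrable_lborel_translate[OF g]] _ M0(2)]) measurable
    have "b 0 = (\<integral>x. \<eta> (?y x) *\<^sub>R G' (f (?y x)) (g (?y x)) \<partial>lborel)"
      unfolding b_def using integral_lborel_translate[of "\<lambda>x. \<eta> x *\<^sub>R G' (f x) (g x)" "t *\<^sub>R e"] by simp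
    then have "norm (b t - b 0) = norm (\<integral>x. \<eta> x *\<^sub>R G' (f x) (g (?y x)) - \<eta> (?y x) *\<^sub>R G' (f (?y x)) (g (?y x)) \<partial>lborel)"
      using 1[of 0 "t *\<^sub>R e"] 1[of "t *\<^sub>R e" "t *\<^sub>R e"] by (simp add: b_def)
    also have "\<dots> \<le> (\<integral>x. (M * t * C) * norm (g (?y x))
        + (M0 * L / 2) * (inverse t * (indicator V x * (norm (f (?y x) - f x))\<^sup>2) + t * (norm (g (?y x)))\<^sup>2) \<partial>lborel)"
    proof (rule integral_norm_le)
      show "integrable lborel (\<lambda>x. (M * t * C) * norm (g (?y x))
        + (M0 * L / 2) * (inverse t * (indicator V x * (norm (f (?y x) - f x))\<^sup>2) + t * (norm (g (?y x)))\<^sup>2))"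
        by (intro Bochner_Integration.integrable_add integrable_mult_right integrable_norm
            integrable_lborel_translate[OF g] sq_int gt)
      fix x
      let ?w = "g (?y x)" and ?d = "norm (f (?y x) - f x)"
      have "\<eta> x *\<^sub>R G' (f x) ?w - \<eta> (?y x) *\<^sub>R G' (f (?y x)) ?w
          = (\<eta> x - \<eta> (?y x)) *\<^sub>R G' (f (?y x)) ?w + \<eta> x *\<^sub>R (G' (f x) ?w - G' (f (?y x)) ?w)"
        by (simp add: algebra_simps)
      also have "norm \<dots> \<le> \<bar>\<eta> x - \<eta> (?y x)\<bar> * norm (G' (f (?y x)) ?w)
          + \<bar>\<eta> x\<bar> * norm (G' (f x) ?w - G' (f (?y x)) ?w)"
        by (rule order_trans[OF norm_triangle_ineq]) simp
      also have "\<dots> \<le> (M * t) * (C * norm ?w) + (M0 * indicator V x) * (L * ?d * norm ?w)"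
      proof (intro add_mono mult_mono G'_apply_bound \<eta>_le)
        show "\<bar>\<eta> x - \<eta> (?y x)\<bar> \<le> M * t" using M1[of t "?y x"] t by simp
        show "norm (G' (f x) ?w - G' (f (?y x)) ?w) \<le> L * ?d * norm ?w"
          using G'_apply_diff_bound[of "f x" ?w "f (?y x)"] by (simp add: norm_minus_commute)
      qed (use M M0 t in auto)
      also have "(M0 * indicator V x) * (L * ?d * norm ?w)
          = (M0 * L / 2) * (2 * (indicator V x * ?d) * norm ?w)"
        by simp
      also have "\<dots> \<le> (M0 * L / 2) * (inverse t * (indicator V x * ?d)\<^sup>2 + t * (norm ?w)\<^sup>2)"
      proof (rule mult_left_mono)
        \<comment> \<open>Young's inequality weighted by \<open>t\<close>, so that both integrals become proportional to \<open>t\<close>.\<close>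
        let ?p = "indicator V x * ?d" and ?q = "norm ?w"
        have "0 \<le> inverse t * (?p - t * ?q)\<^sup>2" using t by simp
        also have "\<dots> = inverse t * ?p\<^sup>2 + t * ?q\<^sup>2 - 2 * ?p * ?q"
          using t by (simp add: power2_eq_square field_simps)
        finally show "2 * ?p * ?q \<le> inverse t * ?p\<^sup>2 + t * ?q\<^sup>2" by simp
      qed (use M0 L_nonneg in simp)
      also have "(indicator V x * ?d)\<^sup>2 = indicator V x * ?d\<^sup>2" by (simp split: split_indicator)
      finally show "norm (\<eta> x *\<^sub>R G' (f x) ?w - \<eta> (?y x) *\<^sub>R G' (f (?y x)) ?w) \<le> (M * t * C) * norm ?w
          + (M0 * L / 2) * (inverse t * (indicator V x * ?d\<^sup>2) + t * (norm ?w)\<^sup>2)" by (simp add: mult_ac)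
    qed
    also have "\<dots> = (M * t * C) * (\<integral>x. norm (g (?y x)) \<partial>lborel)
        + (M0 * L / 2) * (inverse t * (\<integral>x. indicator V x * (norm (f (?y x) - f x))\<^sup>2 \<partial>lborel)
          + t * (\<integral>x. (norm (g (?y x)))\<^sup>2 \<partial>lborel))"
      using integrable_norm[OF integrable_lborel_translate[OF g]] sq_int[of "t *\<^sub>R e"] gt by simp
    also have "(\<integral>x. norm (g (?y x)) \<partial>lborel) = N1"
      unfolding N1_def by (rule integral_lborel_translate) measurable
    also have "(\<integral>x. (norm (g (?y x)))\<^sup>2 \<partial>lborel) = energy"
      unfolding energy_def by (rule integral_lborel_translate) measurable
    also have "(M * t * C) * N1 + (M0 * L / 2) * (inverse t * (\<integral>x. indicator V x * (norm (f (?y x) - f x))\<^sup>2 \<partial>lborel) + t * energy)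
        \<le> (M * t * C) * N1 + (M0 * L / 2) * (inverse t * (t\<^sup>2 * energy) + t * energy)"
      using t M0 L_nonneg by (intro add_left_mono mult_left_mono add_right_mono sq) auto
    also have "\<dots> = (M * C * N1 + M0 * L * energy) * t"
      using t by (simp add: power2_eq_square field_simps)
    finally show ?thesis .
  qed

  define B4 where "B4 = M * C * N1 + M0 * L * energy"
  have B4: "B4 \<ge> 0"
    unfolding B4_def N1_def using M M0 C_nonneg L_nonneg energy_nonneg by simp
  have part5: "norm ((\<integral>t. indicator {0..h} t *\<^sub>R b t \<partial>lborel) - h *\<^sub>R b 0) \<le> B4 * h\<^sup>2"
    if h: "0 < h" "h < r / 2" for h
  proof -
    have ind: "integrable lborel (\<lambda>t. indicator {0..h} t *\<^sub>R c)" for c :: "'z::euclidean_space"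
      using borel_integrable_atLeastAtMost'[of 0 h "\<lambda>_. c"] by (simp add: set_integrable_def)
    have "h *\<^sub>R b 0 = (\<integral>t. indicator {0..h} t *\<^sub>R b 0 \<partial>lborel)"
      using h by simp
    then have "norm ((\<integral>t. indicator {0..h} t *\<^sub>R b t \<partial>lborel) - h *\<^sub>R b 0)
        = norm (\<integral>t. indicator {0..h} t *\<^sub>R b t - indicator {0..h} t *\<^sub>R b 0 \<partial>lborel)"
      using part3[OF h] ind[of "b 0"] by simp
    also have "\<dots> \<le> (\<integral>t. indicator {0..h} t *\<^sub>R (B4 * h) \<partial>lborel)"
    proof (rule integral_norm_le[OF ind])
      fix t :: real
      have "norm (b t - b 0) \<le> B4 * h" if "0 \<le> t" "t \<le> h"
      proof (cases "t = 0")
        case False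
        then have "norm (b t - b 0) \<le> B4 * t" unfolding B4_def using that h by (intro part4) auto
        also have "\<dots> \<le> B4 * h" using that B4 by (intro mult_left_mono)
        finally show ?thesis .
      qed (use B4 h in simp)
      then show "norm (indicator {0..h} t *\<^sub>R b t - indicator {0..h} t *\<^sub>R b 0) \<le> indicator {0..h} t *\<^sub>R (B4 * h)"
        by (auto split: split_indicator)
    qed
    also have "\<dots> = B4 * h\<^sup>2" using h by (simp add: power2_eq_square)
    finally show ?thesis .
  qed

  show thesis
  proof (rule that[of "r / 2" "M * N + M0 * L * energy + B4"])
    show "r / 2 > 0" using r by simp
    fix h assume h: "0 < h" "h < r / 2"
    let ?R = "\<integral>x. \<eta> x *\<^sub>R G' (f x) (D h x) \<partial>lborel"
    have "norm ((Q h + h *\<^sub>R X) - (Q h - ?R) - (?R - h *\<^sub>R b 0))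
        \<le> norm (Q h + h *\<^sub>R X) + norm (Q h - ?R) + norm (?R - h *\<^sub>R b 0)"
      by (rule order_trans[OF norm_triangle_ineq4 add_right_mono[OF norm_triangle_ineq4]])
    also have "\<dots> \<le> M * N * h\<^sup>2 + M0 * L * energy * h\<^sup>2 + B4 * h\<^sup>2"
      using part3[OF h] by (intro add_mono part1 part2 h) (use part5[OF h] in simp)
    finally show "norm (h *\<^sub>R (\<integral>x. partial_deriv i \<eta> x *\<^sub>R G (f x) \<partial>lborel) +
        h *\<^sub>R (\<integral>x. \<eta> x *\<^sub>R G' (f x) (g x) \<partial>lborel)) \<le> (M * N + M0 * L * energy + B4) * h\<^sup>2"
      by (simp add: X_def b_def algebra_simps)
  qed
qed

lemma chain_rule:
  "(\<integral>x. partial_deriv i \<eta> x *\<^sub>R G (f x) \<partial>lborel) = - (\<integral>x. \<eta> x *\<^sub>R G' (f x) (g x) \<partial>lborel)"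
proof -
  define Z where "Z = (\<integral>x. partial_deriv i \<eta> x *\<^sub>R G (f x) \<partial>lborel) + (\<integral>x. \<eta> x *\<^sub>R G' (f x) (g x) \<partial>lborel)"
  obtain B r where r: "r > 0" and B: "\<And>h. 0 < h \<Longrightarrow> h < r \<Longrightarrow> norm (h *\<^sub>R Z) \<le> B * h\<^sup>2"
    using chain_rule_error unfolding Z_def scaleR_add_right by blast
  have "norm Z \<le> B * h" if "0 < h" "h < r" for h
    using B[OF that] that by (simp add: power2_eq_square)
  then have "eventually (\<lambda>h. norm Z \<le> B * h) (at_right 0)"
    using r by (auto simp: eventually_at_right)
  moreover have "((\<lambda>h. B * h) \<longlongrightarrow> B * 0) (at_right 0)" by (intro tendsto_intros)
  ultimately have "norm Z \<le> B * 0"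
    using tendsto_le[OF trivial_limit_at_right_real, of "\<lambda>h. B * h" "B * 0" 0 "\<lambda>_. norm Z" "norm Z"] by simp
  then show ?thesis unfolding Z_def by (simp add: eq_neg_iff_add_eq_0)
qed

end

end

section \<open>Weak derivatives of Sobolev functions on an open set\<close>

text \<open>A version of \<open>u\<close> on the whole space that is suited to translations and to Fubini's theorem; extending it by \<open>0\<close> turns integrals
  over \<open>U\<close> into integrals over the whole space.\<close>
definition Borel_version :: "'a::euclidean_space set \<Rightarrow> ('a \<Rightarrow> 'b::real_normed_vector) \<Rightarrow> ('a \<Rightarrow> 'b) \<Rightarrow> bool"
  where "Borel_version U u v \<longleftrightarrow> u \<in> borel_measurable (lebesgue_on U) \<and> v \<in> borel_measurable borel \<and>
    (\<forall>x. x \<notin> U \<longrightarrow> v x = 0) \<and> (AE x in lborel. x \<in> U \<longrightarrow> u x = v x)"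

lemma Borel_versionD:
  assumes "Borel_version U u v"
  shows "u \<in> borel_measurable (lebesgue_on U)" "v \<in> borel_measurable borel"
    "x \<notin> U \<Longrightarrow> v x = 0" "AE x in lborel. x \<in> U \<longrightarrow> u x = v x"
  using assms by (auto simp: Borel_version_def)

text \<open>Coordinatewise, from the corresponding property of the completion for real functions.\<close>
lemma Borel_version_exists:
  fixes u :: "'a::euclidean_space \<Rightarrow> 'b::euclidean_space"
  assumes U: "U \<in> sets borel" and u: "u \<in> borel_measurable (lebesgue_on U)"
  obtains v where "Borel_version U u v"
proof -
  have "\<exists>v. v \<in> borel_measurable borel \<and> (AE x in lborel. indicator U x * (u x \<bullet> b) = v x)" for b
  proof -
    have "(\<lambda>x. u x \<bullet> b) \<in> borel_measurable (lebesgue_on U)" using u by measurable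
    then have "(\<lambda>x. indicator U x * (u x \<bullet> b)) \<in> borel_measurable lebesgue"
      by (subst (asm) borel_measurable_restrict_space_iff) (use U in \<open>auto simp: mult.commute\<close>)
    then show ?thesis
      using completion_ex_borel_measurable_real[of "\<lambda>x. indicator U x * (u x \<bullet> b)" lborel] by auto
  qed
  then obtain v where v: "\<And>b. v b \<in> borel_measurable borel"
    "\<And>b. AE x in lborel. indicator U x * (u x \<bullet> b) = v b x" by metis
  let ?v = "\<lambda>x. indicator U x *\<^sub>R (\<Sum>b\<in>Basis. v b x *\<^sub>R b)"
  have "AE x in lborel. \<forall>b\<in>Basis. indicator U x * (u x \<bullet> b) = v b x"
    by (intro AE_finite_allI finite_Basis v)
  then have "AE x in lborel. x \<in> U \<longrightarrow> u x = ?v x"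
  proof eventually_elim
    case (elim x)
    show ?case
    proof
      assume "x \<in> U"
      with elim have "v b x = u x \<bullet> b" if "b \<in> Basis" for b using that by (metis indicator_simps(1) mult_1)
      then show "u x = ?v x" using \<open>x \<in> U\<close> by (simp add: euclidean_representation)
    qed
  qed
  moreover have "?v \<in> borel_measurable borel" using v(1) U by measurable
  ultimately show thesis using u by (intro that[of ?v]) (simp add: Borel_version_def)
qed

lemma
  fixes u :: "'a::euclidean_space \<Rightarrow> 'b::{banach, second_countable_topology}"
  assumes U: "U \<in> sets borel" and v: "Borel_version U u v"
  shows integrable_Borel_version: "integrable (lebesgue_on U) u \<longleftrightarrow> integrable lborel v"
    and integral_Borel_version: "(\<integral>x. u x \<partial>lebesgue_on U) = (\<integral>x. v x \<partial>lborel)"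
proof -
  have U': "U \<inter> space lebesgue \<in> sets lebesgue" using U by auto
  have m: "(\<lambda>x. indicator U x *\<^sub>R u x) \<in> borel_measurable lebesgue"
    using Borel_versionD(1)[OF v] by (subst (asm) borel_measurable_restrict_space_iff[OF U'])
  have mv: "v \<in> borel_measurable lebesgue" using Borel_versionD(2)[OF v] by (simp add: measurable_completion)
  have ae: "AE x in lebesgue. indicator U x *\<^sub>R u x = v x"
    using AE_completion[OF Borel_versionD(4)[OF v]]
    by eventually_elim (auto simp: Borel_versionD(3)[OF v] split: split_indicator)
  have "integrable (lebesgue_on U) u \<longleftrightarrow> integrable lebesgue (\<lambda>x. indicator U x *\<^sub>R u x)"
    by (rule integrable_restrict_space[OF U'])
  also have "\<dots> \<longleftrightarrow> integrable lebesgue v" by (rule integrable_cong_AE[OF m mv ae])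
  also have "\<dots> \<longleftrightarrow> integrable lborel v" using Borel_versionD(2)[OF v] by (intro integrable_completion) simp
  finally show "integrable (lebesgue_on U) u \<longleftrightarrow> integrable lborel v" .
  have "(\<integral>x. u x \<partial>lebesgue_on U) = (\<integral>x. indicator U x *\<^sub>R u x \<partial>lebesgue)"
    by (rule integral_restrict_space[OF U'])
  also have "\<dots> = (\<integral>x. v x \<partial>lebesgue)" by (rule integral_cong_AE[OF m mv ae])
  also have "\<dots> = (\<integral>x. v x \<partial>lborel)" using Borel_versionD(2)[OF v] by (intro integral_completion) simp
  finally show "(\<integral>x. u x \<partial>lebesgue_on U) = (\<integral>x. v x \<partial>lborel)" .
qed

lemma borel_measurable_lebesgue_on:
  fixes f :: "'a::euclidean_space \<Rightarrow> 'b::topological_space"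
  shows "f \<in> borel_measurable borel \<Longrightarrow> f \<in> borel_measurable (lebesgue_on U)"
  by (intro measurable_restrict_space1 measurable_completion) simp

lemma integral_scaleR_Borel_version:
  fixes u :: "'a::euclidean_space \<Rightarrow> 'b::{banach, second_countable_topology}"
  assumes U: "U \<in> sets borel" and v: "Borel_version U u v" and \<phi>: "\<phi> \<in> borel_measurable borel"
  shows "(\<integral>x. \<phi> x *\<^sub>R u x \<partial>lebesgue_on U) = (\<integral>x. \<phi> x *\<^sub>R v x \<partial>lborel)"
proof (rule integral_Borel_version[OF U])
  have "(\<lambda>x. \<phi> x *\<^sub>R u x) \<in> borel_measurable (lebesgue_on U)"
    using borel_measurable_lebesgue_on[OF \<phi>] Borel_versionD(1)[OF v] by (rule borel_measurable_scaleR)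
  moreover have "(\<lambda>x. \<phi> x *\<^sub>R v x) \<in> borel_measurable borel"
    using \<phi> Borel_versionD(2)[OF v] by (rule borel_measurable_scaleR)
  moreover have "AE x in lborel. x \<in> U \<longrightarrow> \<phi> x *\<^sub>R u x = \<phi> x *\<^sub>R v x"
    using Borel_versionD(4)[OF v] by eventually_elim auto
  ultimately show "Borel_version U (\<lambda>x. \<phi> x *\<^sub>R u x) (\<lambda>x. \<phi> x *\<^sub>R v x)"
    using Borel_versionD(3)[OF v] by (simp add: Borel_version_def)
qed

text \<open>An exhaustion by compact sets exhibits \<open>f\<close> as a pointwise limit of measurable functions.\<close>
lemma locally_integrable_on_measurable:
  assumes U: "open U" and f: "locally_integrable_on U f"
  shows "f \<in> borel_measurable (lebesgue_on U)"
proof -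
  obtain C where C: "\<And>n. compact (C n)" "\<And>n. C n \<subseteq> U" "\<And>n. C n \<subseteq> interior (C (Suc n))" "\<Union>(range C) = U"
    by (rule open_Union_compact_subsets[OF U]) (rule that)
  have "C n \<subseteq> C (Suc n)" for n by (rule order_trans[OF C(3) interior_subset])
  then have mono: "C m \<subseteq> C n" if "m \<le> n" for m n by (rule lift_Suc_mono_le[OF _ that])
  have "(\<lambda>x. indicator (C n) x *\<^sub>R f x) \<in> borel_measurable lebesgue" for n
  proof -
    have "integrable (lebesgue_on (C n)) f"
      using f C(1,2) by (simp add: locally_integrable_on_def)
    then have "f \<in> borel_measurable (lebesgue_on (C n))" by (rule borel_measurable_integrable)
    then show ?thesis
      using borel_compact[OF C(1)] by (intro borel_measurable_restrict_space_iff[THEN iffD1]) simp_all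
  qed
  moreover have "(\<lambda>n. indicator (C n) x *\<^sub>R f x) \<longlonglongrightarrow> indicator U x *\<^sub>R f x" for x
  proof (cases "x \<in> U")
    case True
    then obtain m where "x \<in> C m" using C(4) by blast
    then have "x \<in> C n" if "n \<ge> m" for n using mono[OF that] by blast
    then have "eventually (\<lambda>n. indicator (C n) x *\<^sub>R f x = indicator U x *\<^sub>R f x) sequentially"
      using True by (intro eventually_sequentiallyI[of m]) simp
    then show ?thesis by (rule tendsto_eventually)
  next
    case False
    then have "x \<notin> C n" for n using C(2) by blast
    with False show ?thesis by simp
  qed
  ultimately have "(\<lambda>x. indicator U x *\<^sub>R f x) \<in> borel_measurable lebesgue"
    by (rule borel_measurable_LIMSEQ_metric)
  then show ?thesis
    using borel_open[OF U] by (intro borel_measurable_restrict_space_iff[THEN iffD2]) simp_all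
qed

lemma integrable_lebesgue_on_subset:
  fixes f :: "'a::euclidean_space \<Rightarrow> 'b::{banach, second_countable_topology}"
  assumes "integrable (lebesgue_on U) f" "S \<subseteq> U" "S \<in> sets lebesgue" "U \<in> sets lebesgue"
  shows "integrable (lebesgue_on S) f"
proof -
  have "set_integrable lebesgue U f"
    unfolding set_integrable_def using assms(1,4) by (subst (asm) integrable_restrict_space) auto
  then have "set_integrable lebesgue S f"
    by (rule set_integrable_subset[OF _ assms(3,2)])
  then show ?thesis
    unfolding set_integrable_def using assms(3) by (subst integrable_restrict_space) auto
qed

lemma AE_lebesgue_on_iff:
  assumes "U \<in> sets borel"
  shows "(AE x in lebesgue_on U. P x) \<longleftrightarrow> (AE x in lborel. x \<in> U \<longrightarrow> P x)"
  using assms by (subst AE_restrict_space_iff) (auto simp: AE_completion_iff)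

lemma weak_partial_unique:
  fixes f g h :: "real^'n::finite \<Rightarrow> 'b::euclidean_space"
  assumes U: "open U" and g: "has_weak_partial U i f g" and h: "has_weak_partial U i f h"
  shows "AE x in lebesgue_on U. g x = h x"
proof -
  have UB: "U \<in> sets borel" using U by simp
  have locally: "set_integrable lborel K v"
    if z: "locally_integrable_on U z" and v: "Borel_version U z v" and K: "compact K" "K \<subseteq> U"
    for z v :: "real^'n \<Rightarrow> 'b" and K
  proof -
    have KB: "K \<in> sets borel" using K by (simp add: borel_compact)
    have int: "integrable (lebesgue_on K) z" using z K unfolding locally_integrable_on_def by blast
    have "AE x in lborel. x \<in> K \<longrightarrow> z x = indicator K x *\<^sub>R v x"
      using Borel_versionD(4)[OF v] by eventually_elim (use K(2) in auto)
    then have "Borel_version K z (\<lambda>x. indicator K x *\<^sub>R v x)"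
      using int KB Borel_versionD(2)[OF v] by (simp add: Borel_version_def)
    from integrable_Borel_version[OF KB this] int show ?thesis
      unfolding set_integrable_def by simp
  qed
  have gl: "locally_integrable_on U g" and hl: "locally_integrable_on U h"
    using g h by (simp_all add: has_weak_partial_def)
  obtain v where v: "Borel_version U g v"
    using Borel_version_exists[OF UB locally_integrable_on_measurable[OF U gl]] .
  obtain w where w: "Borel_version U h w"
    using Borel_version_exists[OF UB locally_integrable_on_measurable[OF U hl]] .
  have "AE x in lborel. x \<in> U \<longrightarrow> v x - w x = 0"
  proof (rule fundamental_lemma[OF U])
    show "set_integrable lborel K (\<lambda>x. v x - w x)" if "compact K" "K \<subseteq> U" for K
      by (intro set_integral_diff(1) locally[OF gl v] locally[OF hl w] that)
    fix \<phi> assume \<phi>: "test_function U \<phi>"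
    obtain K where K: "compact K" "K \<subseteq> U" "\<And>x. x \<notin> K \<Longrightarrow> \<phi> x = 0"
      using \<phi> unfolding test_function_def by blast
    note m = smooth_on_borel_measurable[OF test_function_smooth[OF \<phi>]]
    obtain C where C: "\<And>x. \<bar>\<phi> x\<bar> \<le> C" using test_function_bounded[OF \<phi>] by blast
    have int: "integrable lborel (\<lambda>x. \<phi> x *\<^sub>R z x)" if "set_integrable lborel K z" for z :: "real^'n \<Rightarrow> 'b"
    proof -
      have "integrable lborel (\<lambda>x. \<phi> x *\<^sub>R (indicator K x *\<^sub>R z x))"
        using that m C
        unfolding set_integrable_def by (rule integrable_bounded_scaleR)
      also have "(\<lambda>x. \<phi> x *\<^sub>R (indicator K x *\<^sub>R z x)) = (\<lambda>x. \<phi> x *\<^sub>R z x)"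
        using K(3) by (auto simp: fun_eq_iff indicator_def)
      finally show ?thesis .
    qed
    have "- (\<integral>x. \<phi> x *\<^sub>R g x \<partial>lebesgue_on U) = - (\<integral>x. \<phi> x *\<^sub>R h x \<partial>lebesgue_on U)"
      using g h \<phi> unfolding has_weak_partial_def by simp
    then have "(\<integral>x. \<phi> x *\<^sub>R v x \<partial>lborel) = (\<integral>x. \<phi> x *\<^sub>R w x \<partial>lborel)"
      by (simp only: neg_equal_iff_equal integral_scaleR_Borel_version[OF UB v m] integral_scaleR_Borel_version[OF UB w m])
    then show "(\<integral>x. \<phi> x *\<^sub>R (v x - w x) \<partial>lborel) = 0"
      unfolding scaleR_diff_right using int[OF locally[OF gl v K(1,2)]] int[OF locally[OF hl w K(1,2)]] by simp
  qed
  then show ?thesis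
    unfolding AE_lebesgue_on_iff[OF UB] using Borel_versionD(4)[OF v] Borel_versionD(4)[OF w]
    by eventually_elim auto
qed

text \<open>The arbitrary choice made by \<open>weak_partial\<close> agrees almost everywhere with any weak derivative that has been computed.\<close>
lemma weak_partial_eq:
  fixes f g :: "real^'n::finite \<Rightarrow> 'b::euclidean_space"
  assumes "open U" "has_weak_partial U i f g"
  shows "AE x in lebesgue_on U. weak_partial U i f x = g x"
  unfolding weak_partial_def
  by (rule weak_partial_unique[OF assms(1) someI[of "has_weak_partial U i f", OF assms(2)] assms(2)])

text \<open>Boundedness of \<open>U\<close> makes square-integrable functions integrable, so that their Borel versions satisfy the
  hypotheses of the chain rule on the whole space.\<close>
lemma H1_chain_rule:
  fixes f :: "real^'n::finite \<Rightarrow> 'b::euclidean_space"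
    and G :: "'b \<Rightarrow> 'c::euclidean_space" and G' :: "'b \<Rightarrow> 'b \<Rightarrow>\<^sub>L 'c"
  assumes U: "open U" "bounded U" and f: "f \<in> H1 U"
    and G: "G 0 = 0" "\<And>u. (G has_derivative blinfun_apply (G' u)) (at u)"
    and C: "\<And>u. norm (G' u) \<le> C" and L: "\<And>u v. norm (G' u - G' v) \<le> L * norm (u - v)"
  shows "(\<lambda>x. G (f x)) \<in> H1 U"
    and "AE x in lebesgue_on U. weak_partial U i (\<lambda>x. G (f x)) x = G' (f x) (weak_partial U i f x)"
proof -
  let ?M = "lebesgue_on U"
  have UB: "U \<in> sets borel" using U by simp
  have fm: "f \<in> borel_measurable ?M" and f_sq: "integrable ?M (\<lambda>x. (norm (f x))\<^sup>2)"
    using f by (auto simp: H1_def square_integrable_def)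
  have Gm: "G \<in> borel_measurable borel"
    by (intro borel_measurable_continuous_onI continuous_at_imp_continuous_on ballI
        has_derivative_continuous[OF G(2)])
  have sq: "integrable lborel v0 \<and> integrable lborel (\<lambda>x. (norm (v0 x))\<^sup>2)"
    if v: "Borel_version U v v0" and v2: "integrable ?M (\<lambda>x. (norm (v x))\<^sup>2)" for v v0 :: "real^'n \<Rightarrow> 'b"
  proof
    show 2: "integrable lborel (\<lambda>x. (norm (v0 x))\<^sup>2)"
    proof -
      have "AE x in lborel. x \<in> U \<longrightarrow> (norm (v x))\<^sup>2 = (norm (v0 x))\<^sup>2"
        using Borel_versionD(4)[OF v] by eventually_elim auto
      then have "Borel_version U (\<lambda>x. (norm (v x))\<^sup>2) (\<lambda>x. (norm (v0 x))\<^sup>2)"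
        using Borel_versionD(1-3)[OF v] by (simp add: Borel_version_def)
      from integrable_Borel_version[OF UB this] v2 show ?thesis by simp
    qed
    show "integrable lborel v0"
    proof (rule Bochner_Integration.integrable_bound)
      have "integrable lborel (indicator U :: _ \<Rightarrow> real)"
        using UB emeasure_bounded_finite[OF U(2)] by simp
      then show "integrable lborel (\<lambda>x. indicator U x + (norm (v0 x))\<^sup>2)" using 2 by simp
      have "norm (v0 x) \<le> indicator U x + (norm (v0 x))\<^sup>2" for x
      proof (cases "x \<in> U")
        case True
        have "0 \<le> (norm (v0 x) - 1)\<^sup>2 + norm (v0 x)" by (intro add_nonneg_nonneg) auto
        then show ?thesis using True by (simp add: power2_eq_square algebra_simps)
      qed (simp add: Borel_versionD(3)[OF v])
      then show "AE x in lborel. norm (v0 x) \<le> norm (indicator U x + (norm (v0 x))\<^sup>2)"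
        by (intro AE_I2) (auto intro: order_trans[OF _ abs_ge_self])
    qed (use Borel_versionD(2)[OF v] in simp)
  qed
  obtain f0 where f0: "Borel_version U f f0"
    using Borel_version_exists[OF UB fm] .
  have locally: "locally_integrable_on U v" if "integrable ?M v" for v :: "real^'n \<Rightarrow> 'c"
    unfolding locally_integrable_on_def
    using that U by (auto intro!: integrable_lebesgue_on_subset[of U v] simp: borel_compact)
  have main: "has_weak_partial U i (\<lambda>x. G (f x)) (\<lambda>x. G' (f x) (g x))
      \<and> (\<lambda>x. G (f x)) \<in> square_integrable ?M \<and> (\<lambda>x. G' (f x) (g x)) \<in> square_integrable ?M"
    if g': "g \<in> square_integrable ?M" "has_weak_partial U i f g" for i g
  proof -
    have gm: "g \<in> borel_measurable ?M" and g_sq: "integrable ?M (\<lambda>x. (norm (g x))\<^sup>2)"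
      using g' by (auto simp: square_integrable_def)
    obtain g0 where g0: "Borel_version U g g0"
      using Borel_version_exists[OF UB gm] .
    interpret weak_derivative_composition U i f0 g0 G G' C L
    proof
      show "(\<integral>x. partial_deriv i \<phi> x *\<^sub>R f0 x \<partial>lborel) = - (\<integral>x. \<phi> x *\<^sub>R g0 x \<partial>lborel)"
        if \<phi>: "test_function U \<phi>" for \<phi>
      proof -
        note m = smooth_on_borel_measurable[OF test_function_smooth]
        have "(\<integral>x. partial_deriv i \<phi> x *\<^sub>R f x \<partial>?M) = - (\<integral>x. \<phi> x *\<^sub>R g x \<partial>?M)"
          using g'(2) \<phi> unfolding has_weak_partial_def by blast
        then show ?thesis
          by (simp only: integral_scaleR_Borel_version[OF UB f0 m[OF test_function_partial_deriv[OF \<phi>]]]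
              integral_scaleR_Borel_version[OF UB g0 m[OF \<phi>]])
      qed
    qed (use sq[OF f0 f_sq] sq[OF g0 g_sq] U(1) G C L in simp_all)
    have Gfm: "(\<lambda>x. G (f x)) \<in> borel_measurable ?M" using fm Gm by measurable
    have Ggm: "(\<lambda>x. G' (f x) (g x)) \<in> borel_measurable ?M"
      by (rule G'_measurable[OF fm gm])
    have "AE x in lborel. x \<in> U \<longrightarrow> G (f x) = G (f0 x)"
      using Borel_versionD(4)[OF f0] by eventually_elim auto
    then have Gf0: "Borel_version U (\<lambda>x. G (f x)) (\<lambda>x. G (f0 x))"
      using Gfm Borel_versionD(3)[OF f0] by (simp add: Borel_version_def G(1))
    have "AE x in lborel. x \<in> U \<longrightarrow> G' (f x) (g x) = G' (f0 x) (g0 x)"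
      using Borel_versionD(4)[OF f0] Borel_versionD(4)[OF g0] by eventually_elim auto
    then have Gg0: "Borel_version U (\<lambda>x. G' (f x) (g x)) (\<lambda>x. G' (f0 x) (g0 x))"
      using Ggm Borel_versionD(3)[OF g0] by (simp add: Borel_version_def blinfun.zero_right)
    have weak: "has_weak_partial U i (\<lambda>x. G (f x)) (\<lambda>x. G' (f x) (g x))"
      unfolding has_weak_partial_def
    proof (intro conjI allI impI)
      show "locally_integrable_on U (\<lambda>x. G (f x))"
        using integrable_G_f by (intro locally) (simp only: integrable_Borel_version[OF UB Gf0])
      show "locally_integrable_on U (\<lambda>x. G' (f x) (g x))"
        using integrable_G'_apply[OF g Borel_versionD(2)[OF f0]]
        by (intro locally) (simp only: integrable_Borel_version[OF UB Gg0])
      fix \<phi> assume \<phi>: "test_function U \<phi>"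
      note m = smooth_on_borel_measurable[OF test_function_smooth]
      show "(\<integral>x. partial_deriv i \<phi> x *\<^sub>R G (f x) \<partial>?M) = - (\<integral>x. \<phi> x *\<^sub>R G' (f x) (g x) \<partial>?M)"
        using chain_rule[OF \<phi>]
        by (simp only: integral_scaleR_Borel_version[OF UB Gf0 m[OF test_function_partial_deriv[OF \<phi>]]]
            integral_scaleR_Borel_version[OF UB Gg0 m[OF \<phi>]])
    qed
    have L2: "z \<in> square_integrable ?M"
      if "z \<in> borel_measurable ?M" "integrable ?M (\<lambda>x. (norm (v x))\<^sup>2)" "\<And>x. norm (z x) \<le> C * norm (v x)"
      for z :: "real^'n \<Rightarrow> 'c" and v :: "real^'n \<Rightarrow> 'b"
      unfolding square_integrable_def
    proof (intro CollectI conjI that(1))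
      show "integrable ?M (\<lambda>x. (norm (z x))\<^sup>2)"
      proof (rule Bochner_Integration.integrable_bound)
        show "integrable ?M (\<lambda>x. C\<^sup>2 * (norm (v x))\<^sup>2)" using that(2) by simp
        have "(norm (z x))\<^sup>2 \<le> C\<^sup>2 * (norm (v x))\<^sup>2" for x
          using power_mono[OF that(3)[of x], of 2] by (simp add: power_mult_distrib)
        then show "AE x in ?M. norm ((norm (z x))\<^sup>2) \<le> norm (C\<^sup>2 * (norm (v x))\<^sup>2)" by simp
        show "(\<lambda>x. (norm (z x))\<^sup>2) \<in> borel_measurable ?M" using that(1) by measurable
      qed
    qed
    have "(\<lambda>x. G (f x)) \<in> square_integrable ?M"
      by (rule L2[OF Gfm f_sq G_bound])
    moreover have "(\<lambda>x. G' (f x) (g x)) \<in> square_integrable ?M"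
      by (rule L2[OF Ggm g_sq G'_apply_bound])
    ultimately show ?thesis using weak by blast
  qed
  have "\<exists>g. g \<in> square_integrable ?M \<and> has_weak_partial U i f g" for i
    using f unfolding H1_def by blast
  then obtain g where g: "\<And>i. g i \<in> square_integrable ?M" "\<And>i. has_weak_partial U i f (g i)"
    by metis
  show "(\<lambda>x. G (f x)) \<in> H1 U"
    unfolding H1_def using main[OF g(1) g(2)] by blast
  have "AE x in ?M. weak_partial U i (\<lambda>x. G (f x)) x = G' (f x) (g i x)"
    using main[OF g(1) g(2)] by (intro weak_partial_eq U) blast
  moreover have "AE x in ?M. weak_partial U i f x = g i x"
    by (rule weak_partial_eq[OF U(1) g(2)])
  ultimately show "AE x in ?M. weak_partial U i (\<lambda>x. G (f x)) x = G' (f x) (weak_partial U i f x)"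
    by eventually_elim simp
qed

section \<open>The damped cube\<close>

definition damped_cube :: "real \<Rightarrow> 'b::real_inner \<Rightarrow> 'b" where
  "damped_cube \<epsilon> z = ((norm z)\<^sup>2 / (1 + \<epsilon> * (norm z)\<^sup>2)) *\<^sub>R z"

definition damped_cube_deriv :: "real \<Rightarrow> 'b::real_inner \<Rightarrow> 'b \<Rightarrow>\<^sub>L 'b" where
  "damped_cube_deriv \<epsilon> z = Blinfun (\<lambda>w. ((norm z)\<^sup>2 / (1 + \<epsilon> * (norm z)\<^sup>2)) *\<^sub>R w +
    (2 * (z \<bullet> w) / (1 + \<epsilon> * (norm z)\<^sup>2)\<^sup>2) *\<^sub>R z)"

lemma damped_cube_deriv_apply:
  "damped_cube_deriv \<epsilon> z w = ((norm z)\<^sup>2 / (1 + \<epsilon> * (norm z)\<^sup>2)) *\<^sub>R w +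
    (2 * (z \<bullet> w) / (1 + \<epsilon> * (norm z)\<^sup>2)\<^sup>2) *\<^sub>R z"
proof -
  have "bounded_linear (\<lambda>w. ((norm z)\<^sup>2 / (1 + \<epsilon> * (norm z)\<^sup>2)) *\<^sub>R w +
      (2 / (1 + \<epsilon> * (norm z)\<^sup>2)\<^sup>2 * (z \<bullet> w)) *\<^sub>R z)"
    by (intro bounded_linear_add bounded_linear_scaleR_right bounded_linear_scaleR_const
        bounded_linear_const_mult bounded_linear_inner_right)
  then show ?thesis
    unfolding damped_cube_deriv_def by (subst bounded_linear_Blinfun_apply) (simp_all add: mult_ac)
qed

lemma damped_cube_has_derivative:
  fixes z :: "'b::real_inner"
  assumes \<epsilon>: "\<epsilon> \<ge> 0"
  shows "(damped_cube \<epsilon> has_derivative damped_cube_deriv \<epsilon> z) (at z)"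
proof -
  have pos: "1 + \<epsilon> * (z \<bullet> z) > 0"
    using \<epsilon> by (simp add: add_pos_nonneg)
  have r: "((\<lambda>z. (z \<bullet> z) / (1 + \<epsilon> * (z \<bullet> z))) has_derivative
      (\<lambda>w. 2 * (z \<bullet> w) / (1 + \<epsilon> * (z \<bullet> z))\<^sup>2)) (at z)"
  proof -
    have "((\<lambda>s. s / (1 + \<epsilon> * s)) has_real_derivative 1 / (1 + \<epsilon> * (z \<bullet> z))\<^sup>2) (at (z \<bullet> z))"
      using pos by (auto intro!: derivative_eq_intros simp: power2_eq_square)
    then have outer: "((\<lambda>s. s / (1 + \<epsilon> * s)) has_derivative (\<lambda>h. h / (1 + \<epsilon> * (z \<bullet> z))\<^sup>2)) (at (z \<bullet> z))"
      by (rule has_derivative_eq_rhs[OF has_field_derivative_imp_has_derivative]) (simp add: fun_eq_iff)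
    have "((\<lambda>z. z \<bullet> z) has_derivative (\<lambda>w. 2 * (z \<bullet> w))) (at z)"
      using has_derivative_inner[OF has_derivative_ident has_derivative_ident, of z UNIV]
      by (simp add: inner_commute)
    from has_derivative_compose[OF this outer] show ?thesis by simp
  qed
  have "((\<lambda>z. ((z \<bullet> z) / (1 + \<epsilon> * (z \<bullet> z))) *\<^sub>R z) has_derivative
      (\<lambda>w. ((z \<bullet> z) / (1 + \<epsilon> * (z \<bullet> z))) *\<^sub>R w + (2 * (z \<bullet> w) / (1 + \<epsilon> * (z \<bullet> z))\<^sup>2) *\<^sub>R z)) (at z)"
    by (rule has_derivative_scaleR[OF r has_derivative_ident])
  then show ?thesis
    unfolding damped_cube_def[abs_def] damped_cube_deriv_apply[abs_def] power2_norm_eq_inner .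
qed

text \<open>With \<open>q(z) = 1 / (1 + \<epsilon>\<bar>z\<bar>\<^sup>2)\<close> and \<open>k(z) = q(z) z\<close> the derivative is
  \<open>w \<mapsto> (1 - q(z)) / \<epsilon> \<sqdot> w + 2 \<langle>k(z), w\<rangle> k(z)\<close>. So it suffices that \<open>q\<close> and \<open>k\<close> are bounded and Lipschitz;
  the bound \<open>\<bar>k\<bar> \<le> 1/\<epsilon>\<close> is crude, but \<open>\<epsilon>\<close> is fixed while the chain rule is applied.\<close>
lemma damped_cube_deriv_bounds:
  fixes \<epsilon> :: real
  assumes \<epsilon>: "0 < \<epsilon>" "\<epsilon> \<le> 1"
  obtains C L where "\<And>z :: 'b::real_inner. norm (damped_cube_deriv \<epsilon> z) \<le> C"
    and "\<And>u v :: 'b. norm (damped_cube_deriv \<epsilon> u - damped_cube_deriv \<epsilon> v) \<le> L * norm (u - v)"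
proof -
  define q :: "'b \<Rightarrow> real" where "q z = 1 / (1 + \<epsilon> * (norm z)\<^sup>2)" for z
  define k :: "'b \<Rightarrow> 'b" where "k z = q z *\<^sub>R z" for z
  have pos: "1 + \<epsilon> * (norm z)\<^sup>2 > 0" for z :: 'b using \<epsilon> by (simp add: add_pos_nonneg)
  have q: "q z > 0" "q z \<le> 1" for z using pos[of z] \<epsilon> by (auto simp: q_def)
  \<comment> \<open>The identity behind the formula: products of \<open>q\<close> with \<open>\<bar>z\<bar>\<^sup>2\<close> stay bounded.\<close>
  have qsq: "\<epsilon> * (norm z)\<^sup>2 * q z = 1 - q z" for z
    using pos[of z] by (simp add: q_def field_simps)
  have D_apply: "damped_cube_deriv \<epsilon> z w = ((1 - q z) / \<epsilon>) *\<^sub>R w + (2 * (k z \<bullet> w)) *\<^sub>R k z" for z w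
  proof -
    have "(norm z)\<^sup>2 / (1 + \<epsilon> * (norm z)\<^sup>2) = (1 - q z) / \<epsilon>"
      using \<epsilon> qsq[of z] by (simp add: q_def field_simps)
    moreover have "2 * (z \<bullet> w) / (1 + \<epsilon> * (norm z)\<^sup>2)\<^sup>2 = 2 * (k z \<bullet> w) * q z"
      by (simp add: k_def q_def power2_eq_square)
    ultimately show ?thesis by (simp add: damped_cube_deriv_apply k_def)
  qed
  have norm_k: "norm (k z) = q z * norm z" for z using q(1)[of z] by (simp add: k_def)
  have k: "norm (k z) \<le> 1 / \<epsilon>" for z
  proof -
    have "0 \<le> (norm z - 1)\<^sup>2 + norm z" by (intro add_nonneg_nonneg) auto
    then have "\<epsilon> * norm z \<le> \<epsilon> * (1 + (norm z)\<^sup>2)"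
      using \<epsilon> by (intro mult_left_mono) (auto simp: power2_eq_square algebra_simps)
    also have "\<dots> \<le> 1 + \<epsilon> * (norm z)\<^sup>2" using \<epsilon> by (simp add: algebra_simps)
    finally show ?thesis using \<epsilon> pos[of z] by (simp add: norm_k q_def field_simps)
  qed
  have dq: "\<bar>q u - q v\<bar> \<le> \<epsilon> * norm (u - v) * ((norm u + norm v) * (q u * q v))" for u v
  proof -
    have "q u - q v = \<epsilon> * ((norm v - norm u) * (norm u + norm v)) * (q u * q v)"
      using pos[of u] pos[of v] by (simp add: q_def field_simps power2_eq_square)
    then have "\<bar>q u - q v\<bar> = \<epsilon> * (\<bar>norm v - norm u\<bar> * (norm u + norm v)) * (q u * q v)"
      using \<epsilon> q(1)[of u] q(1)[of v] by (simp add: abs_mult)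
    also have "\<dots> \<le> \<epsilon> * (norm (u - v) * (norm u + norm v)) * (q u * q v)"
      using \<epsilon> q(1)[of u] q(1)[of v]
      by (intro mult_right_mono mult_left_mono) (auto simp: norm_triangle_ineq3 norm_minus_commute abs_minus_commute)
    finally show ?thesis by (simp add: mult_ac)
  qed
  have q_lipschitz: "\<bar>q u - q v\<bar> \<le> 2 * norm (u - v)" for u v
  proof -
    have "(norm u + norm v) * (q u * q v) = norm (k u) * q v + norm (k v) * q u"
      by (simp add: norm_k algebra_simps)
    also have "\<dots> \<le> (1 / \<epsilon>) * 1 + (1 / \<epsilon>) * 1"
      using q k \<epsilon> by (intro add_mono mult_mono) (auto intro: less_imp_le)
    finally have "\<epsilon> * norm (u - v) * ((norm u + norm v) * (q u * q v)) \<le> \<epsilon> * norm (u - v) * (2 / \<epsilon>)"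
      using \<epsilon> by (intro mult_left_mono) auto
    with dq[of u v] show ?thesis using \<epsilon> by simp
  qed
  have k_lipschitz: "norm (k u - k v) \<le> (2 + 1 / \<epsilon>) * norm (u - v)" for u v
  proof -
    have "\<bar>q u - q v\<bar> * norm v \<le> \<epsilon> * norm (u - v) * ((norm u + norm v) * (q u * q v)) * norm v"
      by (intro mult_right_mono dq) simp
    also have "\<dots> = norm (u - v) * (\<epsilon> * norm (k u) * norm (k v) + (\<epsilon> * (norm v)\<^sup>2 * q v) * q u)"
      by (simp add: norm_k power2_eq_square algebra_simps)
    also have "\<dots> \<le> norm (u - v) * (\<epsilon> * (1 / \<epsilon>) * (1 / \<epsilon>) + 1 * 1)"
    proof -
      have "\<epsilon> * norm (k u) * norm (k v) \<le> \<epsilon> * (1 / \<epsilon>) * (1 / \<epsilon>)"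
        using \<epsilon> k by (intro mult_mono) auto
      moreover have "(\<epsilon> * (norm v)\<^sup>2 * q v) * q u \<le> 1 * 1"
        unfolding qsq using q[of u] q[of v] by (intro mult_mono) auto
      ultimately show ?thesis by (intro mult_left_mono add_mono) auto
    qed
    finally have "\<bar>q u - q v\<bar> * norm v \<le> norm (u - v) * (1 / \<epsilon> + 1)" using \<epsilon> by simp
    moreover have "k u - k v = q u *\<^sub>R (u - v) + (q u - q v) *\<^sub>R v"
      by (simp add: k_def algebra_simps)
    then have "norm (k u - k v) \<le> q u * norm (u - v) + \<bar>q u - q v\<bar> * norm v"
      using norm_triangle_ineq[of "q u *\<^sub>R (u - v)" "(q u - q v) *\<^sub>R v"] q(1)[of u] by simp
    moreover have "q u * norm (u - v) \<le> 1 * norm (u - v)"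
      using q(2) by (rule mult_right_mono) simp
    ultimately show ?thesis by (simp add: algebra_simps)
  qed
  show thesis
  proof
    fix z :: 'b
    show "norm (damped_cube_deriv \<epsilon> z) \<le> 1 / \<epsilon> + 2 / \<epsilon> * (1 / \<epsilon>)"
    proof (rule norm_blinfun_bound)
      fix w
      have "norm (damped_cube_deriv \<epsilon> z w) \<le> (1 - q z) / \<epsilon> * norm w + 2 * \<bar>k z \<bullet> w\<bar> * norm (k z)"
        unfolding D_apply using q(2)[of z] \<epsilon> by (intro order_trans[OF norm_triangle_ineq]) (simp add: abs_mult)
      also have "\<dots> \<le> 1 / \<epsilon> * norm w + 2 * (1 / \<epsilon> * norm w) * (1 / \<epsilon>)"
      proof (intro add_mono mult_mono)
        show "(1 - q z) / \<epsilon> \<le> 1 / \<epsilon>" using q(1)[of z] \<epsilon> by (simp add: divide_right_mono)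
        show "\<bar>k z \<bullet> w\<bar> \<le> 1 / \<epsilon> * norm w"
          by (rule order_trans[OF Cauchy_Schwarz_ineq2 mult_right_mono[OF k norm_ge_zero]])
      qed (use \<epsilon> k in auto)
      finally show "norm (damped_cube_deriv \<epsilon> z w) \<le> (1 / \<epsilon> + 2 / \<epsilon> * (1 / \<epsilon>)) * norm w"
        by (simp add: algebra_simps)
    qed (use \<epsilon> in simp)
  next
    fix u v :: 'b
    let ?d = "norm (u - v)"
    show "norm (damped_cube_deriv \<epsilon> u - damped_cube_deriv \<epsilon> v) \<le> (2 / \<epsilon> + 4 / \<epsilon> * (2 + 1 / \<epsilon>)) * ?d"
    proof (rule norm_blinfun_bound)
      fix w
      have "(damped_cube_deriv \<epsilon> u - damped_cube_deriv \<epsilon> v) w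
          = ((q v - q u) / \<epsilon>) *\<^sub>R w + (2 * ((k u - k v) \<bullet> w)) *\<^sub>R k u + (2 * (k v \<bullet> w)) *\<^sub>R (k u - k v)"
        by (simp add: blinfun.diff_left D_apply algebra_simps inner_diff_left diff_divide_distrib)
      then have "norm ((damped_cube_deriv \<epsilon> u - damped_cube_deriv \<epsilon> v) w)
          \<le> \<bar>q u - q v\<bar> / \<epsilon> * norm w + 2 * \<bar>(k u - k v) \<bullet> w\<bar> * norm (k u) + 2 * \<bar>k v \<bullet> w\<bar> * norm (k u - k v)"
        using \<epsilon> by (auto intro!: order_trans[OF norm_triangle_ineq] add_mono simp: abs_mult abs_minus_commute)
      also have "\<dots> \<le> 2 * ?d / \<epsilon> * norm w + 2 * ((2 + 1 / \<epsilon>) * ?d * norm w) * (1 / \<epsilon>)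
          + 2 * (1 / \<epsilon> * norm w) * ((2 + 1 / \<epsilon>) * ?d)"
      proof (intro add_mono mult_mono)
        show "\<bar>q u - q v\<bar> / \<epsilon> \<le> 2 * ?d / \<epsilon>" using \<epsilon> by (intro divide_right_mono q_lipschitz) simp
        show "\<bar>(k u - k v) \<bullet> w\<bar> \<le> (2 + 1 / \<epsilon>) * ?d * norm w"
          by (rule order_trans[OF Cauchy_Schwarz_ineq2 mult_right_mono[OF k_lipschitz norm_ge_zero]])
        show "\<bar>k v \<bullet> w\<bar> \<le> 1 / \<epsilon> * norm w"
          by (rule order_trans[OF Cauchy_Schwarz_ineq2 mult_right_mono[OF k norm_ge_zero]])
      qed (use \<epsilon> k k_lipschitz in auto)
      finally show "norm ((damped_cube_deriv \<epsilon> u - damped_cube_deriv \<epsilon> v) w)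
          \<le> (2 / \<epsilon> + 4 / \<epsilon> * (2 + 1 / \<epsilon>)) * ?d * norm w"
        by (simp add: algebra_simps)
    qed (use \<epsilon> in simp)
  qed
qed

text \<open>Gauge covariance: since \<open>i t z\<close> is orthogonal to \<open>z\<close>, the derivative of the damped cube maps \<open>i t z\<close> to \<open>i t\<close> times the damped cube.
  With \<open>w = p - i t z\<close> the expression becomes the quadratic form of the derivative at \<open>w\<close>, which is positive because the
  radial factor increases.\<close>
lemma magnetic_damped_cube_nonneg:
  fixes z p :: complex and t :: real
  assumes "\<epsilon> \<ge> 0"
  shows "0 \<le> Re ((p - \<i> * complex_of_real t * z) *
    cnj (damped_cube_deriv \<epsilon> z p - \<i> * complex_of_real t * damped_cube \<epsilon> z))"
proof -
  let ?r = "(norm z)\<^sup>2 / (1 + \<epsilon> * (norm z)\<^sup>2)" and ?s = "2 / (1 + \<epsilon> * (norm z)\<^sup>2)\<^sup>2"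
  define w where "w = p - \<i> * complex_of_real t * z"
  have "z \<bullet> (\<i> * complex_of_real t * z) = 0"
    by (simp add: inner_complex_def algebra_simps)
  then have "z \<bullet> p = z \<bullet> w" by (simp add: w_def inner_diff_right)
  have r: "r *\<^sub>R p - \<i> * complex_of_real t * (r *\<^sub>R z) = r *\<^sub>R w" for r :: real
    by (simp add: w_def scaleR_conv_of_real algebra_simps)
  have "damped_cube_deriv \<epsilon> z p - \<i> * complex_of_real t * damped_cube \<epsilon> z =
      ?r *\<^sub>R w + (2 * (z \<bullet> p) / (1 + \<epsilon> * (norm z)\<^sup>2)\<^sup>2) *\<^sub>R z"
    unfolding damped_cube_deriv_apply damped_cube_def r[symmetric] by (simp only: diff_add_eq)
  with \<open>z \<bullet> p = z \<bullet> w\<close> have "damped_cube_deriv \<epsilon> z p - \<i> * complex_of_real t * damped_cube \<epsilon> z =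
      ?r *\<^sub>R w + (?s * (z \<bullet> w)) *\<^sub>R z" by simp
  moreover have "Re (w * cnj (r *\<^sub>R w + s *\<^sub>R z)) = r * (w \<bullet> w) + s * (z \<bullet> w)" for r s
    by (simp add: inner_complex_def algebra_simps)
  ultimately have "Re (w * cnj (damped_cube_deriv \<epsilon> z p - \<i> * complex_of_real t * damped_cube \<epsilon> z))
      = ?r * (w \<bullet> w) + ?s * (z \<bullet> w)\<^sup>2"
    by (simp only: power2_eq_square mult.assoc)
  also have "\<dots> \<ge> 0" using assms by (intro add_nonneg_nonneg mult_nonneg_nonneg divide_nonneg_nonneg) auto
  finally show ?thesis by (simp add: w_def)
qed

section \<open>Removal of the damping\<close>

text \<open>The inequality \<open>2t\<^sup>2 \<le> t\<^sup>3 + t\<close> with \<open>t = u\<^sup>2\<close> bounds the right-hand side by half of the sixth-power term plus half of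
  \<open>\<integral>u\<^sup>2\<close>. As the sixth-power term is at most the right-hand side, both sides are bounded by \<open>\<integral>u\<^sup>2\<close>, uniformly in \<open>\<epsilon>\<close>. This
  is what monotone convergence needs, and it produces the fourth moment of \<open>u\<close>.\<close>
lemma quartic_inequality_limit:
  fixes u :: "'a \<Rightarrow> real" and a :: real
  assumes u [measurable]: "u \<in> borel_measurable M" and u2: "integrable M (\<lambda>x. (u x)\<^sup>2)"
    and S [measurable]: "S \<in> sets M" and a: "a > 0"
    and damped: "\<And>\<epsilon>. 0 < \<epsilon> \<Longrightarrow> \<epsilon> \<le> 1 \<Longrightarrow>
      integrable M (\<lambda>x. indicator S x * (u x ^ 6 / (1 + \<epsilon> * (u x)\<^sup>2))) \<and>
      a * (\<integral>x. (1 - indicator S x) * (u x ^ 4 / (1 + \<epsilon> * (u x)\<^sup>2)) \<partial>M)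
        + (\<integral>x. indicator S x * (u x ^ 6 / (1 + \<epsilon> * (u x)\<^sup>2)) \<partial>M)
      \<le> (\<integral>x. indicator S x * (u x ^ 4 / (1 + \<epsilon> * (u x)\<^sup>2)) \<partial>M)"
  shows "integrable M (\<lambda>x. (1 - indicator S x) * u x ^ 4) \<and> integrable M (\<lambda>x. indicator S x * u x ^ 4) \<and>
    a * (\<integral>x. (1 - indicator S x) * u x ^ 4 \<partial>M) \<le> (\<integral>x. indicator S x * u x ^ 4 \<partial>M)"
proof -
  define F where "F n x = u x ^ 4 / (1 + inverse (real (Suc n)) * (u x)\<^sup>2)" for n x
  define F6 where "F6 n x = u x ^ 6 / (1 + inverse (real (Suc n)) * (u x)\<^sup>2)" for n x
  define I where "I n = (\<integral>x. indicator S x * F n x \<partial>M)" for n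
  define J where "J n = (\<integral>x. (1 - indicator S x) * F n x \<partial>M)" for n
  define E where "E = (\<integral>x. (u x)\<^sup>2 \<partial>M)"
  have pos: "1 + inverse (real (Suc n)) * (u x)\<^sup>2 > 0" for n x
    by (intro add_pos_nonneg) auto
  have F_nonneg: "F n x \<ge> 0" for n x
    unfolding F_def using pos[of n x] by (intro divide_nonneg_pos) auto
  have F6_nonneg: "F6 n x \<ge> 0" for n x
    unfolding F6_def using pos[of n x] by (intro divide_nonneg_pos) auto
  have [measurable]: "F n \<in> borel_measurable M" for n unfolding F_def by measurable
  have F_int: "integrable M (F n)" for n
  proof (rule Bochner_Integration.integrable_bound)
    show "integrable M (\<lambda>x. real (Suc n) * (u x)\<^sup>2)" using u2 by simp
    have "F n x \<le> real (Suc n) * (u x)\<^sup>2" for x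
    proof -
      have "u x ^ 4 = real (Suc n) * (u x)\<^sup>2 * (inverse (real (Suc n)) * (u x)\<^sup>2)"
        by (simp add: power4_eq_xxxx power2_eq_square)
      also have "\<dots> \<le> real (Suc n) * (u x)\<^sup>2 * (1 + inverse (real (Suc n)) * (u x)\<^sup>2)"
        by (intro mult_left_mono) auto
      finally show ?thesis unfolding F_def using pos[of n x] by (simp only: pos_divide_le_eq)
    qed
    then show "AE x in M. norm (F n x) \<le> norm (real (Suc n) * (u x)\<^sup>2)"
      using F_nonneg by (intro AE_I2) simp
  qed measurable
  have int: "integrable M (\<lambda>x. indicator S x * F n x)" "integrable M (\<lambda>x. (1 - indicator S x) * F n x)" for n
  proof -
    show 1: "integrable M (\<lambda>x. indicator S x * F n x)"
      using integrable_mult_indicator[OF S F_int] by simp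
    show "integrable M (\<lambda>x. (1 - indicator S x) * F n x)"
      using Bochner_Integration.integrable_diff[OF F_int 1] by (simp add: algebra_simps)
  qed
  have F6_int: "integrable M (\<lambda>x. indicator S x * F6 n x)"
    and ineq: "a * J n + (\<integral>x. indicator S x * F6 n x \<partial>M) \<le> I n" for n
    using damped[of "inverse (real (Suc n))"] unfolding I_def J_def F_def F6_def
    by (auto simp: inverse_le_1_iff)
  have J_nonneg: "J n \<ge> 0" for n
    unfolding J_def using F_nonneg by (intro Bochner_Integration.integral_nonneg) (auto split: split_indicator)
  have I_le: "I n \<le> E" for n
  proof -
    have "I n \<le> (\<integral>x. (indicator S x * F6 n x + (u x)\<^sup>2) / 2 \<partial>M)"
      unfolding I_def
    proof (rule integral_mono[OF int(1)])
      show "integrable M (\<lambda>x. (indicator S x * F6 n x + (u x)\<^sup>2) / 2)" using F6_int u2 by simp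
      fix x
      define d where "d = 1 + inverse (real (Suc n)) * (u x)\<^sup>2"
      have d: "d \<ge> 1" by (simp add: d_def)
      \<comment> \<open>\<open>t (t - 1)\<^sup>2 \<ge> 0\<close> for \<open>t = u\<^sup>2\<close>.\<close>
      have "0 \<le> (u x)\<^sup>2 * ((u x)\<^sup>2 - 1)\<^sup>2" by simp
      also have "\<dots> = u x ^ 6 + (u x)\<^sup>2 - 2 * u x ^ 4" by algebra
      finally have "2 * u x ^ 4 \<le> u x ^ 6 + (u x)\<^sup>2" by simp
      also have "\<dots> \<le> u x ^ 6 + (u x)\<^sup>2 * d"
        using mult_left_mono[OF d zero_le_power2[of "u x"]] by simp
      finally have "2 * u x ^ 4 / d \<le> (u x ^ 6 + (u x)\<^sup>2 * d) / d"
        using d by (intro divide_right_mono) auto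
      also have "\<dots> = u x ^ 6 / d + (u x)\<^sup>2" using d by (simp add: add_divide_distrib)
      finally have "2 * F n x \<le> F6 n x + (u x)\<^sup>2" unfolding F_def F6_def d_def by simp
      then show "indicator S x * F n x \<le> (indicator S x * F6 n x + (u x)\<^sup>2) / 2"
        by (auto split: split_indicator)
    qed
    also have "\<dots> = ((\<integral>x. indicator S x * F6 n x \<partial>M) + E) / 2"
      unfolding E_def using F6_int u2 by simp
    also have "\<dots> \<le> (I n + E) / 2"
      using ineq[of n] mult_nonneg_nonneg[OF less_imp_le[OF a] J_nonneg[of n]] by simp
    finally show ?thesis by simp
  qed
  have IJ: "a * J n \<le> I n" for n
  proof -
    have "(\<integral>x. indicator S x * F6 n x \<partial>M) \<ge> 0"
      using F6_nonneg by (intro Bochner_Integration.integral_nonneg) (auto split: split_indicator)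
    then show ?thesis using ineq[of n] by simp
  qed
  have mono: "F m x \<le> F n x" if "m \<le> n" for m n x
  proof -
    have "inverse (real (Suc n)) \<le> inverse (real (Suc m))" using that by (intro le_imp_inverse_le) auto
    then have "1 + inverse (real (Suc n)) * (u x)\<^sup>2 \<le> 1 + inverse (real (Suc m)) * (u x)\<^sup>2"
      by (intro add_left_mono mult_right_mono) auto
    then show ?thesis unfolding F_def using pos by (intro divide_left_mono) auto
  qed
  have lim: "(\<lambda>n. F n x) \<longlonglongrightarrow> u x ^ 4" for x
  proof -
    have "(\<lambda>n. F n x) \<longlonglongrightarrow> u x ^ 4 / (1 + 0 * (u x)\<^sup>2)"
      unfolding F_def by (intro tendsto_intros LIMSEQ_inverse_real_of_nat) simp
    then show ?thesis by simp
  qed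
  have monotone: "integrable M (\<lambda>x. c x * u x ^ 4) \<and> (\<lambda>n. \<integral>x. c x * F n x \<partial>M) \<longlonglongrightarrow> (\<integral>x. c x * u x ^ 4 \<partial>M)"
    if c: "\<And>x. c x \<ge> 0" "c \<in> borel_measurable M" and ci: "\<And>n. integrable M (\<lambda>x. c x * F n x)"
      and bd: "\<And>n. (\<integral>x. c x * F n x \<partial>M) \<le> B" for c :: "'a \<Rightarrow> real" and B
  proof -
    have m: "mono (\<lambda>n. c x * F n x)" for x
      using mono c(1) by (intro monoI mult_left_mono)
    have "incseq (\<lambda>n. \<integral>x. c x * F n x \<partial>M)"
      using mono c(1) by (intro monoI integral_mono ci mult_left_mono) auto
    then obtain l where l: "(\<lambda>n. \<integral>x. c x * F n x \<partial>M) \<longlonglongrightarrow> l"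
      using incseq_convergent[of _ B] bd by blast
    have "has_bochner_integral M (\<lambda>x. c x * u x ^ 4) l"
    proof (rule has_bochner_integral_monotone_convergence[OF ci _ _ l])
      show "AE x in M. mono (\<lambda>n. c x * F n x)" using m by simp
      show "AE x in M. (\<lambda>n. c x * F n x) \<longlonglongrightarrow> c x * u x ^ 4"
        by (intro AE_I2 tendsto_mult lim tendsto_const)
      show "(\<lambda>x. c x * u x ^ 4) \<in> borel_measurable M" using c(2) by measurable
    qed
    with l show ?thesis by (auto simp: has_bochner_integral_iff)
  qed
  have mI: "integrable M (\<lambda>x. indicator S x * u x ^ 4)" "I \<longlonglongrightarrow> (\<integral>x. indicator S x * u x ^ 4 \<partial>M)"
    using monotone[of "indicator S" E] int(1) I_le unfolding I_def[abs_def] by simp_all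
  have "J n \<le> E / a" for n
    using order_trans[OF IJ[of n] I_le[of n]] a by (simp add: field_simps)
  moreover have "(\<lambda>x. 1 - indicator S x :: real) \<in> borel_measurable M" by measurable
  moreover have "0 \<le> 1 - (indicator S x :: real)" for x by (simp split: split_indicator)
  ultimately have mJ: "integrable M (\<lambda>x. (1 - indicator S x) * u x ^ 4)"
    "J \<longlonglongrightarrow> (\<integral>x. (1 - indicator S x) * u x ^ 4 \<partial>M)"
    using monotone[of "\<lambda>x. 1 - indicator S x" "E / a"] int(2) unfolding J_def[abs_def] by blast+
  have "a * (\<integral>x. (1 - indicator S x) * u x ^ 4 \<partial>M) \<le> (\<integral>x. indicator S x * u x ^ 4 \<partial>M)"
    using IJ by (intro LIMSEQ_le[OF tendsto_mult[OF tendsto_const mJ(2)] mI(2)]) blast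
  with mI mJ show ?thesis by blast
qed

section \<open>The Ginzburg--Landau equation\<close>

text \<open>The first equation is tested with the damped cube of \<open>\<psi>\<close>. By the chain rule and the positivity of the kinetic term the
  real part of the integrand is bounded below by \<open>\<kappa>\<^sup>2\<close> times the part without derivatives. As the whole integrand is integrable with integral
  \<open>0\<close>, this also shows that the sixth-power term is integrable.\<close>
lemma GL_damped_inequality:
  fixes \<Omega> \<Omega>' :: "(real^2) set" and \<psi> :: "real^2 \<Rightarrow> complex"
  assumes \<Omega>: "open \<Omega>" "\<Omega> \<subseteq> \<Omega>'" and \<Omega>': "open \<Omega>'" "bounded \<Omega>'"
    and pos: "m > 0" "\<kappa> > 0"
    and GL: "GL_weak_solution \<Omega> \<Omega>' F a m \<kappa> H \<psi> A"
    and \<epsilon>: "0 < \<epsilon>" "\<epsilon> \<le> 1"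
  defines "M \<equiv> lebesgue_on \<Omega>'" and "u \<equiv> \<lambda>x. cmod (\<psi> x)"
  shows "integrable M (\<lambda>x. indicator \<Omega> x * (u x ^ 6 / (1 + \<epsilon> * (u x)\<^sup>2)))"
    and "a * (\<integral>x. (1 - indicator \<Omega> x) * (u x ^ 4 / (1 + \<epsilon> * (u x)\<^sup>2)) \<partial>M)
        + (\<integral>x. indicator \<Omega> x * (u x ^ 6 / (1 + \<epsilon> * (u x)\<^sup>2)) \<partial>M)
      \<le> (\<integral>x. indicator \<Omega> x * (u x ^ 4 / (1 + \<epsilon> * (u x)\<^sup>2)) \<partial>M)"
proof -
  \<comment> \<open>\<open>T\<close> is the cubic nonlinearity after testing, \<open>Q\<close> the tested linear term, \<open>R\<close> the real part of the whole integrand.\<close>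
  define T where "T x = indicator \<Omega> x * (u x ^ 6 / (1 + \<epsilon> * (u x)\<^sup>2))" for x
  define Q where "Q x = u x ^ 4 / (1 + \<epsilon> * (u x)\<^sup>2)" for x
  define \<phi> where "\<phi> x = damped_cube \<epsilon> (\<psi> x)" for x
  define R where "R x = Re (complex_of_real (w_weight \<Omega> m x) *
             (\<Sum>j\<in>UNIV. magnetic_gradient \<Omega>' (\<lambda>y. (\<kappa> * H) *\<^sub>R A y) \<psi> x $ j *
                        cnj (magnetic_gradient \<Omega>' (\<lambda>y. (\<kappa> * H) *\<^sub>R A y) \<phi> x $ j)) +
           complex_of_real (\<kappa>\<^sup>2) *
             (complex_of_real (V_potential \<Omega> a x) * \<psi> x +
              complex_of_real (indicator \<Omega> x * (cmod (\<psi> x))\<^sup>2) * \<psi> x) * cnj (\<phi> x))" for x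
  have \<psi>: "\<psi> \<in> H1 \<Omega>'" using GL by (simp add: GL_weak_solution_def)
  then have \<psi>m: "\<psi> \<in> borel_measurable M" and u2: "integrable M (\<lambda>x. (u x)\<^sup>2)"
    by (simp_all add: H1_def square_integrable_def M_def u_def)
  have um [measurable]: "u \<in> borel_measurable M" unfolding u_def using \<psi>m by measurable
  have \<Omega>M [measurable]: "\<Omega> \<in> sets M"
    unfolding M_def using \<Omega> by (auto simp: sets_restrict_space)
  obtain C L where CL: "\<And>z :: complex. norm (damped_cube_deriv \<epsilon> z) \<le> C"
    "\<And>v w :: complex. norm (damped_cube_deriv \<epsilon> v - damped_cube_deriv \<epsilon> w) \<le> L * norm (v - w)"
    using damped_cube_deriv_bounds[OF \<epsilon>] by blast
  have zero: "damped_cube \<epsilon> (0 :: complex) = 0" by (simp add: damped_cube_def)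
  note chain = H1_chain_rule[OF \<Omega>' \<psi> zero damped_cube_has_derivative[OF less_imp_le[OF \<epsilon>(1)]] CL]
  have "\<phi> \<in> H1 \<Omega>'" using chain(1) by (simp add: \<phi>_def[abs_def])
  then have R: "has_bochner_integral M R 0"
    using GL has_bochner_integral_bounded_linear[OF bounded_linear_Re, of M _ 0]
    unfolding GL_weak_solution_def R_def[abs_def] M_def by fastforce
  have d: "1 + \<epsilon> * (u x)\<^sup>2 \<ge> 1" for x using \<epsilon> by simp
  have T_nonneg: "T x \<ge> 0" for x unfolding T_def using d[of x] by (simp add: u_def)
  have Q_nonneg: "Q x \<ge> 0" for x unfolding Q_def using d[of x] by (simp add: u_def)

  have "AE x in M. \<forall>j\<in>UNIV. weak_partial \<Omega>' j \<phi> x = damped_cube_deriv \<epsilon> (\<psi> x) (weak_partial \<Omega>' j \<psi> x)"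
    using chain(2) unfolding M_def \<phi>_def[abs_def] by (intro AE_finite_allI) auto
  then have le: "AE x in M. \<kappa>\<^sup>2 * (V_potential \<Omega> a x * Q x + T x) \<le> R x"
  proof eventually_elim
    case (elim x)
    let ?S = "\<Sum>j\<in>UNIV. magnetic_gradient \<Omega>' (\<lambda>y. (\<kappa> * H) *\<^sub>R A y) \<psi> x $ j *
                        cnj (magnetic_gradient \<Omega>' (\<lambda>y. (\<kappa> * H) *\<^sub>R A y) \<phi> x $ j)"
    have "Re ?S \<ge> 0"
      unfolding Re_sum
    proof (rule sum_nonneg)
      fix j :: 2
      show "0 \<le> Re (magnetic_gradient \<Omega>' (\<lambda>y. (\<kappa> * H) *\<^sub>R A y) \<psi> x $ j *
          cnj (magnetic_gradient \<Omega>' (\<lambda>y. (\<kappa> * H) *\<^sub>R A y) \<phi> x $ j))"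
        using magnetic_damped_cube_nonneg[of \<epsilon> "weak_partial \<Omega>' j \<psi> x" "((\<kappa> * H) *\<^sub>R A x) $ j" "\<psi> x"] \<epsilon> elim
        by (simp add: magnetic_gradient_def \<phi>_def)
    qed
    moreover have "w_weight \<Omega> m x \<ge> 0" using pos by (simp add: w_weight_def)
    ultimately have "0 \<le> Re (complex_of_real (w_weight \<Omega> m x) * ?S)" by simp
    moreover have "Re (\<psi> x * cnj (\<phi> x)) = Q x"
    proof -
      have "\<phi> x = complex_of_real ((u x)\<^sup>2 / (1 + \<epsilon> * (u x)\<^sup>2)) * \<psi> x"
        by (simp add: \<phi>_def damped_cube_def u_def scaleR_conv_of_real)
      then have "\<psi> x * cnj (\<phi> x) = complex_of_real ((u x)\<^sup>2 / (1 + \<epsilon> * (u x)\<^sup>2)) * (\<psi> x * cnj (\<psi> x))"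
        by (simp add: mult_ac)
      also have "\<dots> = complex_of_real ((u x)\<^sup>2 / (1 + \<epsilon> * (u x)\<^sup>2) * (u x)\<^sup>2)"
        by (simp add: u_def complex_norm_square[symmetric])
      finally show ?thesis by (simp add: Q_def power2_eq_square power4_eq_xxxx)
    qed
    then have "Re (complex_of_real (\<kappa>\<^sup>2) * (complex_of_real (V_potential \<Omega> a x) * \<psi> x +
        complex_of_real (indicator \<Omega> x * (cmod (\<psi> x))\<^sup>2) * \<psi> x) * cnj (\<phi> x))
        = \<kappa>\<^sup>2 * ((V_potential \<Omega> a x + indicator \<Omega> x * (u x)\<^sup>2) * Q x)"
    proof -
      have "complex_of_real (\<kappa>\<^sup>2) * (complex_of_real (V_potential \<Omega> a x) * \<psi> x +
        complex_of_real (indicator \<Omega> x * (cmod (\<psi> x))\<^sup>2) * \<psi> x) * cnj (\<phi> x)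
        = complex_of_real (\<kappa>\<^sup>2 * (V_potential \<Omega> a x + indicator \<Omega> x * (u x)\<^sup>2)) * (\<psi> x * cnj (\<phi> x))"
        by (simp add: u_def algebra_simps)
      moreover have "Re (complex_of_real r * z) = r * Re z" for r z by simp
      ultimately show ?thesis
        using \<open>Re (\<psi> x * cnj (\<phi> x)) = Q x\<close> by (simp only: mult.assoc)
    qed
    moreover have "indicator \<Omega> x * (u x)\<^sup>2 * Q x = T x"
      by (simp add: T_def Q_def flip: power_add)
    ultimately show ?case unfolding R_def by (simp add: distrib_right)
  qed

  have Q_int: "integrable M Q"
  proof (rule Bochner_Integration.integrable_bound)
    show "integrable M (\<lambda>x. (u x)\<^sup>2 / \<epsilon>)" using u2 by simp
    have "Q x \<le> (u x)\<^sup>2 / \<epsilon>" for x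
    proof -
      have "u x ^ 4 * \<epsilon> \<le> (u x)\<^sup>2 * (1 + \<epsilon> * (u x)\<^sup>2)"
        by (simp add: power4_eq_xxxx power2_eq_square algebra_simps)
      moreover have "0 < 1 + \<epsilon> * (u x)\<^sup>2" using d[of x] by linarith
      ultimately show ?thesis
        unfolding Q_def using \<epsilon>(1) by (simp only: pos_divide_le_eq times_divide_eq_left pos_le_divide_eq)
    qed
    then show "AE x in M. norm (Q x) \<le> norm ((u x)\<^sup>2 / \<epsilon>)"
      using Q_nonneg \<epsilon> by (intro AE_I2) simp
    show "Q \<in> borel_measurable M" unfolding Q_def by measurable
  qed
  have Q1: "integrable M (\<lambda>x. indicator \<Omega> x * Q x)"
    using integrable_mult_indicator[OF \<Omega>M Q_int] by simp
  have Q2: "integrable M (\<lambda>x. (1 - indicator \<Omega> x) * Q x)"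
    using Bochner_Integration.integrable_diff[OF Q_int Q1] by (simp add: algebra_simps)
  have V: "V_potential \<Omega> a x * Q x = a * ((1 - indicator \<Omega> x) * Q x) - indicator \<Omega> x * Q x" for x
    by (simp add: V_potential_def)
  have VQ: "integrable M (\<lambda>x. V_potential \<Omega> a x * Q x)"
    unfolding V by (intro Bochner_Integration.integrable_diff integrable_mult_right Q1 Q2)
  have R_int: "integrable M R" and R_zero: "(\<integral>x. R x \<partial>M) = 0"
    using R by (simp_all add: has_bochner_integral_iff)
  have T_int: "integrable M T"
  proof (rule Bochner_Integration.integrable_bound)
    show "integrable M (\<lambda>x. R x / \<kappa>\<^sup>2 - V_potential \<Omega> a x * Q x)"
      using R_int VQ by simp
    show "AE x in M. norm (T x) \<le> norm (R x / \<kappa>\<^sup>2 - V_potential \<Omega> a x * Q x)"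
      using le
    proof eventually_elim
      case (elim x)
      then have "T x \<le> R x / \<kappa>\<^sup>2 - V_potential \<Omega> a x * Q x"
        using pos by (simp add: field_simps)
      then show ?case using T_nonneg[of x] by simp
    qed
    show "T \<in> borel_measurable M" unfolding T_def by measurable
  qed
  then show "integrable M (\<lambda>x. indicator \<Omega> x * (u x ^ 6 / (1 + \<epsilon> * (u x)\<^sup>2)))"
    by (simp add: T_def[abs_def])
  have "(\<integral>x. \<kappa>\<^sup>2 * (V_potential \<Omega> a x * Q x + T x) \<partial>M) \<le> (\<integral>x. R x \<partial>M)"
    by (intro integral_mono_AE R_int le integrable_mult_right Bochner_Integration.integrable_add VQ T_int)
  also have "(\<integral>x. \<kappa>\<^sup>2 * (V_potential \<Omega> a x * Q x + T x) \<partial>M)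
      = \<kappa>\<^sup>2 * ((\<integral>x. V_potential \<Omega> a x * Q x \<partial>M) + (\<integral>x. T x \<partial>M))"
    using VQ T_int by simp
  also have "(\<integral>x. V_potential \<Omega> a x * Q x \<partial>M)
      = a * (\<integral>x. (1 - indicator \<Omega> x) * Q x \<partial>M) - (\<integral>x. indicator \<Omega> x * Q x \<partial>M)"
    unfolding V using Q1 Q2 by (simp only: Bochner_Integration.integral_diff integrable_mult_right integral_mult_right_zero)
  finally have "a * (\<integral>x. (1 - indicator \<Omega> x) * Q x \<partial>M) - (\<integral>x. indicator \<Omega> x * Q x \<partial>M) + (\<integral>x. T x \<partial>M) \<le> 0"
    using pos by (simp add: R_zero mult_le_0_iff)
  then show "a * (\<integral>x. (1 - indicator \<Omega> x) * (u x ^ 4 / (1 + \<epsilon> * (u x)\<^sup>2)) \<partial>M)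
        + (\<integral>x. indicator \<Omega> x * (u x ^ 6 / (1 + \<epsilon> * (u x)\<^sup>2)) \<partial>M)
      \<le> (\<integral>x. indicator \<Omega> x * (u x ^ 4 / (1 + \<epsilon> * (u x)\<^sup>2)) \<partial>M)"
    by (simp add: Q_def T_def)
qed

lemma lebesgue_on_subset:
  fixes f :: "'a::euclidean_space \<Rightarrow> 'b::{banach, second_countable_topology}"
  assumes "S \<subseteq> U" "S \<in> sets lebesgue" "U \<in> sets lebesgue"
  shows "integrable (lebesgue_on S) f \<longleftrightarrow> integrable (lebesgue_on U) (\<lambda>x. indicator S x *\<^sub>R f x)"
    and "(\<integral>x. f x \<partial>lebesgue_on S) = (\<integral>x. indicator S x *\<^sub>R f x \<partial>lebesgue_on U)"
proof -
  have eq: "lebesgue_on S = restrict_space (lebesgue_on U) S"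
    using assms by (simp add: restrict_restrict_space Int_absorb1)
  have S: "S \<inter> space (lebesgue_on U) \<in> sets (lebesgue_on U)"
    using assms by (auto simp: sets_restrict_space)
  show "integrable (lebesgue_on S) f \<longleftrightarrow> integrable (lebesgue_on U) (\<lambda>x. indicator S x *\<^sub>R f x)"
    unfolding eq by (rule integrable_restrict_space[OF S])
  show "(\<integral>x. f x \<partial>lebesgue_on S) = (\<integral>x. indicator S x *\<^sub>R f x \<partial>lebesgue_on U)"
    unfolding eq by (rule integral_restrict_space[OF S])
qed

theorem theorem2p4:
  fixes \<Omega> \<Omega>' :: "(real^2) set"
    and F A :: "real^2 \<Rightarrow> real^2"
    and \<psi> :: "real^2 \<Rightarrow> complex"
    and a m \<kappa> H :: real
  assumes "open \<Omega>" and "bounded \<Omega>" and "simply_connected \<Omega>" and "smooth_boundary \<Omega>"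
    and "open \<Omega>'" and "bounded \<Omega>'" and "simply_connected \<Omega>'" and "smooth_boundary \<Omega>'"
    and "closure \<Omega> \<subseteq> \<Omega>'"
    and "unit_field_potential \<Omega>' F"
    and "a > 0" and "m > 0" and "\<kappa> > 0" and "H > 0"
    and "\<psi> \<in> H1 \<Omega>'" and "A \<in> H1_div \<Omega>'"
    and "GL_weak_solution \<Omega> \<Omega>' F a m \<kappa> H \<psi> A"
  shows "integrable (lebesgue_on (\<Omega>' - \<Omega>)) (\<lambda>x. (cmod (\<psi> x)) ^ 4) \<and>
    integrable (lebesgue_on \<Omega>) (\<lambda>x. (cmod (\<psi> x)) ^ 4) \<and>
    a * (\<integral>x. (cmod (\<psi> x)) ^ 4 \<partial>lebesgue_on (\<Omega>' - \<Omega>)) \<le> (\<integral>x. (cmod (\<psi> x)) ^ 4 \<partial>lebesgue_on \<Omega>)"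
proof -
  let ?M = "lebesgue_on \<Omega>'" and ?u = "\<lambda>x. cmod (\<psi> x)"
  have sub: "\<Omega> \<subseteq> \<Omega>'" using \<open>closure \<Omega> \<subseteq> \<Omega>'\<close> closure_subset by blast
  have leb: "\<Omega> \<in> sets lebesgue" "\<Omega>' \<in> sets lebesgue" using assms(1,5) by auto
  have "\<psi> \<in> borel_measurable ?M" and u2: "integrable ?M (\<lambda>x. (?u x)\<^sup>2)"
    using \<open>\<psi> \<in> H1 \<Omega>'\<close> by (simp_all add: H1_def square_integrable_def)
  then have u: "?u \<in> borel_measurable ?M" by measurable
  have \<Omega>: "\<Omega> \<in> sets ?M" using sub leb by (auto simp: sets_restrict_space)
  have limit: "integrable ?M (\<lambda>x. (1 - indicator \<Omega> x) * ?u x ^ 4)"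
    "integrable ?M (\<lambda>x. indicator \<Omega> x * ?u x ^ 4)"
    "a * (\<integral>x. (1 - indicator \<Omega> x) * ?u x ^ 4 \<partial>?M) \<le> (\<integral>x. indicator \<Omega> x * ?u x ^ 4 \<partial>?M)"
    using quartic_inequality_limit[OF u u2 \<Omega> \<open>a > 0\<close>]
      GL_damped_inequality[OF assms(1) sub assms(5,6,12,13,17)] by blast+
  have out: "(1 - indicator \<Omega> x) * ?u x ^ 4 = indicator (\<Omega>' - \<Omega>) x *\<^sub>R ?u x ^ 4"
    if "x \<in> space ?M" for x
    using that by (simp split: split_indicator)
  have diff: "\<Omega>' - \<Omega> \<subseteq> \<Omega>'" "\<Omega>' - \<Omega> \<in> sets lebesgue" using leb by auto
  have "integrable (lebesgue_on (\<Omega>' - \<Omega>)) (\<lambda>x. ?u x ^ 4) \<longleftrightarrow> integrable ?M (\<lambda>x. (1 - indicator \<Omega> x) * ?u x ^ 4)"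
    unfolding lebesgue_on_subset(1)[OF diff leb(2)]
    by (rule Bochner_Integration.integrable_cong[OF refl out[symmetric]])
  moreover have "(\<integral>x. ?u x ^ 4 \<partial>lebesgue_on (\<Omega>' - \<Omega>)) = (\<integral>x. (1 - indicator \<Omega> x) * ?u x ^ 4 \<partial>?M)"
    unfolding lebesgue_on_subset(2)[OF diff leb(2)]
    by (rule Bochner_Integration.integral_cong[OF refl out[symmetric]])
  moreover have "integrable (lebesgue_on \<Omega>) (\<lambda>x. ?u x ^ 4) \<longleftrightarrow> integrable ?M (\<lambda>x. indicator \<Omega> x * ?u x ^ 4)"
    unfolding lebesgue_on_subset(1)[OF sub leb] by simp
  moreover have "(\<integral>x. ?u x ^ 4 \<partial>lebesgue_on \<Omega>) = (\<integral>x. indicator \<Omega> x * ?u x ^ 4 \<partial>?M)"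
    unfolding lebesgue_on_subset(2)[OF sub leb] by simp
  ultimately show ?thesis using limit by simp
qed

end
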